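(* Let $X$ be a Banach function space over $\mathbf{R}^d$ for which there exist $1<r^*<s^*<\infty$ such that $X$ is $r^*$-convex and $s^*$-concave, and such that $$M:X\to X,\qquad M:X'\to X'$$ are bounded. Then there exist $r_0\in(1,r^*]$ and $s_0\in[s^*,\infty)$ such that for all $r\in(1,r_0]$ and $s\in[s_0,\infty)$ $$M:X_{r,s}\to X_{r,s},\qquad M:(X_{r,s})'\to(X_{r,s})'$$ are bounded.
   Context: $L^0(\mathbf{R}^d)$ is the space of measurable functions on $\mathbf{R}^d$ (Lebesgue measure, modulo a.e. equality); $q'$ is the Hölder conjugate of $q\in[1,\infty]$. Banach function space over $\mathbf{R}^d$: a vector space $X\subseteq L^0(\mathbf{R}^d)$ with a norm $\|\cdot\|_X$ satisfying: (ideal property) if $f\in X$, $g\in L^0(\mathbf{R}^d)$ and $|g|\le|f|$, then $g\in X$ and $\|g\|_X\le\|f\|_X$; (Fatou property) if $0\le f_n\uparrow f$ with $f_n\in X$ and $\sup_n\|f_n\|_X<\infty$, then $f\in X$ and $\|f\|_X=\sup_n\|f_n\|_X$; (saturation property) every measurable $E\subseteq\mathbf{R}^d$ of positive measure has a measurable subset $F\subseteq E$ of positive measure with $\mathbf{1}_F\in X$. The associate space $X'$ is the space of $g\in L^0(\mathbf{R}^d)$ with $\|g\|_{X'}:=\sup_{\|f\|_X\le1}\int_{\mathbf{R}^d}|fg|<\infty$. $X$ is $p$-convex if $\big\|(|f|^p+|g|^p)^{1/p}\big\|_X\le(\|f\|_X^p+\|g\|_X^p)^{1/p}$ for all $f,g\in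 X$, and $q$-concave if $(\|f\|_X^q+\|g\|_X^q)^{1/q}\le\big\|(|f|^q+|g|^q)^{1/q}\big\|_X$ for all $f,g\in X$. For $p\in(0,\infty)$, $X^p:=\{f\in L^0(\mathbf{R}^d):|f|^{1/p}\in X\}$ with $\|f\|_{X^p}:=\big\||f|^{1/p}\big\|_X^p$. For $1\le r<s\le\infty$ and $X$ an $r$-convex and $s$-concave Banach function space, $X_{r,s}:=\big[\big[(X^r)'\big]^{(s/r)'}\big]'$, which is again a Banach function space. $M$ is the Hardy--Littlewood maximal operator $Mf=\sup_Q\big(\frac1{|Q|}\int_Q|f|\big)\mathbf{1}_Q$, the supremum being over all cubes $Q\subseteq\mathbf{R}^d$. *)

theory Defs
  imports "HOL-Analysis.Analysis"
begin

text \<open>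
  Elements of \<open>L\<^sup>0\<close> are represented by Lebesgue measurable real-valued functions, i.e. by the
  elements of \<^term>\<open>borel_measurable lebesgue\<close>, and all pointwise relations are required almost
  everywhere instead of passing to the quotient. The ideal property makes membership and norm of a
  Banach function space invariant under almost everywhere equality. The value of
  \<open>fnorm\<close> outside \<open>fcarrier\<close> is irrelevant.
\<close>

record 'a fun_space =
  fcarrier :: "('a \<Rightarrow> real) set"
  fnorm :: "('a \<Rightarrow> real) \<Rightarrow> real"

locale banach_function_space =
  fixes X :: "(real ^ 'n::finite) fun_space"
  assumes carrier_measurable: "fcarrier X \<subseteq> borel_measurable lebesgue"
    and zero_mem: "(\<lambda>x. 0) \<in> fcarrier X"
    and add_mem: "\<lbrakk>f \<in> fcarrier X; g \<in> fcarrier X\<rbrakk> \<Longrightarrow> (\<lambda>x. f x + g x) \<in> fcarrier X"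
    and scale_mem: "f \<in> fcarrier X \<Longrightarrow> (\<lambda>x. c * f x) \<in> fcarrier X"
    and norm_nonneg: "f \<in> fcarrier X \<Longrightarrow> 0 \<le> fnorm X f"
    and norm_eq_zero_iff:
      "f \<in> fcarrier X \<Longrightarrow> fnorm X f = 0 \<longleftrightarrow> (AE x in lebesgue. f x = 0)"
    and norm_scale: "f \<in> fcarrier X \<Longrightarrow> fnorm X (\<lambda>x. c * f x) = \<bar>c\<bar> * fnorm X f"
    and norm_triangle:
      "\<lbrakk>f \<in> fcarrier X; g \<in> fcarrier X\<rbrakk> \<Longrightarrow> fnorm X (\<lambda>x. f x + g x) \<le> fnorm X f + fnorm X g"
    and ideal:
      "\<lbrakk>f \<in> fcarrier X; g \<in> borel_measurable lebesgue; AE x in lebesgue. \<bar>g x\<bar> \<le> \<bar>f x\<bar>\<rbrakk>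
        \<Longrightarrow> g \<in> fcarrier X \<and> fnorm X g \<le> fnorm X f"
    and fatou:
      "\<lbrakk>\<And>n. F n \<in> fcarrier X; f \<in> borel_measurable lebesgue;
        AE x in lebesgue. (\<forall>n. 0 \<le> F n x) \<and> incseq (\<lambda>n. F n x) \<and> (\<lambda>n. F n x) \<longlonglongrightarrow> f x;
        bdd_above (range (\<lambda>n. fnorm X (F n)))\<rbrakk>
        \<Longrightarrow> f \<in> fcarrier X \<and> fnorm X f = (SUP n. fnorm X (F n))"
    and saturation:
      "\<lbrakk>E \<in> sets lebesgue; emeasure lebesgue E > 0\<rbrakk>
        \<Longrightarrow> \<exists>A \<in> sets lebesgue. A \<subseteq> E \<and> emeasure lebesgue A > 0 \<and> indicator A \<in> fcarrier X"

definition assoc_norm ::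
    "(real ^ 'n::finite) fun_space \<Rightarrow> (real ^ 'n \<Rightarrow> real) \<Rightarrow> ennreal" where
  "assoc_norm X g =
    (SUP f \<in> {f \<in> fcarrier X. fnorm X f \<le> 1}. \<integral>\<^sup>+ x. ennreal \<bar>f x * g x\<bar> \<partial>lebesgue)"

definition associate :: "(real ^ 'n::finite) fun_space \<Rightarrow> (real ^ 'n) fun_space" where
  "associate X =
    \<lparr>fcarrier = {g \<in> borel_measurable lebesgue. assoc_norm X g < \<infinity>},
     fnorm = (\<lambda>g. enn2real (assoc_norm X g))\<rparr>"

definition p_convex :: "real \<Rightarrow> (real ^ 'n::finite) fun_space \<Rightarrow> bool" where
  "p_convex p X \<longleftrightarrow> (\<forall>f \<in> fcarrier X. \<forall>g \<in> fcarrier X.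
    fnorm X (\<lambda>x. (\<bar>f x\<bar> powr p + \<bar>g x\<bar> powr p) powr (1 / p))
      \<le> (fnorm X f powr p + fnorm X g powr p) powr (1 / p))"

definition q_concave :: "real \<Rightarrow> (real ^ 'n::finite) fun_space \<Rightarrow> bool" where
  "q_concave q X \<longleftrightarrow> (\<forall>f \<in> fcarrier X. \<forall>g \<in> fcarrier X.
    (fnorm X f powr q + fnorm X g powr q) powr (1 / q)
      \<le> fnorm X (\<lambda>x. (\<bar>f x\<bar> powr q + \<bar>g x\<bar> powr q) powr (1 / q)))"

definition space_power :: "(real ^ 'n::finite) fun_space \<Rightarrow> real \<Rightarrow> (real ^ 'n) fun_space" where
  "space_power X p =
    \<lparr>fcarrier = {f \<in> borel_measurable lebesgue. (\<lambda>x. \<bar>f x\<bar> powr (1 / p)) \<in> fcarrier X},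
     fnorm = (\<lambda>f. fnorm X (\<lambda>x. \<bar>f x\<bar> powr (1 / p)) powr p)\<rparr>"

text \<open>Only meaningful for \<open>1 < q < \<infinity>\<close>, where it is the solution of \<open>1/q + 1/q' = 1\<close>.\<close>

definition hoelder_conj :: "real \<Rightarrow> real" where
  "hoelder_conj q = q / (q - 1)"

text \<open>The space \<open>X\<^sub>r\<^sub>,\<^sub>s = [[(X\<^sup>r)']\<^bsup>(s/r)'\<^esup>]'\<close>, for finite \<open>s > r\<close>.\<close>

definition rs_space ::
    "(real ^ 'n::finite) fun_space \<Rightarrow> real \<Rightarrow> real \<Rightarrow> (real ^ 'n) fun_space" where
  "rs_space X r s =
    associate (space_power (associate (space_power X r)) (hoelder_conj (s / r)))"

text \<open>Nondegenerate cubes with sides parallel to the coordinate axes.\<close>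

definition cubes :: "(real ^ 'n::finite) set set" where
  "cubes = {cbox a (\<chi> i. a $ i + l) | a l. l > 0}"

text \<open>
  The averages are taken in \<^typ>\<open>ennreal\<close>, so that they are infinite if \<open>f\<close> is not integrable on
  the cube.
\<close>

definition maximal_function ::
    "(real ^ 'n::finite \<Rightarrow> real) \<Rightarrow> real ^ 'n \<Rightarrow> ennreal" where
  "maximal_function f x =
    (SUP Q \<in> cubes.
      (\<integral>\<^sup>+ y \<in> Q. ennreal \<bar>f y\<bar> \<partial>lebesgue) / emeasure lebesgue Q * indicator Q x)"

text \<open>
  Membership of \<open>M f\<close> in \<open>X\<close> includes that \<open>M f\<close> is finite almost everywhere;
  \<^const>\<open>enn2real\<close> alone would map the value \<open>\<infinity>\<close> to \<open>0\<close>.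
\<close>

definition maximal_bounded_on :: "(real ^ 'n::finite) fun_space \<Rightarrow> bool" where
  "maximal_bounded_on X \<longleftrightarrow> (\<exists>C. \<forall>f \<in> fcarrier X.
    (AE x in lebesgue. maximal_function f x < \<infinity>) \<and>
    (\<lambda>x. enn2real (maximal_function f x)) \<in> fcarrier X \<and>
    fnorm X (\<lambda>x. enn2real (maximal_function f x)) \<le> C * fnorm X f)"

end

theory Submission
  imports Defs
begin

text \<open>
  Every function space below is replaced by a functional \<open>\<rho>\<close> with values in \<^typ>\<open>ennreal\<close>, defined
  on nonnegative measurable functions and infinite off the space. Powers and associate spaces become
  the operations \<open>gauge_power\<close> and \<open>dual\<close>. Call \<open>\<rho>\<close> bounded if \<open>\<rho> (M f) \<le> A * \<rho> f\<close> for all \<open>f\<close>. The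
  theorem follows from three ways in which boundedness of the maximal operator \<open>M\<close> propagates.

  (1) If \<open>\<rho>\<close> is bounded, then so is \<open>\<rho>\<^sup>r\<close> for \<open>r > 1\<close> close to \<open>1\<close> (\<open>gauge_power_bounded_maximal\<close>). The
  Rubio de Francia sum \<open>w = \<Sum>k. (2A)\<^sup>-\<^sup>k M\<^sup>k f\<close> dominates \<open>f\<close>, has \<open>\<rho> w \<le> 2 * \<rho> f\<close>, and satisfies
  \<open>M w \<le> 2A w\<close>, so it is an \<open>A\<^sub>1\<close> weight. The reverse Hoelder inequality for such weights
  (\<open>A1_reverse_Hoelder\<close>) gives \<open>M (w\<^sup>r) \<le> C w\<^sup>r\<close>, with \<open>r\<close> and \<open>C\<close> depending on \<open>A\<close> only.

  (2) If \<open>\<rho>\<close> and its dual \<open>\<rho>'\<close> are bounded, then so is \<open>(\<rho>\<^sup>r)'\<close> for \<open>r > 1\<close> close to \<open>1\<close>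
  (\<open>dual_gauge_power_bounded_maximal\<close>). One has to bound \<open>\<integral> f\<^sup>r M h\<close> for \<open>\<rho> f \<le> 1\<close>, and by (1) one may
  replace \<open>f\<close> by an \<open>A\<^sub>1\<close> weight \<open>w\<close>. For these,
  \<open>\<integral> w\<^sup>r M h \<le> C \<integral> w M (h w\<^sup>r\<^sup>-\<^sup>1)\<close> (\<open>weighted_maximal_integral_le\<close>): at those points of a cube
  where \<open>w\<close> is comparable to its average, \<open>w\<^sup>r\<^sup>-\<^sup>1\<close> times the average of \<open>h\<close> is at most a constant times the
  average of \<open>h w\<^sup>r\<^sup>-\<^sup>1\<close>. The right-hand side is controlled by duality between \<open>\<rho>\<close> and \<open>\<rho>'\<close>, because \<open>h \<mapsto> h w\<^sup>r\<^sup>-\<^sup>1\<close> maps \<open>(\<rho>\<^sup>r)'\<close> boundedly to \<open>\<rho>'\<close>.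

  (3) If \<open>\<rho>\<close> is bounded, then so is \<open>\<rho>''\<close> (\<open>bidual_bounded_maximal\<close>): \<open>M\<close> is a supremum of positive linear
  operators dominated by \<open>M\<close>, and these can be moved from one factor of a pairing to the other.

  Applied to \<open>\<rho> = X\<close> these give, for \<open>1 < r \<le> r0\<close> and with constants uniform in \<open>r\<close>, the boundedness of
  \<open>\<sigma> = (X\<^sup>r)'\<close> by (2), and of \<open>\<sigma>' = (X\<^sup>r)''\<close> by (1) and (3). The exponent \<open>q = (s/r)'\<close> tends to \<open>1\<close> as \<open>s \<rightarrow> \<infinity>\<close>,
  uniformly in \<open>r\<close>. For large \<open>s\<close> the same three steps therefore apply to \<open>\<sigma>\<close> with exponent \<open>q\<close>:
  \<open>X\<^bsub>r,s\<^esub> = (\<sigma>\<^sup>q)'\<close> is bounded by (2), and its associate space \<open>(\<sigma>\<^sup>q)''\<close> is bounded by (1) and (3).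
\<close>

section \<open>Powers in the extended half-line\<close>

text \<open>
  The conventions \<open>\<infinity>\<^sup>p = \<infinity>\<close> and \<open>0\<^sup>p = 0\<close> are the right ones for \<open>p > 0\<close>, the only exponents that occur.
\<close>

definition epow :: "ennreal \<Rightarrow> real \<Rightarrow> ennreal" where
  "epow x p = (if x = \<infinity> then \<infinity> else ennreal (enn2real x powr p))"

lemma epow_top [simp]: "epow \<infinity> p = \<infinity>" "epow top p = \<infinity>"
  by (auto simp: epow_def)

lemma epow_ennreal: "0 \<le> x \<Longrightarrow> epow (ennreal x) p = ennreal (x powr p)"
  by (auto simp: epow_def)

lemma epow_zero [simp]: "epow 0 p = 0"
  using epow_ennreal[of 0 p] by simp

lemma epow_one [simp]: "epow x 1 = x"
  by (cases x) (auto simp: epow_ennreal)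

lemma epow_eq_top_iff [simp]: "epow x p = \<infinity> \<longleftrightarrow> x = \<infinity>" "epow x p = top \<longleftrightarrow> x = top"
  by (auto simp: epow_def)

lemma epow_less_top_iff [simp]: "epow x p < \<infinity> \<longleftrightarrow> x < \<infinity>" "epow x p < top \<longleftrightarrow> x < top"
  by (simp_all add: epow_def top.not_eq_extremum[symmetric])

lemma epow_eq_0_iff [simp]: "epow x p = 0 \<longleftrightarrow> x = 0"
  by (cases x) (auto simp: epow_ennreal)

lemma epow_pos_iff [simp]: "0 < epow x p \<longleftrightarrow> 0 < x"
  by (metis epow_eq_0_iff not_gr_zero)

lemma epow_mono: "\<lbrakk>x \<le> y; 0 < p\<rbrakk> \<Longrightarrow> epow x p \<le> epow y p"
  by (cases x; cases y) (auto simp: epow_ennreal powr_mono2 top_unique)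

lemma epow_epow: "epow (epow x p) q = epow x (p * q)"
  by (cases x) (auto simp: epow_ennreal powr_powr)

lemma epow_inverse_cancel: "r \<noteq> 0 \<Longrightarrow> epow (epow x r) (1 / r) = x" "r \<noteq> 0 \<Longrightarrow> epow (epow x (1 / r)) r = x"
  by (simp_all add: epow_epow)

lemma epow_add: "epow x (p + q) = epow x p * epow x q"
  by (cases x) (auto simp: epow_ennreal powr_add ennreal_mult ennreal_mult_top)

lemma epow_mult: "epow (x * y) p = epow x p * epow y p"
proof (cases "x = 0 \<or> y = 0 \<or> x = \<infinity> \<or> y = \<infinity>")
  case True
  then show ?thesis by (auto simp: ennreal_mult_top ennreal_top_mult)
next
  case False
  then obtain a b where "x = ennreal a" "0 \<le> a" "y = ennreal b" "0 \<le> b"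
    by (cases x; cases y) auto
  then show ?thesis
    by (simp add: ennreal_mult[symmetric] epow_ennreal powr_mult)
qed

lemma epow_le_iff: "0 < p \<Longrightarrow> epow x p \<le> epow y p \<longleftrightarrow> x \<le> y"
  by (metis epow_inverse_cancel(1) epow_mono less_irrefl divide_pos_pos zero_less_one)

lemma epow_measurable [measurable]:
  assumes [measurable]: "f \<in> borel_measurable M"
  shows "(\<lambda>x. epow (f x) p) \<in> borel_measurable M"
  unfolding epow_def by measurable

lemma epow_const_le: "\<lbrakk>1 \<le> c; r \<le> s\<rbrakk> \<Longrightarrow> epow (ennreal c) r \<le> epow (ennreal c) s"
  by (auto simp: epow_ennreal powr_mono intro!: ennreal_leI)

section \<open>Averages over cubes and the maximal function\<close>

abbreviation cube :: "real ^ 'n::finite \<Rightarrow> real \<Rightarrow> (real ^ 'n) set" where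
  "cube p l \<equiv> cbox p (\<chi> i. p $ i + l)"

lemma cubesI: "0 < l \<Longrightarrow> cube p l \<in> cubes"
  by (auto simp: cubes_def)

lemma cubesE:
  assumes "Q \<in> cubes" obtains p l where "Q = cube p l" "0 < l"
  using assms by (auto simp: cubes_def)

lemma mem_cube: "x \<in> cube p l \<longleftrightarrow> (\<forall>i. p $ i \<le> x $ i \<and> x $ i \<le> p $ i + l)"
  by (auto simp: mem_box_cart)

lemma emeasure_cube:
  fixes p :: "real ^ 'n::finite"
  assumes l: "0 \<le> l"
  shows "emeasure lebesgue (cube p l) = ennreal (l ^ CARD('n))"
    and "emeasure lborel (cube p l) = ennreal (l ^ CARD('n))"
proof -
  have ne: "cube p l \<noteq> {}" using l unfolding interval_ne_empty_cart by simp
  have "emeasure lborel (cube p l) = ennreal (measure lborel (cube p l))"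
    using emeasure_lborel_cbox_finite[of p "\<chi> i. p $ i + l"]
    by (intro emeasure_eq_ennreal_measure) (simp add: less_top)
  also have "measure lborel (cube p l) = (\<Prod>i\<in>(UNIV::'n set). l)"
    using content_cbox_cart[OF ne] by simp
  finally show "emeasure lborel (cube p l) = ennreal (l ^ CARD('n))" by simp
  then show "emeasure lebesgue (cube p l) = ennreal (l ^ CARD('n))" by simp
qed

lemma emeasure_cubes:
  assumes "Q \<in> cubes"
  shows "0 < emeasure lebesgue Q" "emeasure lebesgue Q < \<infinity>" "Q \<in> sets lebesgue" "Q \<noteq> {}"
    "emeasure lebesgue Q \<noteq> 0" "emeasure lebesgue Q \<noteq> \<infinity>" "emeasure lebesgue Q \<noteq> top"
proof -
  from assms obtain p l where *: "Q = cube p l" "0 < l" by (rule cubesE)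
  show "0 < emeasure lebesgue Q" "emeasure lebesgue Q < \<infinity>" "Q \<in> sets lebesgue" "Q \<noteq> {}"
    "emeasure lebesgue Q \<noteq> 0" "emeasure lebesgue Q \<noteq> \<infinity>" "emeasure lebesgue Q \<noteq> top"
    using * by (simp_all add: emeasure_cube interval_ne_empty_cart)
qed

definition avg :: "(real ^ 'n::finite \<Rightarrow> ennreal) \<Rightarrow> (real ^ 'n) set \<Rightarrow> ennreal" where
  "avg f Q = (\<integral>\<^sup>+ y \<in> Q. f y \<partial>lebesgue) / emeasure lebesgue Q"

text \<open>
  The maximal function of a function that may be infinite, so that \<open>M\<close> can be iterated and applied to
  infinite sums without finiteness conditions.
\<close>

definition maximal :: "(real ^ 'n::finite \<Rightarrow> ennreal) \<Rightarrow> real ^ 'n \<Rightarrow> ennreal" where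
  "maximal f x = (SUP Q \<in> cubes. avg f Q * indicator Q x)"

lemma maximal_function_eq: "maximal_function f = maximal (\<lambda>x. ennreal \<bar>f x\<bar>)"
  by (auto simp: maximal_function_def maximal_def avg_def)

lemma avg_times_measure: "Q \<in> cubes \<Longrightarrow> avg f Q * emeasure lebesgue Q = (\<integral>\<^sup>+ y \<in> Q. f y \<partial>lebesgue)"
  using emeasure_cubes[of Q] by (simp add: avg_def ennreal_divide_times ennreal_divide_self)

lemma avg_le_iff:
  assumes "Q \<in> cubes"
  shows "avg f Q \<le> c \<longleftrightarrow> (\<integral>\<^sup>+ y \<in> Q. f y \<partial>lebesgue) \<le> c * emeasure lebesgue Q"
proof
  assume "avg f Q \<le> c"
  then have "avg f Q * emeasure lebesgue Q \<le> c * emeasure lebesgue Q" by (rule mult_right_mono) simp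
  then show "(\<integral>\<^sup>+ y \<in> Q. f y \<partial>lebesgue) \<le> c * emeasure lebesgue Q" by (simp add: avg_times_measure assms)
next
  assume "(\<integral>\<^sup>+ y \<in> Q. f y \<partial>lebesgue) \<le> c * emeasure lebesgue Q"
  then show "avg f Q \<le> c"
    using emeasure_cubes[OF assms] unfolding avg_def by (intro divide_le_posI_ennreal) (auto simp: mult.commute)
qed

lemma less_avg_iff: "Q \<in> cubes \<Longrightarrow> c < avg f Q \<longleftrightarrow> c * emeasure lebesgue Q < (\<integral>\<^sup>+ y \<in> Q. f y \<partial>lebesgue)"
  using avg_le_iff[of Q f c] by (simp add: not_le[symmetric])

lemma avg_mono_AE:
  assumes "AE x in lebesgue. x \<in> Q \<longrightarrow> f x \<le> g x" shows "avg f Q \<le> avg g Q"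
  unfolding avg_def by (intro divide_right_mono_ennreal nn_integral_mono_AE) (use assms in \<open>auto simp: indicator_def\<close>)

lemma avg_cmult: "f \<in> borel_measurable lebesgue \<Longrightarrow> Q \<in> cubes \<Longrightarrow> avg (\<lambda>x. c * f x) Q = c * avg f Q"
  using emeasure_cubes(3)[of Q]
  by (simp add: avg_def ennreal_times_divide nn_integral_cmult mult.assoc)

lemma avg_suminf:
  assumes "\<And>n. f n \<in> borel_measurable lebesgue" "Q \<in> cubes"
  shows "avg (\<lambda>x. \<Sum>n. f n x) Q = (\<Sum>n. avg (f n) Q)"
proof -
  have [measurable]: "Q \<in> sets lebesgue" "\<And>n. f n \<in> borel_measurable lebesgue"
    using assms emeasure_cubes by auto
  have "(\<integral>\<^sup>+ y \<in> Q. (\<Sum>n. f n y) \<partial>lebesgue) = (\<integral>\<^sup>+ y. (\<Sum>n. f n y * indicator Q y) \<partial>lebesgue)"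
    by (simp add: ennreal_suminf_multc)
  also have "\<dots> = (\<Sum>n. \<integral>\<^sup>+ y \<in> Q. f n y \<partial>lebesgue)"
    by (intro nn_integral_suminf) measurable
  finally show ?thesis
    unfolding avg_def by simp
qed

lemma avg_le_maximal: "Q \<in> cubes \<Longrightarrow> x \<in> Q \<Longrightarrow> avg f Q \<le> maximal f x"
  unfolding maximal_def by (rule SUP_upper2[of Q]) auto

lemma maximal_leI: "(\<And>Q. Q \<in> cubes \<Longrightarrow> x \<in> Q \<Longrightarrow> avg f Q \<le> c) \<Longrightarrow> maximal f x \<le> c"
  unfolding maximal_def by (rule SUP_least) (auto simp: indicator_def)

lemma less_maximalE:
  assumes "c < maximal f x" obtains Q where "Q \<in> cubes" "x \<in> Q" "c < avg f Q"
proof -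
  have "\<exists>Q\<in>cubes. x \<in> Q \<and> c < avg f Q"
    using assms maximal_leI[of x f c] by (meson not_le)
  then show thesis using that by blast
qed

lemma maximal_mono_AE:
  assumes "AE x in lebesgue. f x \<le> g x" shows "maximal f x \<le> maximal g x"
proof (rule maximal_leI)
  fix Q :: "(real^'a) set" assume Q: "Q \<in> cubes" "x \<in> Q"
  have "avg f Q \<le> avg g Q" using assms by (intro avg_mono_AE) auto
  also have "\<dots> \<le> maximal g x" using Q by (rule avg_le_maximal)
  finally show "avg f Q \<le> maximal g x" .
qed

lemma maximal_suminf_le:
  assumes "\<And>n. f n \<in> borel_measurable lebesgue"
  shows "maximal (\<lambda>x. \<Sum>n. f n x) x \<le> (\<Sum>n. maximal (f n) x)"
  by (rule maximal_leI) (auto simp: avg_suminf assms intro!: suminf_le avg_le_maximal)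

lemma maximal_cmult_le:
  assumes "f \<in> borel_measurable lebesgue"
  shows "maximal (\<lambda>x. c * f x) x \<le> c * maximal f x"
  by (rule maximal_leI) (auto simp: avg_cmult assms intro!: mult_left_mono avg_le_maximal)

text \<open>
  Countably many cubes suffice to compute the maximal function. This gives measurability, and it makes
  the maximal function an increasing limit of maxima over finitely many cubes.
\<close>

definition rcubes :: "(real ^ 'n::finite) set set" where
  "rcubes = (\<lambda>(p, l). cube p l) ` ({p. \<forall>i. p $ i \<in> \<rat>} \<times> {l. 0 < l \<and> l \<in> \<rat>})"

lemma rcubes_subset: "rcubes \<subseteq> cubes"
  by (auto simp: rcubes_def intro: cubesI)

lemma countable_rcubes: "countable (rcubes :: (real ^ 'n::finite) set set)"
proof -
  have "{p::real^'n. \<forall>i. p $ i \<in> \<rat>} = (\<lambda>f. \<chi> i. f i) ` (PiE UNIV (\<lambda>_. \<rat>))"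
  proof (intro set_eqI iffI)
    fix p :: "real^'n" assume "p \<in> {p. \<forall>i. p $ i \<in> \<rat>}"
    then show "p \<in> (\<lambda>f. \<chi> i. f i) ` (PiE UNIV (\<lambda>_. \<rat>))"
      by (intro image_eqI[of _ _ "\<lambda>i. p $ i"]) auto
  qed auto
  moreover have "countable (PiE (UNIV::'n set) (\<lambda>_. \<rat> :: real set))"
    by (rule countable_PiE[OF finite]) (rule countable_rat)
  ultimately have "countable {p::real^'n. \<forall>i. p $ i \<in> \<rat>}" by simp
  moreover have "countable {l::real. 0 < l \<and> l \<in> \<rat>}"
    by (rule countable_subset[OF _ countable_rat]) auto
  ultimately show ?thesis
    unfolding rcubes_def by (intro countable_image countable_SIGMA)
qed

lemma rcubes_enumeration:
  obtains e :: "nat \<Rightarrow> (real ^ 'n::finite) set" where "range e = rcubes"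
proof -
  have "(rcubes :: (real^'n) set set) \<noteq> {}"
    unfolding rcubes_def by (auto intro!: exI[of _ "0"] exI[of _ 1])
  then show thesis using range_from_nat_into[OF _ countable_rcubes] that by blast
qed

text \<open>
  A slightly larger rational cube has nearly the same measure, while the integral over it is not smaller.
\<close>

lemma rational_cube_above:
  fixes f :: "real ^ 'n::finite \<Rightarrow> ennreal"
  assumes Q: "Q \<in> cubes" and c: "c < avg f Q"
  obtains R where "R \<in> rcubes" "Q \<subseteq> R" "c < avg f R"
proof -
  obtain p l where Ql: "Q = cube p l" and l: "0 < l" using Q by (rule cubesE)
  have "c < top" using c top_greatest by (rule order.strict_trans2)
  then obtain d where d: "c = ennreal d" "0 \<le> d" by (cases c) auto
  have "ennreal (d * l ^ CARD('n)) < (\<integral>\<^sup>+ y \<in> Q. f y \<partial>lebesgue)"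
    using c l d less_avg_iff[OF Q, of c f] by (simp add: Ql emeasure_cube ennreal_mult)
  moreover have "((\<lambda>e. ennreal (d * (l + 2 * e) ^ CARD('n))) \<longlongrightarrow> ennreal (d * (l + 2 * 0) ^ CARD('n))) (at_right 0)"
    by (intro tendsto_intros)
  ultimately have "\<forall>\<^sub>F e in at_right 0. ennreal (d * (l + 2 * e) ^ CARD('n)) < (\<integral>\<^sup>+ y \<in> Q. f y \<partial>lebesgue)"
    by (intro order_tendstoD(2)) auto
  then obtain b where b: "b > 0" and bb: "\<And>e. 0 < e \<Longrightarrow> e < b \<Longrightarrow> ennreal (d * (l + 2 * e) ^ CARD('n)) < (\<integral>\<^sup>+ y \<in> Q. f y \<partial>lebesgue)"
    by (auto simp: eventually_at_right_field)
  define e where "e = b / 2"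
  have e: "0 < e" "e < b" using b by (auto simp: e_def)
  have "\<forall>i. \<exists>r\<in>\<rat>. p $ i - e < r \<and> r < p $ i"
    using e by (intro allI Rats_dense_in_real) auto
  then obtain q where q: "\<And>i. q i \<in> \<rat> \<and> p $ i - e < q i \<and> q i < p $ i" by metis
  obtain m where m: "m \<in> \<rat>" "l + e < m" "m < l + 2 * e"
    using e Rats_dense_in_real[of "l + e" "l + 2 * e"] by auto
  let ?R = "cube (\<chi> i. q i) m"
  have R: "?R \<in> rcubes"
    unfolding rcubes_def using q m l e by (intro image_eqI[of _ _ "(\<chi> i. q i, m)"]) auto
  moreover have sub: "Q \<subseteq> ?R"
  proof
    fix x assume x: "x \<in> Q"
    show "x \<in> ?R" unfolding mem_cube
    proof
      fix i show "(\<chi> i. q i) $ i \<le> x $ i \<and> x $ i \<le> (\<chi> i. q i) $ i + m"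
        using q[of i] m x by (auto simp: Ql mem_cube dest!: spec[of _ i])
    qed
  qed
  moreover have "c < avg f ?R"
  proof -
    have m0: "0 \<le> m" using m l e by linarith
    have "c * emeasure lebesgue ?R = ennreal (d * m ^ CARD('n))"
      using d m0 by (simp only: emeasure_cube[OF m0] ennreal_mult zero_le_power)
    also have "\<dots> \<le> ennreal (d * (l + 2 * e) ^ CARD('n))"
      using d m l e by (intro ennreal_leI mult_left_mono power_mono) auto
    also have "\<dots> < (\<integral>\<^sup>+ y \<in> Q. f y \<partial>lebesgue)" using bb e by blast
    also have "\<dots> \<le> (\<integral>\<^sup>+ y \<in> ?R. f y \<partial>lebesgue)"
      using sub by (intro nn_integral_mono) (auto simp: indicator_def)
    finally show ?thesis using R rcubes_subset by (subst less_avg_iff) auto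
  qed
  ultimately show thesis using that by blast
qed

lemma maximal_eq_rational: "maximal f x = (SUP Q \<in> rcubes. avg f Q * indicator Q x)"
proof (rule antisym)
  show "maximal f x \<le> (SUP Q \<in> rcubes. avg f Q * indicator Q x)"
  proof (rule dense_ge, rule ccontr)
    fix y assume y: "(SUP Q \<in> rcubes. avg f Q * indicator Q x) < y" "\<not> maximal f x \<le> y"
    then obtain Q where "Q \<in> cubes" "x \<in> Q" "y < avg f Q" by (auto simp: not_le elim: less_maximalE)
    then obtain R where R: "R \<in> rcubes" "x \<in> R" "y < avg f R"
      using rational_cube_above[of Q y f] by blast
    then have "y \<le> (SUP Q \<in> rcubes. avg f Q * indicator Q x)"
      by (intro SUP_upper2[of R]) auto
    with y show False by auto
  qed
qed (auto simp: maximal_def intro!: SUP_subset_mono rcubes_subset)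

lemma maximal_measurable [measurable]:
  "maximal f \<in> borel_measurable lebesgue"
proof -
  have "(\<lambda>x. SUP Q \<in> rcubes. avg f Q * indicator Q x) \<in> borel_measurable lebesgue"
  proof (rule borel_measurable_SUP[OF countable_rcubes])
    fix Q :: "(real^'a) set" assume "Q \<in> rcubes"
    then have [measurable]: "Q \<in> sets lebesgue" using rcubes_subset emeasure_cubes(3) by blast
    show "(\<lambda>x. avg f Q * indicator Q x) \<in> borel_measurable lebesgue" by measurable
  qed
  then show ?thesis by (simp add: maximal_eq_rational[abs_def])
qed

section \<open>A nonnegative function is dominated by its maximal function\<close>

text \<open>
  The form in which covering arguments are used: the sets \<open>B i\<close> cover \<open>E\<close>, and the mass of each \<open>B i\<close> is
  charged to \<open>A i\<close>. Disjointness of the \<open>A i\<close> makes the charges add up to at most the mass of \<open>V\<close>.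
\<close>

lemma integral_le_of_disjoint_bounds:
  fixes f g :: "real ^ 'n::finite \<Rightarrow> ennreal"
  assumes I: "countable I" and [measurable]: "f \<in> borel_measurable lebesgue" "g \<in> borel_measurable lebesgue"
    and A: "\<And>i. i \<in> I \<Longrightarrow> A i \<in> sets lebesgue" and B: "\<And>i. i \<in> I \<Longrightarrow> B i \<in> sets lebesgue"
    and disj: "disjoint_family_on A I"
    and cover: "E \<subseteq> (\<Union>i\<in>I. B i)" and sub: "\<And>i. i \<in> I \<Longrightarrow> A i \<subseteq> V"
    and le: "\<And>i. i \<in> I \<Longrightarrow> (\<integral>\<^sup>+ x \<in> B i. f x \<partial>lebesgue) \<le> c * (\<integral>\<^sup>+ x \<in> A i. g x \<partial>lebesgue)"
  shows "(\<integral>\<^sup>+ x \<in> E. f x \<partial>lebesgue) \<le> c * (\<integral>\<^sup>+ x \<in> V. g x \<partial>lebesgue)"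
proof -
  have "(\<integral>\<^sup>+ x \<in> E. f x \<partial>lebesgue) \<le> (\<integral>\<^sup>+ x. \<integral>\<^sup>+ i. f x * indicator (B i) x \<partial>count_space I \<partial>lebesgue)"
  proof (intro nn_integral_mono)
    fix x
    show "f x * indicator E x \<le> (\<integral>\<^sup>+ i. f x * indicator (B i) x \<partial>count_space I)"
    proof (cases "x \<in> E")
      case True
      then obtain j where j: "j \<in> I" "x \<in> B j" using cover by blast
      have "f x * indicator (B j) x \<le> (\<integral>\<^sup>+ i. f x * indicator (B i) x \<partial>count_space I)"
        by (rule nn_integral_ge_point[OF j(1)])
      with j True show ?thesis by simp
    qed simp
  qed
  also have "\<dots> = (\<integral>\<^sup>+ i. (\<integral>\<^sup>+ x \<in> B i. f x \<partial>lebesgue) \<partial>count_space I)"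
    using B by (intro nn_integral_count_space_nn_integral I borel_measurable_times_ennreal
      borel_measurable_indicator) auto
  also have "\<dots> \<le> (\<integral>\<^sup>+ i. c * (\<integral>\<^sup>+ x \<in> A i. g x \<partial>lebesgue) \<partial>count_space I)"
    by (intro nn_integral_mono) (simp add: le)
  also have "\<dots> = c * (\<integral>\<^sup>+ i. (\<integral>\<^sup>+ x \<in> A i. g x \<partial>lebesgue) \<partial>count_space I)"
    by (intro nn_integral_cmult) simp
  also have "(\<integral>\<^sup>+ i. (\<integral>\<^sup>+ x \<in> A i. g x \<partial>lebesgue) \<partial>count_space I)
      = (\<integral>\<^sup>+ i. emeasure (density lebesgue g) (A i) \<partial>count_space I)"
    by (intro nn_integral_cong) (simp add: emeasure_density A)
  also have "\<dots> = emeasure (density lebesgue g) (\<Union>i\<in>I. A i)"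
    by (intro emeasure_UN_countable[symmetric] I disj) (simp add: A)
  also have "\<dots> = (\<integral>\<^sup>+ x \<in> (\<Union>i\<in>I. A i). g x \<partial>lebesgue)"
    using A I by (intro emeasure_density) auto
  also have "\<dots> \<le> (\<integral>\<^sup>+ x \<in> V. g x \<partial>lebesgue)"
    using sub by (intro nn_integral_mono) (auto simp: indicator_def)
  finally show ?thesis by (simp add: mult_left_mono)
qed

text \<open>
  An open set \<open>V\<close> around \<open>E\<close> of nearly the same measure contains nonoverlapping cubes that cover \<open>E\<close> and each
  contain a point of \<open>E\<close>. On such a cube the average of \<open>f\<close> is at most \<open>a\<close>, hence
  \<open>b * |E| \<le> \<integral>\<^sub>E f \<le> a * |V|\<close>, and \<open>|V|\<close> is as close to \<open>|E|\<close> as desired.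
\<close>

lemma measure_sublevel_zero:
  fixes f :: "real ^ 'n::finite \<Rightarrow> ennreal"
  assumes [measurable]: "f \<in> borel_measurable lebesgue"
    and ab: "0 \<le> a" "a < b"
    and E: "E = {x \<in> cbox (- vec c) (vec c). ennreal b < f x \<and> maximal f x \<le> ennreal a}" and c: "0 < c"
  shows "emeasure lebesgue E = 0"
proof -
  have eq: "E = cbox (- vec c) (vec c) \<inter> {x \<in> space lebesgue. ennreal b < f x \<and> maximal f x \<le> ennreal a}"
    unfolding E by auto
  have [measurable]: "E \<in> sets lebesgue"
    unfolding eq by (rule sets.Int, simp, measurable)
  have "emeasure lebesgue E \<le> emeasure lebesgue (cbox (- vec c) (vec c :: real^'n))"
    by (intro emeasure_mono) (auto simp: E)
  also have "\<dots> < \<infinity>"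
    using emeasure_lborel_cbox_finite by simp
  finally have fin: "emeasure lebesgue E < \<infinity>" .
  define e where "e = measure lebesgue E"
  have e: "emeasure lebesgue E = ennreal e" 
    unfolding e_def using fin by (intro emeasure_eq_ennreal_measure) auto
  have e0: "0 \<le> e" by (simp add: e_def)
  \<comment> \<open>the tolerance \<open>h\<close> bounds the excess of \<open>|V|\<close> over \<open>|E|\<close>\<close>
  have "b * e \<le> a * e + a * h" if h: "0 < h" for h
  proof -
    obtain V where V: "open V" "E \<subseteq> V" "emeasure lebesgue (V - E) < ennreal h"
      using sets_lebesgue_outer_open[OF \<open>E \<in> sets lebesgue\<close> h] by metis
    have [measurable]: "V \<in> sets lebesgue" using V(1) by auto
    \<comment> \<open>a gauge that forces every tagged cube of the dyadic covering lemma into \<open>V\<close>\<close>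
    define g where "g = (\<lambda>x. if x \<in> E then V else UNIV)"
    have "gauge g" using V by (auto simp: gauge_def g_def)
    have ne: "box (- vec c) (vec c :: real^'n) \<noteq> {}"
      using c by (simp add: interval_ne_empty_cart)
    have Esub: "E \<subseteq> cbox (- vec c) (vec c)" by (auto simp: E)
    obtain D where D: "countable D"
      "\<And>K. K \<in> D \<Longrightarrow> interior K \<noteq> {} \<and> (\<exists>c d. K = cbox c d)"
      "pairwise (\<lambda>A B. interior A \<inter> interior B = {}) D"
      "\<And>K. K \<in> D \<Longrightarrow> \<exists>x \<in> E \<inter> K. K \<subseteq> g x"
      "\<And>u v. cbox u v \<in> D \<Longrightarrow> \<exists>n::nat. \<forall>i \<in> Basis. v \<bullet> i - u \<bullet> i = (vec c \<bullet> i - (- vec c) \<bullet> i) / 2^n"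
      "E \<subseteq> \<Union>D"
      by (rule covering_lemma[OF Esub ne \<open>gauge g\<close>]) (rule that; assumption)
    have cub: "K \<in> cubes" if "K \<in> D" for K
    proof -
      obtain u v where K: "K = cbox u v" using D(2) \<open>K \<in> D\<close> by blast
      then obtain n :: nat where n: "\<And>i. i \<in> Basis \<Longrightarrow> v \<bullet> i - u \<bullet> i = (vec c \<bullet> i - (- vec c) \<bullet> i) / 2^n"
        using D(5) \<open>K \<in> D\<close> by blast
      have "v $ i - u $ i = 2 * c / 2^n" for i
        using n[of "axis i 1"] by (simp add: inner_axis axis_in_Basis_iff)
      then have "v = (\<chi> i. u $ i + 2 * c / 2^n)"
        by (simp add: vec_eq_iff algebra_simps)
      then show ?thesis using K c by (auto intro: cubesI)
    qed
    have int_meas: "emeasure lebesgue (interior K) = emeasure lebesgue K" if K: "K \<in> D" for K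
    proof -
      from cub[OF K] obtain p l where "K = cube p l" by (rule cubesE)
      then show ?thesis by (simp add: emeasure_lborel_box_eq emeasure_lborel_cbox_eq)
    qed
    have "ennreal (b * e) = (\<integral>\<^sup>+ x \<in> E. ennreal b \<partial>lebesgue)"
      using ab e0 by (simp add: nn_integral_cmult_indicator e ennreal_mult)
    also have "\<dots> \<le> (\<integral>\<^sup>+ x \<in> E. f x \<partial>lebesgue)"
      by (intro nn_integral_mono) (auto simp: E indicator_def intro: less_imp_le)
    also have "\<dots> \<le> ennreal a * (\<integral>\<^sup>+ x \<in> V. 1 \<partial>lebesgue)"
    proof (rule integral_le_of_disjoint_bounds[where I = D and A = interior and B = "\<lambda>K. K"])
      show "disjoint_family_on interior D"
        using D(3) by (auto simp: disjoint_family_on_def pairwise_def)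
      show "interior K \<subseteq> V" if "K \<in> D" for K
        using D(4)[OF that] interior_subset[of K] by (auto simp: g_def)
      show "(\<integral>\<^sup>+ x \<in> K. f x \<partial>lebesgue) \<le> ennreal a * (\<integral>\<^sup>+ x \<in> interior K. 1 \<partial>lebesgue)" if K: "K \<in> D" for K
      proof -
        obtain x where x: "x \<in> E" "x \<in> K" using D(4)[OF K] by blast
        have "avg f K \<le> maximal f x" using cub[OF K] x by (intro avg_le_maximal)
        also have "\<dots> \<le> ennreal a" using x by (simp add: E)
        finally show ?thesis 
          using int_meas[OF K] by (simp add: avg_le_iff[OF cub[OF K]])
      qed
      show "K \<in> sets lebesgue" if "K \<in> D" for K
        using emeasure_cubes(3)[OF cub[OF that]] .
    qed (use D(1,6) in auto)
    also have "(\<integral>\<^sup>+ x \<in> V. 1 \<partial>lebesgue) = emeasure lebesgue V" by simp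
    also have "\<dots> = emeasure lebesgue E + emeasure lebesgue (V - E)"
      using V(2) by (subst plus_emeasure) (auto simp: Un_absorb1 Un_Diff_cancel)
    also have "ennreal a * \<dots> \<le> ennreal a * (ennreal e + ennreal h)"
      using V(3) e by (intro mult_left_mono add_mono) auto
    also have "\<dots> = ennreal (a * e + a * h)"
      using ab e0 h by (simp add: ennreal_mult[symmetric] ennreal_plus[symmetric] distrib_left del: ennreal_plus)
    finally show ?thesis
      using ab e0 h by (subst (asm) ennreal_le_iff) auto
  qed
  then have "b * e \<le> a * e + h" if "0 < h" for h
  proof -
    have "b * e \<le> a * e + a * (h / (a + 1))"
      using that ab \<open>\<And>h. 0 < h \<Longrightarrow> b * e \<le> a * e + a * h\<close>[of "h / (a + 1)"] by simp
    also have "a * (h / (a + 1)) \<le> h" using that ab by (simp add: field_simps)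
    finally show ?thesis by simp
  qed
  then have "b * e \<le> a * e" by (rule field_le_epsilon)
  then have "e = 0" using ab e0 by (simp add: mult_le_cancel_right)
  then show ?thesis using e by simp
qed

text \<open>
  A one-sided form of the Lebesgue differentiation theorem, which recovers pointwise bounds from averages.
\<close>

lemma le_maximal_AE:
  fixes f :: "real ^ 'n::finite \<Rightarrow> ennreal"
  assumes [measurable]: "f \<in> borel_measurable lebesgue"
  shows "AE x in lebesgue. f x \<le> maximal f x"
proof -
  let ?E = "\<lambda>a b n. {x \<in> cbox (- vec (real (Suc n))) (vec (real (Suc n)) :: real^'n). ennreal b < f x \<and> maximal f x \<le> ennreal a}"
  have eq: "?E a b n = cbox (- vec (real (Suc n))) (vec (real (Suc n))) \<inter> {x \<in> space lebesgue. ennreal b < f x \<and> maximal f x \<le> ennreal a}" for a b n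
    by auto
  have meas: "?E a b n \<in> sets lebesgue" for a b n
    unfolding eq by (rule sets.Int, simp, measurable)
  have *: "AE x in lebesgue. \<forall>a\<in>\<rat>. \<forall>b\<in>\<rat>. \<forall>n. 0 \<le> a \<longrightarrow> a < b \<longrightarrow> x \<notin> ?E a b n"
    unfolding AE_ball_countable[OF countable_rat] AE_all_countable
  proof (intro ballI allI)
    fix a b :: real and n
    show "AE x in lebesgue. 0 \<le> a \<longrightarrow> a < b \<longrightarrow> x \<notin> ?E a b n"
    proof (cases "0 \<le> a \<and> a < b")
      case True
      have "emeasure lebesgue (?E a b n) = 0"
        by (rule measure_sublevel_zero[OF assms _ _ refl]) (use True in auto)
      then have "AE x in lebesgue. x \<notin> ?E a b n"
        by (intro AE_not_in null_setsI meas)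
      then show ?thesis by (rule eventually_mono) blast
    qed auto
  qed
  show ?thesis
  proof (rule AE_mp[OF *], rule AE_I2, intro impI, rule ccontr)
    fix x :: "real^'n"
    assume H: "\<forall>a\<in>\<rat>. \<forall>b\<in>\<rat>. \<forall>n. 0 \<le> a \<longrightarrow> a < b \<longrightarrow> x \<notin> ?E a b n" and "\<not> f x \<le> maximal f x"
    then have lt: "maximal f x < f x" by simp
    obtain r :: rat where r: "maximal f x < real_of_rat r" "real_of_rat r < f x"
      using ennreal_rat_dense[OF lt] by blast
    obtain s :: rat where s: "ennreal (real_of_rat r) < real_of_rat s" "real_of_rat s < f x"
      using ennreal_rat_dense[OF r(2)] by blast
    have r0: "0 \<le> real_of_rat r"
      using r(1) by (metis ennreal_neg linear not_less_zero)
    have rs: "real_of_rat r < real_of_rat s"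
      using s(1) by (metis ennreal_leI not_le)
    obtain n where n: "norm x \<le> real n" using real_arch_simple by blast
    have "x \<in> cbox (- vec (real (Suc n))) (vec (real (Suc n)))"
      unfolding mem_box_cart
    proof
      fix i have "\<bar>x $ i\<bar> \<le> real (Suc n)" using component_le_norm_cart[of x i] n by simp
      then show "(- vec (real (Suc n))) $ i \<le> x $ i \<and> x $ i \<le> vec (real (Suc n)) $ i" by (simp add: abs_le_iff)
    qed
    then have "x \<in> ?E (real_of_rat r) (real_of_rat s) n"
      using r s by auto
    then show False using H r0 rs by (auto simp: Rats_def)
  qed
qed

section \<open>Vitali coverings by cubes and level sets of weights\<close>

lemma emeasure_cube_mono:
  fixes p q :: "real ^ 'n::finite"
  assumes "0 \<le> l" "l \<le> m"
  shows "emeasure lebesgue (cube p l) \<le> emeasure lebesgue (cube q m)"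
proof -
  have m: "0 \<le> m" using assms by linarith
  have "l ^ CARD('n) \<le> m ^ CARD('n)" using assms by (intro power_mono)
  then show ?thesis
    unfolding emeasure_cube(1)[OF assms(1)] emeasure_cube(1)[OF m] by (rule ennreal_leI)
qed

text \<open>
  A cube that sticks out of \<open>cube a L\<close> can be translated back into it without losing a point of the
  intersection. This localises covering arguments to subcubes of a given cube.
\<close>

lemma fit_cube:
  fixes a c :: "real ^ 'n::finite"
  assumes "0 < L" "0 < m"
  shows "\<exists>b. cube b (min m L) \<subseteq> cube a L \<and> cube a L \<inter> cube c m \<subseteq> cube b (min m L)"
proof -
  define b :: "real ^ 'n" where "b = (\<chi> i. if L \<le> m then a $ i else max (a $ i) (min (c $ i) (a $ i + L - m)))"
  have 1: "cube b (min m L) \<subseteq> cube a L"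
  proof
    fix x assume x: "x \<in> cube b (min m L)"
    show "x \<in> cube a L" unfolding mem_cube
    proof
      fix i show "a $ i \<le> x $ i \<and> x $ i \<le> a $ i + L"
        using x[unfolded mem_cube, rule_format, of i] assms by (auto simp: b_def min_def max_def split: if_splits)
    qed
  qed
  have 2: "cube a L \<inter> cube c m \<subseteq> cube b (min m L)"
  proof
    fix x assume x: "x \<in> cube a L \<inter> cube c m"
    show "x \<in> cube b (min m L)" unfolding mem_cube
    proof
      fix i show "b $ i \<le> x $ i \<and> x $ i \<le> b $ i + min m L"
        using IntD1[OF x, unfolded mem_cube, rule_format, of i] IntD2[OF x, unfolded mem_cube, rule_format, of i] assms
        by (auto simp: b_def min_def max_def split: if_splits)
    qed
  qed
  from 1 2 show ?thesis by blast
qed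

lemma cube_subset_cball:
  fixes p :: "real ^ 'n::finite"
  assumes "0 \<le> l"
  shows "cube p l \<subseteq> cball p (real CARD('n) * l)"
proof
  fix x assume x: "x \<in> cube p l"
  have "dist p x = norm (x - p)" by (simp add: dist_norm norm_minus_commute)
  also have "\<dots> \<le> (\<Sum>i\<in>UNIV. \<bar>(x - p) $ i\<bar>)" by (rule norm_le_l1_cart)
  also have "\<dots> \<le> (\<Sum>i\<in>(UNIV::'n set). l)"
  proof (rule sum_mono)
    fix i show "\<bar>(x - p) $ i\<bar> \<le> l"
      using x[unfolded mem_cube, rule_format, of i] by simp
  qed
  finally show "x \<in> cball p (real CARD('n) * l)" by simp
qed

lemma ball_subset_cube:
  fixes p :: "real ^ 'n::finite"
  shows "ball p r \<subseteq> cube (p - vec r) (2 * r)"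
proof
  fix x assume x: "x \<in> ball p r"
  show "x \<in> cube (p - vec r) (2 * r)" unfolding mem_cube
  proof
    fix i have "\<bar>(x - p) $ i\<bar> < r"
      using component_le_norm_cart[of "x - p" i] x by (simp add: dist_norm norm_minus_commute)
    then show "(p - vec r) $ i \<le> x $ i \<and> x $ i \<le> (p - vec r) $ i + 2 * r" by (auto simp: abs_less_iff)
  qed
qed

text \<open>
  The factor in the Vitali covering lemma for cubes. A cube with corner \<open>p\<close> and side \<open>l\<close> lies in the Euclidean
  ball around \<open>p\<close> of radius \<open>d * l\<close>, where \<open>d\<close> is the dimension, and the ball of radius \<open>5 * d * l\<close> that appears
  in the covering lemma for balls lies in a cube of side \<open>10 * d * l\<close>.
\<close>

definition dilation :: "'n::finite itself \<Rightarrow> real" where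
  "dilation _ = 10 * real CARD('n)"

lemma dilation_ge: "10 \<le> dilation TYPE('n::finite)"
  by (simp add: dilation_def Suc_leI)

lemma Vitali_cubes:
  fixes p :: "'a \<Rightarrow> real ^ 'n::finite" and l :: "'a \<Rightarrow> real"
  assumes l: "\<And>i. i \<in> K \<Longrightarrow> 0 < l i \<and> l i \<le> B"
  obtains C q where "countable C" "C \<subseteq> K" "disjoint_family_on (\<lambda>i. cube (p i) (l i)) C"
    "\<And>j. j \<in> C \<Longrightarrow> cube (p j) (l j) \<subseteq> cube (q j) (dilation TYPE('n) * l j)"
    "\<And>i. i \<in> K \<Longrightarrow> \<exists>j\<in>C. cube (p i) (l i) \<subseteq> cube (q j) (dilation TYPE('n) * l j)"
proof -
  define d where "d = real CARD('n)"
  have d: "0 < d" by (simp add: d_def)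
  have "0 < d * l i \<and> d * l i \<le> d * B" if "i \<in> K" for i
    using l[OF that] d by simp
  then have dl: "\<And>i. i \<in> K \<Longrightarrow> 0 < d * l i \<and> d * l i \<le> d * B" .
  obtain C where C: "countable C" "C \<subseteq> K"
     "pairwise (\<lambda>i j. disjnt (cball (p i) (d * l i)) (cball (p j) (d * l j))) C"
     "\<And>i. i \<in> K \<Longrightarrow> \<exists>j. j \<in> C \<and> \<not> disjnt (cball (p i) (d * l i)) (cball (p j) (d * l j)) \<and>
                        cball (p i) (d * l i) \<subseteq> ball (p j) (5 * (d * l j))"
    by (rule Vitali_covering_lemma_cballs_balls[where K = K and r = "\<lambda>i. d * l i" and B = "d * B" and a = p])
      (erule dl, (rule that; assumption))
  have sub: "cube (p i) (l i) \<subseteq> cball (p i) (d * l i)" if "i \<in> K" for i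
    using cube_subset_cball[of "l i" "p i"] l[OF that] by (simp add: d_def)
  define q where "q = (\<lambda>j. p j - vec (5 * (d * l j)))"
  have *: "ball (p j) (5 * (d * l j)) \<subseteq> cube (q j) (dilation TYPE('n) * l j)" for j
    using ball_subset_cube[of "p j" "5 * (d * l j)"] by (simp add: q_def dilation_def d_def mult.assoc)
  show thesis
  proof (rule that[of C q])
    show "disjoint_family_on (\<lambda>i. cube (p i) (l i)) C"
      unfolding disjoint_family_on_def
    proof (intro ballI impI)
      fix i j assume ij: "i \<in> C" "j \<in> C" "i \<noteq> j"
      then have "disjnt (cball (p i) (d * l i)) (cball (p j) (d * l j))"
        using C(3) by (auto simp: pairwise_def)
      then show "cube (p i) (l i) \<inter> cube (p j) (l j) = {}"
        using sub[of i] sub[of j] ij C(2) by (auto simp: disjnt_def)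
    qed
    show "\<exists>j\<in>C. cube (p i) (l i) \<subseteq> cube (q j) (dilation TYPE('n) * l j)" if i: "i \<in> K" for i
      using C(4)[OF i] sub[OF i] * by blast
    show "cube (p j) (l j) \<subseteq> cube (q j) (dilation TYPE('n) * l j)" if "j \<in> C" for j
    proof -
      have "0 < l j" using l that C(2) by blast
      then have "cball (p j) (d * l j) \<subseteq> ball (p j) (5 * (d * l j))"
        using d by (intro cball_subset_ball_iff[THEN iffD2]) auto
      then show ?thesis using sub[of j] *[of j] that C(2) by blast
    qed
  qed (use C in auto)
qed

text \<open>
  The core of the reverse Hoelder inequality. Around almost every point of \<open>Q\<close> where \<open>w > t\<close> one chooses a subcube of \<open>Q\<close>
  with average larger than \<open>t\<close> that is maximal up to a factor \<open>2\<close>. A Vitali subfamily of these is disjoint, and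
  its dilations, kept inside \<open>Q\<close>, have averages at most \<open>t\<close> by maximality. So the mass of \<open>w\<close> on
  \<open>{w > t}\<close> is at most a multiple of \<open>t\<close> times the measure of the chosen cubes. On these, \<open>B * w\<close> is at least the
  maximal function and hence larger than \<open>t\<close>.
\<close>

lemma A1_level:
  fixes w :: "real ^ 'n::finite \<Rightarrow> ennreal"
  assumes [measurable]: "w \<in> borel_measurable lebesgue"
    and A1: "\<And>x. maximal w x \<le> B * w x" and Q: "Q \<in> cubes" and avgQ: "avg w Q \<le> t" and t: "t < \<infinity>"
  shows "(\<integral>\<^sup>+ x \<in> {x \<in> Q. t < w x}. w x \<partial>lebesgue)
    \<le> ennreal (dilation TYPE('n) ^ CARD('n)) * t * emeasure lebesgue {x \<in> Q. t < B * w x}"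
proof -
  define k where "k = dilation TYPE('n)"
  have k: "10 \<le> k" unfolding k_def by (rule dilation_ge)
  obtain a L where QL: "Q = cube a L" and L: "0 < L" using Q by (rule cubesE)
  have [measurable]: "Q \<in> sets lebesgue" using Q by (rule emeasure_cubes)
  define f where "f = (\<lambda>x. w x * indicator Q x)"
  have [measurable]: "f \<in> borel_measurable lebesgue" unfolding f_def by measurable
  have intQ: "(\<integral>\<^sup>+ x \<in> Q. w x \<partial>lebesgue) \<le> t * emeasure lebesgue Q"
    using avgQ by (simp add: avg_le_iff[OF Q])
  \<comment> \<open>the sides of the admissible subcubes of \<open>Q\<close> that contain \<open>x\<close>\<close>
  define T where "T = (\<lambda>x. {l. 0 < l \<and> (\<exists>p. cube p l \<subseteq> Q \<and> x \<in> cube p l \<and> t < avg w (cube p l))})"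
  define S where "S = {x \<in> Q. t < w x \<and> f x \<le> maximal f x}"
  have le_L: "l \<le> L" if "l \<in> T x" for l x
  proof -
    obtain p where "cube p l \<subseteq> Q" "0 < l" using \<open>l \<in> T x\<close> by (auto simp: T_def)
    then have "cube p l \<subseteq> cube a L" by (simp add: QL)
    then have "emeasure lebesgue (cube p l) \<le> emeasure lebesgue (cube a L)"
      by (intro emeasure_mono) auto
    then have "ennreal (l ^ CARD('n)) \<le> ennreal (L ^ CARD('n))"
      using \<open>0 < l\<close> L by (simp only: emeasure_cube less_imp_le)
    then have "l ^ CARD('n) \<le> L ^ CARD('n)" using L by (subst (asm) ennreal_le_iff) auto
    then show ?thesis using L by (meson power_mono_iff \<open>0 < l\<close> less_imp_le zero_less_card_finite)
  qed
  have ex_T: "\<exists>l. l \<in> T x" if x: "x \<in> S" for x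
  proof -
    have "t < maximal f x" using x by (auto simp: S_def f_def intro: order.strict_trans2)
    then obtain P where P: "P \<in> cubes" "x \<in> P" "t < avg f P" by (rule less_maximalE)
    obtain p l where pl: "P = cube p l" "0 < l" using P(1) by (rule cubesE)
    have ltP: "t * emeasure lebesgue P < (\<integral>\<^sup>+ y \<in> P. f y \<partial>lebesgue)"
      using P by (simp add: less_avg_iff)
    have "\<not> L < l"
    proof
      assume Ll: "L < l"
      have "(\<integral>\<^sup>+ y \<in> P. f y \<partial>lebesgue) \<le> (\<integral>\<^sup>+ y \<in> Q. w y \<partial>lebesgue)"
        by (intro nn_integral_mono) (auto simp: f_def indicator_def)
      also have "\<dots> \<le> t * emeasure lebesgue Q" by (rule intQ)
      also have "\<dots> \<le> t * emeasure lebesgue P"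
        unfolding QL pl(1) by (intro mult_left_mono emeasure_cube_mono) (use L Ll in simp_all)
      finally show False using ltP by simp
    qed
    then have lL: "min l L = l" by simp
    obtain b where b: "cube b l \<subseteq> cube a L" "cube a L \<inter> cube p l \<subseteq> cube b l"
      using fit_cube[OF L pl(2), of a p] unfolding lL by blast
    have "t * emeasure lebesgue (cube b l) = t * emeasure lebesgue P"
      using pl by (simp add: emeasure_cube)
    also have "\<dots> < (\<integral>\<^sup>+ y \<in> P. f y \<partial>lebesgue)" by (rule ltP)
    also have "\<dots> \<le> (\<integral>\<^sup>+ y \<in> cube b l. w y \<partial>lebesgue)"
      using b(2) by (intro nn_integral_mono) (auto simp: f_def indicator_def QL pl(1))
    finally have "t < avg w (cube b l)" by (simp add: less_avg_iff cubesI pl(2))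
    moreover have "x \<in> cube b l" using x P(2) b(2) pl(1) QL by (auto simp: S_def)
    ultimately have "l \<in> T x" using b(1) pl(2) by (auto simp: T_def QL)
    then show ?thesis by blast
  qed
  \<comment> \<open>more than half of the supremum of the admissible sides\<close>
  have "\<exists>l p. 0 < l \<and> cube p l \<subseteq> Q \<and> x \<in> cube p l \<and> t < avg w (cube p l) \<and> (\<forall>m\<in>T x. m < 2 * l)" if x: "x \<in> S" for x
  proof -
    have bdd: "bdd_above (T x)" using le_L by (auto intro!: bdd_aboveI)
    obtain l0 where l0: "l0 \<in> T x" using ex_T[OF x] by blast
    have "0 < l0" using l0 by (simp add: T_def)
    then have "0 < Sup (T x)" using cSup_upper[OF l0 bdd] by linarith
    then have "Sup (T x) / 2 < Sup (T x)" by simp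
    then obtain l where l: "l \<in> T x" "Sup (T x) / 2 < l"
      using less_cSup_iff[OF _ bdd] l0 by blast
    have "m < 2 * l" if "m \<in> T x" for m using cSup_upper[OF that bdd] l(2) by linarith
    then show ?thesis using l(1) by (auto simp: T_def)
  qed
  then have "\<forall>x\<in>S. \<exists>l p. 0 < l \<and> cube p l \<subseteq> Q \<and> x \<in> cube p l \<and> t < avg w (cube p l) \<and> (\<forall>m\<in>T x. m < 2 * l)"
    by blast
  from bchoice[OF this] obtain l where "\<forall>x\<in>S. \<exists>p. 0 < l x \<and> cube p (l x) \<subseteq> Q \<and> x \<in> cube p (l x)
      \<and> t < avg w (cube p (l x)) \<and> (\<forall>m\<in>T x. m < 2 * l x)" by blast
  from bchoice[OF this] obtain p where "\<forall>x\<in>S. 0 < l x \<and> cube (p x) (l x) \<subseteq> Q \<and> x \<in> cube (p x) (l x)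
      \<and> t < avg w (cube (p x) (l x)) \<and> (\<forall>m\<in>T x. m < 2 * l x)" by blast
  then have lp: "\<And>x. x \<in> S \<Longrightarrow> 0 < l x" "\<And>x. x \<in> S \<Longrightarrow> cube (p x) (l x) \<subseteq> Q"
    "\<And>x. x \<in> S \<Longrightarrow> x \<in> cube (p x) (l x)" "\<And>x. x \<in> S \<Longrightarrow> t < avg w (cube (p x) (l x))"
    "\<And>x m. x \<in> S \<Longrightarrow> m \<in> T x \<Longrightarrow> m < 2 * l x"
    by simp_all
  have inT: "l x \<in> T x" if "x \<in> S" for x using lp(1-4)[OF that] by (auto simp: T_def)
  have lL: "0 < l x \<and> l x \<le> L" if "x \<in> S" for x using le_L[OF inT[OF that]] lp(1)[OF that] by blast
  obtain C q where C: "countable C" "C \<subseteq> S" "disjoint_family_on (\<lambda>i. cube (p i) (l i)) C"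
    "\<And>j. j \<in> C \<Longrightarrow> cube (p j) (l j) \<subseteq> cube (q j) (k * l j)"
    "\<And>i. i \<in> S \<Longrightarrow> \<exists>j\<in>C. cube (p i) (l i) \<subseteq> cube (q j) (k * l j)"
    by (rule Vitali_cubes[where K = S and l = l and B = L and p = p, folded k_def])
      (erule lL, (rule that; assumption))
  have "\<exists>b. cube b (min (k * l j) L) \<subseteq> cube a L \<and> cube a L \<inter> cube (q j) (k * l j) \<subseteq> cube b (min (k * l j) L)" if "j \<in> C" for j
  proof -
    have "0 < l j" using that C(2) by (intro lp(1)) blast
    then have "0 < k * l j" using k by (intro mult_pos_pos) linarith+
    then show ?thesis by (rule fit_cube[OF L])
  qed
  then have "\<forall>j\<in>C. \<exists>b. cube b (min (k * l j) L) \<subseteq> cube a L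
      \<and> cube a L \<inter> cube (q j) (k * l j) \<subseteq> cube b (min (k * l j) L)" by blast
  from bchoice[OF this] obtain b where b: "\<And>j. j \<in> C \<Longrightarrow> cube (b j) (min (k * l j) L) \<subseteq> cube a L"
    "\<And>j. j \<in> C \<Longrightarrow> cube a L \<inter> cube (q j) (k * l j) \<subseteq> cube (b j) (min (k * l j) L)"
    by auto
  let ?R = "\<lambda>j. cube (b j) (min (k * l j) L)"
  \<comment> \<open>either the dilation fills \<open>Q\<close>, or its side is too large to be admissible\<close>
  have bound: "(\<integral>\<^sup>+ x \<in> ?R j. w x \<partial>lebesgue) \<le> ennreal (k ^ CARD('n)) * t * (\<integral>\<^sup>+ x \<in> cube (p j) (l j). 1 \<partial>lebesgue)"
    if j: "j \<in> C" for j
  proof -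
    have jS: "j \<in> S" using j C(2) by blast
    have lj: "0 < l j" using lp(1)[OF jS] .
    have m0: "0 < min (k * l j) L" using lj L k by simp
    have "(\<integral>\<^sup>+ x \<in> ?R j. w x \<partial>lebesgue) \<le> t * emeasure lebesgue (?R j)"
    proof (cases "L \<le> k * l j")
      case True
      then have eq: "min (k * l j) L = L" by simp
      have "(\<integral>\<^sup>+ x \<in> ?R j. w x \<partial>lebesgue) \<le> (\<integral>\<^sup>+ x \<in> Q. w x \<partial>lebesgue)"
        using b(1)[OF j] by (intro nn_integral_mono) (auto simp: indicator_def QL)
      also have "\<dots> \<le> t * emeasure lebesgue Q" by (rule intQ)
      also have "emeasure lebesgue Q = emeasure lebesgue (?R j)"
        unfolding eq QL using L by (simp only: emeasure_cube less_imp_le)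
      finally show ?thesis .
    next
      case False
      then have eq: "min (k * l j) L = k * l j" by simp
      have "2 * l j \<le> k * l j" using k lj by simp
      then have "k * l j \<notin> T j" using lp(5)[OF jS, of "k * l j"] by auto
      moreover have "?R j \<subseteq> Q" using b(1)[OF j] QL by simp
      moreover have "j \<in> ?R j"
        using b(2)[OF j] lp(3)[OF jS] C(4)[OF j] jS QL by (auto simp: S_def)
      moreover have "0 < k * l j" using m0 eq by simp
      ultimately have "\<not> t < avg w (?R j)" unfolding eq T_def by blast
      then show ?thesis
        using avg_le_iff[OF cubesI[OF m0], of w "b j" t] by (simp only: not_less)
    qed
    also have "emeasure lebesgue (?R j) \<le> ennreal ((k * l j) ^ CARD('n))"
      using m0 by (subst emeasure_cube) (auto intro!: ennreal_leI power_mono)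
    also have "\<dots> = ennreal (k ^ CARD('n)) * emeasure lebesgue (cube (p j) (l j))"
      using lj k by (simp add: emeasure_cube power_mult_distrib ennreal_mult)
    finally have "(\<integral>\<^sup>+ x \<in> ?R j. w x \<partial>lebesgue)
        \<le> t * (ennreal (k ^ CARD('n)) * emeasure lebesgue (cube (p j) (l j)))"
      by (simp add: mult_left_mono)
    then show ?thesis by (simp add: ac_simps)
  qed
  have "(\<integral>\<^sup>+ x \<in> {x \<in> Q. t < w x}. w x \<partial>lebesgue) = (\<integral>\<^sup>+ x \<in> S. w x \<partial>lebesgue)"
    using le_maximal_AE[OF \<open>f \<in> borel_measurable lebesgue\<close>]
    by (intro nn_integral_cong_AE) (auto elim!: eventually_mono simp: S_def indicator_def)
  also have "\<dots> \<le> ennreal (k ^ CARD('n)) * t * (\<integral>\<^sup>+ x \<in> {x \<in> Q. t < B * w x}. 1 \<partial>lebesgue)"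
  proof (rule integral_le_of_disjoint_bounds[OF C(1) _ _ _ _ C(3) _ _ bound])
    show "S \<subseteq> (\<Union>j\<in>C. ?R j)"
    proof
      fix x assume x: "x \<in> S"
      then obtain j where j: "j \<in> C" "cube (p x) (l x) \<subseteq> cube (q j) (k * l j)" using C(5) by blast
      then have "x \<in> ?R j" using b(2)[OF j(1)] lp(3)[OF x] x QL by (auto simp: S_def)
      then show "x \<in> (\<Union>j\<in>C. ?R j)" using j(1) by blast
    qed
    show "cube (p j) (l j) \<subseteq> {x \<in> Q. t < B * w x}" if j: "j \<in> C" for j
    proof
      fix x assume x: "x \<in> cube (p j) (l j)"
      have jS: "j \<in> S" using j C(2) by blast
      have "t < avg w (cube (p j) (l j))" by (rule lp(4)[OF jS])
      also have "\<dots> \<le> maximal w x" using x lp(1)[OF jS] by (intro avg_le_maximal cubesI)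
      also have "\<dots> \<le> B * w x" by (rule A1)
      finally show "x \<in> {x \<in> Q. t < B * w x}" using lp(2)[OF jS] x by auto
    qed
  qed auto
  also have "(\<integral>\<^sup>+ x \<in> {x \<in> Q. t < B * w x}. 1 \<partial>lebesgue) = emeasure lebesgue {x \<in> Q. t < B * w x}"
  proof -
    have "{x \<in> Q. t < B * w x} = Q \<inter> {x \<in> space lebesgue. t < B * w x}" by auto
    also have "\<dots> \<in> sets lebesgue" by (rule sets.Int) (measurable, measurable)
    finally show ?thesis by simp
  qed
  finally show ?thesis unfolding k_def .
qed

section \<open>The reverse Hoelder inequality for A1 weights\<close>

lemma sigma_finite_lebesgue: "sigma_finite_measure (lebesgue :: 'a::euclidean_space measure)"
proof
  obtain A :: "'a set set" where A: "countable A" "A \<subseteq> sets lborel" "\<Union>A = space lborel" "\<forall>a\<in>A. emeasure lborel a \<noteq> \<infinity>"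
    using lborel.sigma_finite_countable by blast
  have "a \<in> sets lebesgue \<and> emeasure lebesgue a \<noteq> \<infinity>" if "a \<in> A" for a
    using A(2,4) that by (auto simp: subset_iff)
  then show "\<exists>A::'a set set. countable A \<and> A \<subseteq> sets lebesgue \<and> \<Union> A = space lebesgue \<and> (\<forall>a\<in>A. emeasure lebesgue a \<noteq> \<infinity>)"
    using A(1,3) by (intro exI[of _ A] conjI ballI subsetI) (simp, blast, simp, blast)
qed

text \<open>
  Fubini for the region under the graph of \<open>F\<close>. It turns inequalities between level sets into inequalities
  between integrals.
\<close>

lemma layer_cake:
  fixes v F :: "'a::euclidean_space \<Rightarrow> ennreal"
  assumes [measurable]: "v \<in> borel_measurable lebesgue" "F \<in> borel_measurable lebesgue" "\<phi> \<in> borel_measurable lborel"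
  shows "(\<integral>\<^sup>+ x. v x * (\<integral>\<^sup>+ t. \<phi> t * indicator {t. ennreal t < F x} t \<partial>lborel) \<partial>lebesgue)
    = (\<integral>\<^sup>+ t. \<phi> t * (\<integral>\<^sup>+ x \<in> {x. ennreal t < F x}. v x \<partial>lebesgue) \<partial>lborel)"
proof -
  interpret L: sigma_finite_measure "lebesgue :: 'a measure" by (rule sigma_finite_lebesgue)
  interpret P: pair_sigma_finite "lebesgue :: 'a measure" "lborel :: real measure" ..
  let ?h = "\<lambda>x t. v x * (\<phi> t * (if ennreal t < F x then 1 else 0))"
  have [measurable]: "\<phi> \<in> borel_measurable borel" using assms(3) by simp
  have "(\<integral>\<^sup>+ x. v x * (\<integral>\<^sup>+ t. \<phi> t * indicator {t. ennreal t < F x} t \<partial>lborel) \<partial>lebesgue)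
    = (\<integral>\<^sup>+ x. (\<integral>\<^sup>+ t. ?h x t \<partial>lborel) \<partial>lebesgue)"
    by (intro nn_integral_cong, subst nn_integral_cmult[symmetric]) (auto simp: indicator_def intro!: nn_integral_cong)
  also have "\<dots> = (\<integral>\<^sup>+ t. (\<integral>\<^sup>+ x. ?h x t \<partial>lebesgue) \<partial>lborel)"
    by (intro P.Fubini'[symmetric]) measurable
  also have "\<dots> = (\<integral>\<^sup>+ t. \<phi> t * (\<integral>\<^sup>+ x \<in> {x. ennreal t < F x}. v x \<partial>lebesgue) \<partial>lborel)"
    by (intro nn_integral_cong, subst nn_integral_cmult[symmetric]) (auto simp: indicator_def mult_ac intro!: nn_integral_cong)
  finally show ?thesis .
qed

lemma layer_cake_linear:
  fixes v F :: "'a::euclidean_space \<Rightarrow> ennreal"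
  assumes [measurable]: "v \<in> borel_measurable lebesgue" "F \<in> borel_measurable lebesgue"
  shows "(\<integral>\<^sup>+ x. v x * F x \<partial>lebesgue)
    = (\<integral>\<^sup>+ t. indicator {0<..} t * (\<integral>\<^sup>+ x \<in> {x. ennreal t < F x}. v x \<partial>lebesgue) \<partial>lborel)"
proof -
  have "(\<integral>\<^sup>+ t. indicator {0<..} t * indicator {t. ennreal t < y} t \<partial>lborel) = y" for y
  proof (cases y)
    case (real a)
    have "(\<integral>\<^sup>+ t. indicator {0<..} t * indicator {t. ennreal t < y} t \<partial>lborel) = (\<integral>\<^sup>+ t. indicator {0<..<a} t \<partial>lborel)"
      using real by (intro nn_integral_cong) (auto simp: indicator_def ennreal_less_iff)
    also have "\<dots> = y" using real by simp
    finally show ?thesis .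
  next
    case top
    have "(\<integral>\<^sup>+ t. indicator {0<..} t * indicator {t. ennreal t < y} t \<partial>lborel) = (\<integral>\<^sup>+ t. indicator {0::real<..} t \<partial>lborel)"
      using top by (intro nn_integral_cong) (auto simp: indicator_def)
    also have "\<dots> = emeasure lborel {0::real<..}" by simp
    also have "\<dots> = y"
    proof -
      have "ennreal a \<le> emeasure lborel {0::real<..}" if "0 \<le> a" for a :: real
      proof -
        have "ennreal a = emeasure lborel {0<..<a}" using that by simp
        also have "\<dots> \<le> emeasure lborel {0::real<..}" by (intro emeasure_mono) auto
        finally show ?thesis .
      qed
      then have le: "ennreal (enn2real (emeasure lborel {0::real<..}) + 1) \<le> emeasure lborel {0::real<..}"
        by (simp del: ennreal_plus)
      show ?thesis
      proof (cases "emeasure lborel {0::real<..}")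
        case (real c)
        then show ?thesis using le by (simp add: ennreal_le_iff)
      qed (simp add: top)
    qed
    finally show ?thesis .
  qed
  then have "(\<integral>\<^sup>+ x. v x * F x \<partial>lebesgue) = (\<integral>\<^sup>+ x. v x * (\<integral>\<^sup>+ t. indicator {0<..} t * indicator {t. ennreal t < F x} t \<partial>lborel) \<partial>lebesgue)"
    by simp
  also have "\<dots> = (\<integral>\<^sup>+ t. indicator {0<..} t * (\<integral>\<^sup>+ x \<in> {x. ennreal t < F x}. v x \<partial>lebesgue) \<partial>lborel)"
    by (rule layer_cake) auto
  finally show ?thesis .
qed

text \<open>
  The levels below \<open>m\<close> contribute at most \<open>m powr \<delta>\<close>; above \<open>m\<close> the integrand is the derivative of
  \<open>t powr \<delta>\<close>. The truncation at \<open>N\<close> keeps the integral in \<open>A1_power_integral_le\<close> finite.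
\<close>

lemma truncated_power_le:
  assumes \<delta>: "0 < \<delta>" and m: "0 < m" "m \<le> N"
  shows "epow (min y (ennreal N)) \<delta> \<le> ennreal (m powr \<delta>)
    + (\<integral>\<^sup>+ t. (ennreal (\<delta> * t powr (\<delta> - 1)) * indicator {m..N} t) * indicator {t. ennreal t < y} t \<partial>lborel)" (is "_ \<le> _ + ?I")
proof -
  define b where "b = enn2real (min y (ennreal N))"
  have "min y (ennreal N) < top" by (simp add: min_less_iff_disj)
  then have b: "min y (ennreal N) = ennreal b" "0 \<le> b" by (auto simp: b_def)
  have bN: "b \<le> N"
  proof -
    have "ennreal b \<le> ennreal N" unfolding b(1)[symmetric] by simp
    then show ?thesis using m by (simp add: ennreal_le_iff)
  qed
  have by': "ennreal b \<le> y" unfolding b(1)[symmetric] by simp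
  show ?thesis
  proof (cases "b \<le> m")
    case True
    then have "epow (ennreal b) \<delta> \<le> ennreal (m powr \<delta>)"
      using b \<delta> by (auto simp: epow_ennreal intro!: ennreal_leI powr_mono2)
    also have "\<dots> \<le> ennreal (m powr \<delta>) + ?I" by simp
    finally show ?thesis unfolding b(1) .
  next
    case False
    have "(\<integral>\<^sup>+ t. ennreal (\<delta> * t powr (\<delta> - 1) * indicator {0<..} t) * indicator {m..b} t \<partial>lborel) = ennreal (b powr \<delta> - m powr \<delta>)"
    proof (rule nn_integral_FTC_Icc)
      fix t assume t: "t \<in> {m..b}"
      then have "0 < t" using m by auto
      then show "((\<lambda>t. t powr \<delta>) has_real_derivative \<delta> * t powr (\<delta> - 1) * indicator {0<..} t) (at t)"
        by (auto intro!: derivative_eq_intros)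
      show "0 \<le> \<delta> * t powr (\<delta> - 1) * indicator {0<..} t" using \<delta> by simp
    qed (use False in auto)
    moreover have "(\<integral>\<^sup>+ t. ennreal (\<delta> * t powr (\<delta> - 1) * indicator {0<..} t) * indicator {m..b} t \<partial>lborel)
      \<le> ?I"
    proof (rule nn_integral_mono_AE, rule eventually_mono[OF AE_lborel_singleton[of b]])
      fix t :: real assume "t \<noteq> b"
      show "ennreal (\<delta> * t powr (\<delta> - 1) * indicator {0<..} t) * indicator {m..b} t
        \<le> (ennreal (\<delta> * t powr (\<delta> - 1)) * indicator {m..N} t) * indicator {t. ennreal t < y} t"
      proof (cases "t \<in> {m..b}")
        case True
        then have "t < b" "0 < t" "t \<in> {m..N}" using \<open>t \<noteq> b\<close> m bN by auto
        moreover have "ennreal t < ennreal b" using \<open>t < b\<close> \<open>0 < t\<close> by (simp add: ennreal_less_iff)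
        then have "ennreal t < y" using by' by (rule order.strict_trans2)
        ultimately show ?thesis using True by simp
      qed simp
    qed
    ultimately have "ennreal (b powr \<delta> - m powr \<delta>) \<le> ?I"
      by simp
    then have "ennreal (m powr \<delta>) + ennreal (b powr \<delta> - m powr \<delta>) \<le> ennreal (m powr \<delta>) + ?I"
      by (rule add_left_mono)
    moreover have "ennreal (m powr \<delta>) + ennreal (b powr \<delta> - m powr \<delta>) = epow (ennreal b) \<delta>"
      using False m b \<delta> by (subst ennreal_plus[symmetric]) (auto simp: epow_ennreal powr_mono2)
    ultimately show ?thesis unfolding b(1) by simp
  qed
qed

lemma truncated_power_layer_le:
  assumes \<delta>: "0 < \<delta>" and m: "0 < m" and N: "0 < N"
  shows "(\<integral>\<^sup>+ t. (ennreal (t powr \<delta>) * indicator {m..N} t) * indicator {t. ennreal t < y} t \<partial>lborel)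
    \<le> y * epow (min y (ennreal N)) \<delta>"
proof (cases y)
    case (real a)
    have "(\<integral>\<^sup>+ t. (ennreal (t powr \<delta>) * indicator {m..N} t) * indicator {t. ennreal t < y} t \<partial>lborel)
      \<le> (\<integral>\<^sup>+ t. epow (min y (ennreal N)) \<delta> * indicator {0<..a} t \<partial>lborel)"
    proof (rule nn_integral_mono)
      fix t :: real
      show "(ennreal (t powr \<delta>) * indicator {m..N} t) * indicator {t. ennreal t < y} t \<le> epow (min y (ennreal N)) \<delta> * indicator {0<..a} t"
      proof (cases "t \<in> {m..N} \<and> ennreal t < y")
        case True
        then have t: "0 < t" "t \<le> N" "t < a" using m real by (auto simp: ennreal_less_iff)
        have "ennreal (t powr \<delta>) = epow (ennreal t) \<delta>" using t by (simp add: epow_ennreal)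
        also have "\<dots> \<le> epow (min y (ennreal N)) \<delta>"
          using t \<delta> real by (intro epow_mono) (auto simp: ennreal_leI)
        finally show ?thesis using True t by simp
      qed (auto simp: indicator_def)
    qed
    also have "\<dots> = epow (min y (ennreal N)) \<delta> * y"
      using real by (simp add: nn_integral_cmult)
    finally show ?thesis by (simp add: mult.commute)
  next
    case top
    then show ?thesis using N by (simp add: ennreal_top_mult)
  qed

text \<open>
  By the layer cake formula and \<open>A1_level\<close>, the integral \<open>I\<close> on the left is at most
  \<open>m powr (1 + \<delta>) * |Q| + K * \<delta> * B\<^sup>2 * I\<close>, where \<open>K\<close> is the constant of \<open>A1_level\<close>. For small \<open>\<delta>\<close> the last
  term is at most \<open>I / 2\<close> and can be absorbed, as \<open>I\<close> is finite thanks to the truncation.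
\<close>

lemma A1_power_integral_le:
  fixes w :: "real ^ 'n::finite \<Rightarrow> ennreal"
  assumes [measurable]: "w \<in> borel_measurable lebesgue"
    and A1: "\<And>x. maximal w x \<le> ennreal B * w x" and B: "1 \<le> B" 
    and Q: "Q \<in> cubes" and m: "0 < m" "avg w Q \<le> ennreal m"
    and \<delta>: "0 < \<delta>" "\<delta> \<le> 1" "2 * dilation TYPE('n) ^ CARD('n) * \<delta> * B\<^sup>2 \<le> 1" and N: "m \<le> N"
  shows "(\<integral>\<^sup>+ x \<in> Q. w x * epow (min (w x) (ennreal N)) \<delta> \<partial>lebesgue) \<le> 2 * ennreal (m powr (1 + \<delta>)) * emeasure lebesgue Q"
proof -
  define K where "K = dilation TYPE('n) ^ CARD('n)"
  have K: "0 \<le> K" using dilation_ge[where 'n='n] by (simp add: K_def)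
  have [measurable]: "Q \<in> sets lebesgue" using Q by (rule emeasure_cubes)
  have Npos: "0 < N" using m N by linarith
  define \<psi> where "\<psi> = (\<lambda>x. epow (min (w x) (ennreal N)) \<delta>)"
  have [measurable]: "\<psi> \<in> borel_measurable lebesgue" unfolding \<psi>_def by measurable
  define I where "I = (\<integral>\<^sup>+ x \<in> Q. w x * \<psi> x \<partial>lebesgue)"
  define v where "v = (\<lambda>x. w x * indicator Q x)"
  have [measurable]: "v \<in> borel_measurable lebesgue" unfolding v_def by measurable
  define E where "E = emeasure lebesgue Q"
  have intQ: "(\<integral>\<^sup>+ x. v x \<partial>lebesgue) \<le> ennreal m * E"
    using m unfolding avg_le_iff[OF Q] by (simp add: v_def E_def)
  have E: "E < \<infinity>" using emeasure_cubes[OF Q] by (simp add: E_def)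
  have "I \<le> (\<integral>\<^sup>+ x. v x * ennreal (N powr \<delta>) \<partial>lebesgue)"
    unfolding I_def
  proof (intro nn_integral_mono)
    fix x
    have "\<psi> x \<le> epow (ennreal N) \<delta>" unfolding \<psi>_def using \<delta> by (intro epow_mono) auto
    then have "\<psi> x \<le> ennreal (N powr \<delta>)" using Npos by (simp add: epow_ennreal)
    then show "w x * \<psi> x * indicator Q x \<le> v x * ennreal (N powr \<delta>)"
      by (auto simp: v_def indicator_def intro: mult_left_mono)
  qed
  also have "\<dots> = (\<integral>\<^sup>+ x. v x \<partial>lebesgue) * ennreal (N powr \<delta>)"
    by (rule nn_integral_multc) measurable
  also have "\<dots> \<le> ennreal m * E * ennreal (N powr \<delta>)" by (intro mult_right_mono intQ) simp
  also have "\<dots> < \<infinity>" using E by (simp add: ennreal_mult_less_top)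
  \<comment> \<open>finiteness permits the absorption at the end\<close>
  finally have Ifin: "I < \<infinity>" .
  let ?J = "\<lambda>t. (\<integral>\<^sup>+ x \<in> {x. ennreal t < ennreal B * w x}. indicator Q x \<partial>lebesgue)"
  let ?\<phi> = "\<lambda>t. ennreal (\<delta> * t powr (\<delta> - 1)) * indicator {m..N} t"
  let ?W = "\<lambda>x. (\<integral>\<^sup>+ t. ?\<phi> t * indicator {t. ennreal t < w x} t \<partial>lborel)"
  have "I \<le> (\<integral>\<^sup>+ x. v x * ennreal (m powr \<delta>) + v x * ?W x \<partial>lebesgue)"
    unfolding I_def
  proof (intro nn_integral_mono)
    fix x
    have "w x * \<psi> x * indicator Q x = v x * \<psi> x" by (simp add: v_def ac_simps)
    also have "\<dots> \<le> v x * (ennreal (m powr \<delta>) + ?W x)"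
      unfolding \<psi>_def using truncated_power_le[OF \<delta>(1) m(1) N] by (intro mult_left_mono) auto
    finally show "w x * \<psi> x * indicator Q x \<le> v x * ennreal (m powr \<delta>) + v x * ?W x"
      by (simp add: distrib_left)
  qed
  also have "\<dots> = (\<integral>\<^sup>+ x. v x * ennreal (m powr \<delta>) \<partial>lebesgue) + (\<integral>\<^sup>+ x. v x * ?W x \<partial>lebesgue)"
  proof (rule nn_integral_add)
    have "(\<lambda>x. v x * (\<integral>\<^sup>+ t. ?\<phi> t * (if ennreal t < w x then 1 else 0) \<partial>lborel)) \<in> borel_measurable lebesgue"
      by measurable
    then show "(\<lambda>x. v x * ?W x) \<in> borel_measurable lebesgue"
      by (simp add: indicator_def of_bool_def)
  qed measurable
  also have "(\<integral>\<^sup>+ x. v x * ennreal (m powr \<delta>) \<partial>lebesgue) \<le> ennreal (m powr (1 + \<delta>)) * E"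
  proof -
    have "(\<integral>\<^sup>+ x. v x * ennreal (m powr \<delta>) \<partial>lebesgue) = (\<integral>\<^sup>+ x. v x \<partial>lebesgue) * ennreal (m powr \<delta>)"
      by (rule nn_integral_multc) measurable
    also have "\<dots> \<le> ennreal m * E * ennreal (m powr \<delta>)" by (intro mult_right_mono intQ) simp
    also have "\<dots> = ennreal (m powr (1 + \<delta>)) * E"
      using m by (simp add: powr_add ennreal_mult ac_simps)
    finally show ?thesis .
  qed
  also have "(\<integral>\<^sup>+ x. v x * ?W x \<partial>lebesgue)
    = (\<integral>\<^sup>+ t. ?\<phi> t * (\<integral>\<^sup>+ x \<in> {x. ennreal t < w x}. v x \<partial>lebesgue) \<partial>lborel)"
    by (rule layer_cake) measurable
  also have "\<dots> \<le> (\<integral>\<^sup>+ t. ennreal (K * \<delta>) * ((ennreal (t powr \<delta>) * indicator {m..N} t) * ?J t) \<partial>lborel)"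
  proof (rule nn_integral_mono)
    fix t :: real
    show "?\<phi> t * (\<integral>\<^sup>+ x \<in> {x. ennreal t < w x}. v x \<partial>lebesgue)
      \<le> ennreal (K * \<delta>) * ((ennreal (t powr \<delta>) * indicator {m..N} t) * ?J t)"
    proof (cases "t \<in> {m..N}")
      case True
      then have t: "0 < t" "m \<le> t" using m by auto
      have seq: "{x \<in> Q. ennreal t < ennreal B * w x} = Q \<inter> {x \<in> space lebesgue. ennreal t < ennreal B * w x}" by auto
      have [measurable]: "{x \<in> Q. ennreal t < ennreal B * w x} \<in> sets lebesgue"
        unfolding seq by (rule sets.Int) (measurable, measurable)
      have "(\<integral>\<^sup>+ x \<in> {x. ennreal t < w x}. v x \<partial>lebesgue) = (\<integral>\<^sup>+ x \<in> {x \<in> Q. ennreal t < w x}. w x \<partial>lebesgue)"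
        by (intro nn_integral_cong) (auto simp: v_def indicator_def)
      also have "\<dots> \<le> ennreal K * ennreal t * emeasure lebesgue {x \<in> Q. ennreal t < ennreal B * w x}"
        unfolding K_def using order.trans[OF m(2) ennreal_leI[OF t(2)]] by (intro A1_level A1 Q) auto
      also have "emeasure lebesgue {x \<in> Q. ennreal t < ennreal B * w x} = (\<integral>\<^sup>+ x. indicator {x \<in> Q. ennreal t < ennreal B * w x} x \<partial>lebesgue)"
        by (rule nn_integral_indicator[symmetric]) fact
      also have "\<dots> = ?J t"
        by (intro nn_integral_cong) (auto simp: indicator_def)
      finally have "?\<phi> t * (\<integral>\<^sup>+ x \<in> {x. ennreal t < w x}. v x \<partial>lebesgue)
         \<le> ?\<phi> t * (ennreal K * ennreal t * ?J t)"
        by (intro mult_left_mono) auto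
      also have "\<dots> = (ennreal (\<delta> * t powr (\<delta> - 1)) * ennreal K * ennreal t) * ?J t"
        using True by (simp add: ac_simps)
      also have "ennreal (\<delta> * t powr (\<delta> - 1)) * ennreal K * ennreal t = ennreal (\<delta> * t powr (\<delta> - 1) * K * t)"
        using \<delta> K t by (simp add: ennreal_mult)
      also have "\<delta> * t powr (\<delta> - 1) * K * t = K * \<delta> * t powr \<delta>"
        using t by (simp add: powr_diff)
      also have "ennreal (K * \<delta> * t powr \<delta>) = ennreal (K * \<delta>) * ennreal (t powr \<delta>)"
        using \<delta> K by (simp add: ennreal_mult)
      finally show ?thesis using True by (simp add: ac_simps)
    qed simp
  qed
  also have "\<dots> = ennreal (K * \<delta>) * (\<integral>\<^sup>+ t. ((ennreal (t powr \<delta>) * indicator {m..N} t) * ?J t) \<partial>lborel)"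
  proof (rule nn_integral_cmult)
    interpret L: sigma_finite_measure "lebesgue :: (real^'n) measure" by (rule sigma_finite_lebesgue)
    have "(\<lambda>t. (ennreal (t powr \<delta>) * indicator {m..N} t) * (\<integral>\<^sup>+ x. indicator Q x * (if ennreal t < ennreal B * w x then 1 else 0) \<partial>lebesgue)) \<in> borel_measurable lborel"
      by measurable
    then show "(\<lambda>t. (ennreal (t powr \<delta>) * indicator {m..N} t) * ?J t) \<in> borel_measurable lborel"
      by (simp add: indicator_def of_bool_def)
  qed
  also have "(\<integral>\<^sup>+ t. ((ennreal (t powr \<delta>) * indicator {m..N} t) * ?J t) \<partial>lborel)
    = (\<integral>\<^sup>+ x. indicator Q x * (\<integral>\<^sup>+ t. (ennreal (t powr \<delta>) * indicator {m..N} t) * indicator {t. ennreal t < ennreal B * w x} t \<partial>lborel) \<partial>lebesgue)"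
    by (rule layer_cake[symmetric]) measurable
  also have "\<dots> \<le> (\<integral>\<^sup>+ x. ennreal (B\<^sup>2) * (w x * \<psi> x * indicator Q x) \<partial>lebesgue)"
  proof (rule nn_integral_mono)
    fix x
    have "(\<integral>\<^sup>+ t. (ennreal (t powr \<delta>) * indicator {m..N} t) * indicator {t. ennreal t < ennreal B * w x} t \<partial>lborel)
       \<le> ennreal B * w x * epow (min (ennreal B * w x) (ennreal N)) \<delta>"
      using truncated_power_layer_le[OF \<delta>(1) m(1) Npos] .
    also have "\<dots> \<le> ennreal B * w x * epow (ennreal B * min (w x) (ennreal N)) \<delta>"
    proof (intro mult_left_mono epow_mono)
      have "1 * ennreal N \<le> ennreal B * ennreal N" using B by (intro mult_right_mono) auto
      then show "min (ennreal B * w x) (ennreal N) \<le> ennreal B * min (w x) (ennreal N)"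
        by (auto simp: min_def)
    qed (use \<delta> in auto)
    also have "epow (ennreal B * min (w x) (ennreal N)) \<delta> = epow (ennreal B) \<delta> * \<psi> x"
      by (simp add: epow_mult \<psi>_def)
    also have "ennreal B * w x * (epow (ennreal B) \<delta> * \<psi> x) \<le> ennreal B * w x * (ennreal B * \<psi> x)"
      using epow_const_le[OF B \<delta>(2)] by (intro mult_left_mono mult_right_mono) auto
    also have "\<dots> = ennreal (B\<^sup>2) * (w x * \<psi> x)"
      using B by (simp add: power2_eq_square ennreal_mult ac_simps)
    finally show "indicator Q x * (\<integral>\<^sup>+ t. (ennreal (t powr \<delta>) * indicator {m..N} t) * indicator {t. ennreal t < ennreal B * w x} t \<partial>lborel)
       \<le> ennreal (B\<^sup>2) * (w x * \<psi> x * indicator Q x)"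
      by (auto simp: indicator_def)
  qed
  also have "\<dots> = ennreal (B\<^sup>2) * I"
    unfolding I_def by (rule nn_integral_cmult) measurable
  finally have main: "I \<le> ennreal (m powr (1 + \<delta>)) * E + ennreal (K * \<delta>) * (ennreal (B\<^sup>2) * I)"
    by (simp add: add_mono mult_left_mono)
  obtain i where i: "I = ennreal i" "0 \<le> i" using Ifin by (cases I) auto
  obtain e where e: "E = ennreal e" "0 \<le> e" using E by (cases E) auto
  have "i \<le> m powr (1 + \<delta>) * e + K * \<delta> * (B\<^sup>2 * i)"
    using main i e K \<delta> unfolding i(1) e(1)
    by (simp add: ennreal_mult[symmetric] ennreal_plus[symmetric] ennreal_le_iff del: ennreal_plus)
  moreover have "K * \<delta> * (B\<^sup>2 * i) \<le> i / 2"
    using mult_right_mono[OF \<delta>(3) i(2)] by (simp add: K_def[symmetric] ac_simps)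
  ultimately have "i \<le> 2 * m powr (1 + \<delta>) * e" by linarith
  then have "I \<le> ennreal (2 * m powr (1 + \<delta>) * e)" unfolding i(1) by (rule ennreal_leI)
  also have "\<dots> = 2 * ennreal (m powr (1 + \<delta>)) * E"
    using e by (simp add: ennreal_mult)
  finally show ?thesis unfolding I_def \<psi>_def E_def .
qed

text \<open>
  Monotone convergence removes the truncation from \<open>A1_power_integral_le\<close>, with \<open>m\<close> the average of \<open>w\<close>. If that average
  is \<open>0\<close>, then \<open>w\<close> vanishes almost everywhere on \<open>Q\<close>.
\<close>

lemma A1_reverse_Hoelder:
  fixes w :: "real ^ 'n::finite \<Rightarrow> ennreal"
  assumes [measurable]: "w \<in> borel_measurable lebesgue" and fin: "AE x in lebesgue. w x < \<infinity>"
    and A1: "\<And>x. maximal w x \<le> ennreal B * w x" and B: "1 \<le> B" and Q: "Q \<in> cubes"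
    and \<delta>: "0 < \<delta>" "\<delta> \<le> 1" "2 * dilation TYPE('n) ^ CARD('n) * \<delta> * B\<^sup>2 \<le> 1"
  shows "avg (\<lambda>x. epow (w x) (1 + \<delta>)) Q \<le> 2 * epow (avg w Q) (1 + \<delta>)"
proof (cases "avg w Q")
  case top
  then show ?thesis by (simp add: ennreal_mult_top)
next
  case (real m)
  have [measurable]: "Q \<in> sets lebesgue" using Q by (rule emeasure_cubes)
  show ?thesis
  proof (cases "m = 0")
    case True
    then have "(\<integral>\<^sup>+ x \<in> Q. w x \<partial>lebesgue) = 0"
      using avg_times_measure[OF Q, of w] real by simp
    then have "AE x in lebesgue. w x * indicator Q x = 0"
      by (subst (asm) nn_integral_0_iff_AE) auto
    then have "AE x in lebesgue. epow (w x) (1 + \<delta>) * indicator Q x = 0"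
      by (rule eventually_mono) (auto simp: indicator_def split: if_splits)
    then have "(\<integral>\<^sup>+ x \<in> Q. epow (w x) (1 + \<delta>) \<partial>lebesgue) = (\<integral>\<^sup>+ x. 0 \<partial>(lebesgue :: (real^'n) measure))"
      by (intro nn_integral_cong_AE) simp
    then show ?thesis by (simp add: avg_def)
  next
    case False
    then have m: "0 < m" "avg w Q \<le> ennreal m" using real by auto
    define u where "u = (\<lambda>n x. w x * epow (min (w x) (ennreal (m + real n))) \<delta> * indicator Q x)"
    have [measurable]: "u n \<in> borel_measurable lebesgue" for n unfolding u_def by measurable
    have "(\<integral>\<^sup>+ x \<in> Q. epow (w x) (1 + \<delta>) \<partial>lebesgue) \<le> (\<integral>\<^sup>+ x. (SUP n. u n x) \<partial>lebesgue)"
    proof (rule nn_integral_mono_AE, rule eventually_mono[OF fin])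
      fix x assume "w x < \<infinity>"
      then obtain a where a: "w x = ennreal a" "0 \<le> a" by (cases "w x") auto
      obtain n where "a \<le> real n" using real_arch_simple by blast
      then have "min (w x) (ennreal (m + real n)) = w x"
        using a m by (intro min_absorb1) (simp add: ennreal_leI del: ennreal_plus)
      then have "epow (w x) (1 + \<delta>) * indicator Q x = u n x"
        by (simp add: u_def epow_add)
      also have "\<dots> \<le> (SUP n. u n x)" by (rule SUP_upper) simp
      finally show "epow (w x) (1 + \<delta>) * indicator Q x \<le> (SUP n. u n x)" .
    qed
    also have "\<dots> = (SUP n. (\<integral>\<^sup>+ x. u n x \<partial>lebesgue))"
    proof (rule nn_integral_monotone_convergence_SUP)
      show "incseq u"
        unfolding incseq_def le_fun_def u_def using \<delta> m
        by (intro allI impI mult_right_mono mult_left_mono epow_mono min.mono ennreal_leI) auto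
    qed measurable
    also have "\<dots> \<le> 2 * ennreal (m powr (1 + \<delta>)) * emeasure lebesgue Q"
      unfolding u_def by (intro SUP_least A1_power_integral_le[OF assms(1) A1 B Q m \<delta>]) auto
    finally have "avg (\<lambda>x. epow (w x) (1 + \<delta>)) Q \<le> 2 * ennreal (m powr (1 + \<delta>))"
      by (simp add: avg_le_iff[OF Q])
    then show ?thesis using real by (simp add: epow_ennreal)
  qed
qed

text \<open>
  The reverse Hoelder inequality on every cube, combined with the \<open>A\<^sub>1\<close> condition for \<open>w\<close>, is the \<open>A\<^sub>1\<close> condition
  for \<open>w\<^sup>r\<close>.
\<close>

lemma A1_power:
  fixes w :: "real ^ 'n::finite \<Rightarrow> ennreal"
  assumes [measurable]: "w \<in> borel_measurable lebesgue" and fin: "AE x in lebesgue. w x < \<infinity>"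
    and A1: "\<And>x. maximal w x \<le> ennreal B * w x" and B: "1 \<le> B"
    and r: "1 < r" "r \<le> 2" "2 * dilation TYPE('n) ^ CARD('n) * (r - 1) * B\<^sup>2 \<le> 1"
  shows "maximal (\<lambda>x. epow (w x) r) x \<le> ennreal (2 * B\<^sup>2) * epow (w x) r"
proof -
  have "maximal (\<lambda>x. epow (w x) r) x \<le> 2 * epow (maximal w x) r"
  proof (rule maximal_leI)
    fix Q :: "(real^'n) set" assume Q: "Q \<in> cubes" "x \<in> Q"
    have "avg (\<lambda>x. epow (w x) r) Q \<le> 2 * epow (avg w Q) r"
      using A1_reverse_Hoelder[OF assms(1) fin A1 B Q(1), of "r - 1"] r by simp
    also have "\<dots> \<le> 2 * epow (maximal w x) r"
      using Q r by (intro mult_left_mono epow_mono avg_le_maximal) auto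
    finally show "avg (\<lambda>x. epow (w x) r) Q \<le> 2 * epow (maximal w x) r" .
  qed
  also have "\<dots> \<le> 2 * epow (ennreal B * w x) r"
    using r by (intro mult_left_mono epow_mono A1) auto
  also have "\<dots> = 2 * (epow (ennreal B) r * epow (w x) r)" by (simp add: epow_mult)
  also have "\<dots> \<le> 2 * (epow (ennreal B) 2 * epow (w x) r)"
    using epow_const_le[OF B r(2)] by (intro mult_left_mono mult_right_mono) auto
  also have "\<dots> = ennreal (2 * B\<^sup>2) * epow (w x) r"
    using B by (simp add: epow_ennreal powr_numeral ennreal_mult mult.assoc)
  finally show ?thesis .
qed

section \<open>The maximal function integrated against a power of a weight\<close>

lemma less_divide_ennrealI:
  fixes t c z :: ennreal
  assumes "t * c < z" "c \<noteq> 0" "c < \<infinity>"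
  shows "t < z / c"
proof (rule ccontr)
  assume "\<not> t < z / c"
  then have "z / c * c \<le> t * c" by (intro mult_right_mono) auto
  moreover have "z / c * c = z"
    using assms(2,3) by (simp add: ennreal_divide_times ennreal_divide_self)
  ultimately show False using assms(1) by simp
qed

lemma cube_point_AE:
  assumes "Q \<in> cubes" "AE x in lebesgue. x \<in> Q \<longrightarrow> P x"
  obtains x where "x \<in> Q" "P x"
proof -
  have "\<exists>x\<in>Q. P x"
  proof (rule ccontr)
    assume "\<not> (\<exists>x\<in>Q. P x)"
    then have "AE x in lebesgue. x \<notin> Q" using assms(2) by (auto elim!: eventually_mono)
    then have "emeasure lebesgue Q = 0"
      using emeasure_cubes(3)[OF assms(1)] by (simp add: AE_iff_measurable[OF _ refl])
    then show False using emeasure_cubes(1)[OF assms(1)] by simp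
  qed
  then show thesis using that by blast
qed

text \<open>
  By Markov's inequality, \<open>w\<close> is at most twice its average on a set \<open>S\<close> of at least half the measure of \<open>Q\<close>. The \<open>A\<^sub>1\<close>
  condition bounds the average by a multiple of every value of \<open>w\<close> on \<open>Q\<close>. So for \<open>x\<close> in \<open>S\<close> the factor \<open>w(x)\<^sup>r\<^sup>-\<^sup>1\<close> may
  be moved inside the average of \<open>h\<close>, which puts \<open>x\<close> into the level set of \<open>G\<close>. The number \<open>j\<close> stands for a lower
  bound of the weight on \<open>Q\<close>; it will be the average of \<open>w\<^sup>r\<close> over a dilation of \<open>Q\<close>.
\<close>

lemma level_cube_weight_le:
  fixes w h :: "real ^ 'n::finite \<Rightarrow> ennreal"
  assumes [measurable]: "w \<in> borel_measurable lebesgue" "h \<in> borel_measurable lebesgue"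
    and fin: "AE x in lebesgue. w x < \<infinity>"
    and A1: "\<And>x. maximal w x \<le> ennreal B * w x" and B: "1 \<le> B"
    and r: "1 < r" "r \<le> 2"
    and Q: "Q \<in> cubes" "t < avg h Q"
    and j: "\<And>y. y \<in> Q \<Longrightarrow> j \<le> C * epow (w y) r"
  defines "G \<equiv> \<lambda>x. ennreal (2 * B) * maximal (\<lambda>x. h x * epow (w x) (r - 1)) x / epow (w x) (r - 1)"
  shows "emeasure lebesgue Q * j \<le> 2 * (C * (\<integral>\<^sup>+ x \<in> Q. epow (w x) r * indicator {x. t < G x} x \<partial>lebesgue))"
proof -
  have [measurable]: "Q \<in> sets lebesgue" using Q(1) by (rule emeasure_cubes)
  have avg_le: "avg w Q \<le> ennreal B * w y" if "y \<in> Q" for y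
    using avg_le_maximal[OF Q(1) that, of w] A1[of y] by (rule order.trans)
  obtain y0 where y0: "y0 \<in> Q" "w y0 < \<infinity>"
    by (rule cube_point_AE[OF Q(1), of "\<lambda>x. w x < \<infinity>"]) (use fin in \<open>auto elim: eventually_mono\<close>)
  have "avg w Q < \<infinity>"
    by (rule order.strict_trans1[OF avg_le[OF y0(1)]]) (use y0(2) in \<open>simp add: ennreal_mult_less_top\<close>)
  then obtain a where a: "avg w Q = ennreal a" "0 \<le> a" by (cases "avg w Q") auto
  show ?thesis
  proof (cases "a = 0")
    case True
    then have "(\<integral>\<^sup>+ x \<in> Q. w x \<partial>lebesgue) = 0"
      using avg_times_measure[OF Q(1), of w] a by simp
    then have "AE x in lebesgue. w x * indicator Q x = 0"
      by (subst (asm) nn_integral_0_iff_AE) auto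
    then have "AE x in lebesgue. x \<in> Q \<longrightarrow> w x = 0"
      by (rule eventually_mono) (auto simp: indicator_def split: if_splits)
    then obtain y where "y \<in> Q" "w y = 0" by (rule cube_point_AE[OF Q(1)])
    then show ?thesis using j[of y] by simp
  next
    case False
    then have a0: "0 < a" using a by simp
    \<comment> \<open>the part of \<open>Q\<close> where \<open>w\<close> is comparable to its average \<open>a\<close>\<close>
    define S where "S = {x \<in> Q. w x \<le> ennreal (2 * a)}"
    have Seq: "S = Q \<inter> {x \<in> space lebesgue. w x \<le> ennreal (2 * a)}" by (auto simp: S_def)
    have [measurable]: "S \<in> sets lebesgue" unfolding Seq by (rule sets.Int) (measurable, measurable)
    have SQ: "S \<subseteq> Q" by (auto simp: S_def)
    have "2 * ennreal a * emeasure lebesgue (Q - S) = (\<integral>\<^sup>+ x. ennreal (2 * a) * indicator (Q - S) x \<partial>lebesgue)"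
      using a by (simp add: nn_integral_cmult_indicator ennreal_mult)
    also have "\<dots> \<le> (\<integral>\<^sup>+ x \<in> Q. w x \<partial>lebesgue)"
      by (intro nn_integral_mono) (auto simp: S_def indicator_def)
    also have "\<dots> = ennreal a * emeasure lebesgue Q"
      using avg_times_measure[OF Q(1), of w] a by simp
    finally have "ennreal a * (2 * emeasure lebesgue (Q - S)) \<le> ennreal a * emeasure lebesgue Q"
      by (simp add: ac_simps)
    then have half: "2 * emeasure lebesgue (Q - S) \<le> emeasure lebesgue Q"
      using a0 by (simp add: ennreal_mult_le_mult_iff)
    have split: "emeasure lebesgue Q = emeasure lebesgue S + emeasure lebesgue (Q - S)"
      using SQ by (subst plus_emeasure) (auto simp: Un_absorb1)
    have Q2S: "emeasure lebesgue Q \<le> 2 * emeasure lebesgue S"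
    proof -
      have "emeasure lebesgue S \<le> emeasure lebesgue Q" using SQ by (intro emeasure_mono) auto
      also have "\<dots> < \<infinity>" by (rule emeasure_cubes(2)[OF Q(1)])
      finally obtain s where s: "emeasure lebesgue S = ennreal s" "0 \<le> s" by (cases "emeasure lebesgue S") auto
      have "emeasure lebesgue (Q - S) \<le> emeasure lebesgue Q" by (intro emeasure_mono) auto
      also have "\<dots> < \<infinity>" by (rule emeasure_cubes(2)[OF Q(1)])
      finally obtain u where u: "emeasure lebesgue (Q - S) = ennreal u" "0 \<le> u" by (cases "emeasure lebesgue (Q - S)") auto
      have 2: "2 = ennreal 2" by simp
      have "ennreal (2 * u) \<le> ennreal (s + u)"
        using half u s unfolding split by (simp add: ennreal_mult ennreal_plus)
      then have "2 * u \<le> s + u" using u s by (subst (asm) ennreal_le_iff) auto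
      then have "ennreal (s + u) \<le> ennreal (2 * s)" by (intro ennreal_leI) simp
      then show ?thesis unfolding split s(1) u(1) using u s by (simp add: ennreal_mult ennreal_plus)
    qed
    have in_level: "t < G x" if x: "x \<in> S" "w x \<noteq> 0" for x
    proof -
      define c where "c = epow (w x) (r - 1)"
      have wx: "w x \<le> 2 * avg w Q" using x a by (simp add: S_def ennreal_mult)
      also have "\<dots> < \<infinity>" using a by (simp add: ennreal_mult_less_top)
      finally have c: "c \<noteq> 0" "c < \<infinity>" using x by (auto simp: c_def)
      have pt: "h y * c \<le> ennreal (2 * B) * (h y * epow (w y) (r - 1))" if y: "y \<in> Q" for y
      proof -
        have "w x \<le> 2 * avg w Q" by (rule wx)
        also have "\<dots> \<le> 2 * (ennreal B * w y)" by (intro mult_left_mono avg_le y) simp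
        also have "\<dots> = ennreal (2 * B) * w y" using B by (simp add: ennreal_mult mult.assoc)
        finally have "c \<le> epow (ennreal (2 * B) * w y) (r - 1)"
          unfolding c_def using r by (intro epow_mono) auto
        also have "\<dots> = epow (ennreal (2 * B)) (r - 1) * epow (w y) (r - 1)" by (rule epow_mult)
        also have "\<dots> \<le> epow (ennreal (2 * B)) 1 * epow (w y) (r - 1)"
          using B r by (intro mult_right_mono epow_const_le) auto
        finally have "h y * c \<le> h y * (ennreal (2 * B) * epow (w y) (r - 1))"
          by (intro mult_left_mono) auto
        then show ?thesis by (simp add: ac_simps)
      qed
      have "t * c < avg h Q * c"
        using Q(2) c by (intro ennreal_mult_strict_right_mono) (auto simp: zero_less_iff_neq_zero)
      also have "\<dots> = avg (\<lambda>x. c * h x) Q" by (simp add: avg_cmult[OF _ Q(1)] mult.commute)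
      also have "\<dots> \<le> avg (\<lambda>x. ennreal (2 * B) * (h x * epow (w x) (r - 1))) Q"
        using pt by (intro avg_mono_AE) (auto simp: mult.commute)
      also have "\<dots> = ennreal (2 * B) * avg (\<lambda>x. h x * epow (w x) (r - 1)) Q"
        by (intro avg_cmult Q(1)) measurable
      also have "\<dots> \<le> ennreal (2 * B) * maximal (\<lambda>x. h x * epow (w x) (r - 1)) x"
        using x SQ by (intro mult_left_mono avg_le_maximal Q(1)) auto
      finally show "t < G x" unfolding G_def c_def[symmetric] by (rule less_divide_ennrealI) fact+
    qed
    have "emeasure lebesgue Q * j \<le> 2 * emeasure lebesgue S * j" by (intro mult_right_mono Q2S) simp
    also have "\<dots> = 2 * (\<integral>\<^sup>+ x. j * indicator S x \<partial>lebesgue)"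
      by (simp add: nn_integral_cmult_indicator ac_simps)
    also have "\<dots> \<le> 2 * (\<integral>\<^sup>+ x. C * (epow (w x) r * indicator {x. t < G x} x * indicator Q x) \<partial>lebesgue)"
    proof (intro mult_left_mono nn_integral_mono)
      fix x show "j * indicator S x \<le> C * (epow (w x) r * indicator {x. t < G x} x * indicator Q x)"
        using j[of x] in_level[of x] SQ by (cases "w x = 0") (auto simp: indicator_def)
    qed simp
    also have "(\<integral>\<^sup>+ x. C * (epow (w x) r * indicator {x. t < G x} x * indicator Q x) \<partial>lebesgue)
       = C * (\<integral>\<^sup>+ x \<in> Q. epow (w x) r * indicator {x. t < G x} x \<partial>lebesgue)"
    proof (rule nn_integral_cmult)
      have "(\<lambda>x. epow (w x) r * (if t < G x then 1 else 0) * indicator Q x) \<in> borel_measurable lebesgue"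
        unfolding G_def by measurable
      then show "(\<lambda>x. epow (w x) r * indicator {x. t < G x} x * indicator Q x) \<in> borel_measurable lebesgue"
        by (simp add: indicator_def of_bool_def)
    qed
    finally show ?thesis .
  qed
qed

text \<open>
  A Vitali subfamily of the cubes on which the average of \<open>h\<close> exceeds \<open>t\<close> is charged to its disjoint members by
  \<open>level_cube_weight_le\<close>; the \<open>A\<^sub>1\<close> condition for \<open>w\<^sup>r\<close> accounts for the passage to the dilated cubes.
\<close>

lemma level_finite_weight_le:
  fixes w h :: "real ^ 'n::finite \<Rightarrow> ennreal"
  assumes [measurable]: "w \<in> borel_measurable lebesgue" "h \<in> borel_measurable lebesgue"
    and fin: "AE x in lebesgue. w x < \<infinity>"
    and A1: "\<And>x. maximal w x \<le> ennreal B * w x" and B: "1 \<le> B"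
    and A1r: "\<And>x. maximal (\<lambda>x. epow (w x) r) x \<le> C * epow (w x) r"
    and r: "1 < r" "r \<le> 2" and R: "finite R" "R \<subseteq> cubes"
  defines "G \<equiv> \<lambda>x. ennreal (2 * B) * maximal (\<lambda>x. h x * epow (w x) (r - 1)) x / epow (w x) (r - 1)"
  shows "(\<integral>\<^sup>+ x \<in> (\<Union>Q\<in>{Q \<in> R. t < avg h Q}. Q). epow (w x) r \<partial>lebesgue)
    \<le> (2 * ennreal (dilation TYPE('n) ^ CARD('n)) * C) * (\<integral>\<^sup>+ x \<in> {x. t < G x}. epow (w x) r \<partial>lebesgue)"
proof -
  define k where "k = dilation TYPE('n)"
  have k: "10 \<le> k" unfolding k_def by (rule dilation_ge)
  define K where "K = {Q \<in> R. t < avg h Q}"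
  have K: "finite K" "K \<subseteq> cubes" using R by (auto simp: K_def)
  have "\<forall>Q\<in>K. \<exists>p l. 0 < l \<and> Q = cube p l"
  proof
    fix Q assume "Q \<in> K"
    then obtain p l where "Q = cube p l" "0 < l" using K(2) by (blast elim: cubesE)
    then show "\<exists>p l. 0 < l \<and> Q = cube p l" by blast
  qed
  from bchoice[OF this] obtain p where "\<forall>Q\<in>K. \<exists>l. 0 < l \<and> Q = cube (p Q) l" by blast
  from bchoice[OF this] obtain l where "\<forall>Q\<in>K. 0 < l Q \<and> Q = cube (p Q) (l Q)" by blast
  then have pl: "\<And>Q. Q \<in> K \<Longrightarrow> 0 < l Q" "\<And>Q. Q \<in> K \<Longrightarrow> cube (p Q) (l Q) = Q" by simp_all
  have bdd: "0 < l Q \<and> l Q \<le> Max (insert 0 (l ` K))" if "Q \<in> K" for Q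
    using pl(1)[OF that] that K(1) by (auto intro!: Max_ge)
  obtain D q where D: "countable D" "D \<subseteq> K" "disjoint_family_on (\<lambda>i. cube (p i) (l i)) D"
    "\<And>j. j \<in> D \<Longrightarrow> cube (p j) (l j) \<subseteq> cube (q j) (k * l j)"
    "\<And>i. i \<in> K \<Longrightarrow> \<exists>j\<in>D. cube (p i) (l i) \<subseteq> cube (q j) (k * l j)"
    by (rule Vitali_cubes[where K = K and l = l and B = "Max (insert 0 (l ` K))" and p = p, folded k_def])
      (erule bdd, (rule that; assumption))
  have Gm [measurable]: "G \<in> borel_measurable lebesgue" unfolding G_def by measurable
  have vm [measurable]: "(\<lambda>x. epow (w x) r * indicator {x. t < G x} x) \<in> borel_measurable lebesgue"
  proof -
    have "(\<lambda>x. epow (w x) r * (if t < G x then 1 else 0)) \<in> borel_measurable lebesgue" by measurable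
    then show ?thesis by (simp add: indicator_def of_bool_def)
  qed
  have "(\<integral>\<^sup>+ x \<in> (\<Union>Q\<in>K. Q). epow (w x) r \<partial>lebesgue)
    \<le> (2 * ennreal (k ^ CARD('n)) * C) * (\<integral>\<^sup>+ x \<in> UNIV. epow (w x) r * indicator {x. t < G x} x \<partial>lebesgue)"
  proof (rule integral_le_of_disjoint_bounds[OF D(1) _ _ _ _ D(3)])
    show "(\<Union>Q\<in>K. Q) \<subseteq> (\<Union>j\<in>D. cube (q j) (k * l j))"
    proof
      fix x assume "x \<in> (\<Union>Q\<in>K. Q)"
      then obtain Q where Q: "Q \<in> K" "x \<in> Q" by blast
      obtain j where "j \<in> D" "cube (p Q) (l Q) \<subseteq> cube (q j) (k * l j)" using D(5)[OF Q(1)] by blast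
      then show "x \<in> (\<Union>j\<in>D. cube (q j) (k * l j))" using Q pl(2)[OF Q(1)] by blast
    qed
    fix j assume j: "j \<in> D"
    then have jK: "j \<in> K" using D(2) by blast
    have lj: "0 < l j" using pl(1)[OF jK] .
    have pj: "cube (p j) (l j) = j" using pl(2)[OF jK] .
    have kl: "0 < k * l j" using lj k by (intro mult_pos_pos) linarith+
    let ?Q = "cube (q j) (k * l j)"
    define i where "i = avg (\<lambda>x. epow (w x) r) ?Q"
    have "i \<le> C * epow (w y) r" if "y \<in> j" for y
    proof -
      have "y \<in> ?Q" using that D(4)[OF j] unfolding pj by blast
      then show ?thesis
        unfolding i_def by (rule order.trans[OF avg_le_maximal[OF cubesI[OF kl]] A1r])
    qed
    then have *: "emeasure lebesgue j * i \<le> 2 * (C * (\<integral>\<^sup>+ x \<in> j. epow (w x) r * indicator {x. t < G x} x \<partial>lebesgue))"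
      unfolding G_def using jK R(2) by (intro level_cube_weight_le assms(1,2) fin A1 B r) (auto simp: K_def)
    have "(\<integral>\<^sup>+ x \<in> ?Q. epow (w x) r \<partial>lebesgue) = i * emeasure lebesgue ?Q"
      unfolding i_def by (rule avg_times_measure[OF cubesI[OF kl], symmetric])
    also have "emeasure lebesgue ?Q = ennreal (k ^ CARD('n)) * emeasure lebesgue (cube (p j) (l j))"
    proof -
      have "0 \<le> l j" "0 \<le> k * l j" "0 \<le> k" using lj kl k by linarith+
      then show ?thesis by (simp only: emeasure_cube power_mult_distrib ennreal_mult zero_le_power)
    qed
    also have "i * \<dots> = ennreal (k ^ CARD('n)) * (emeasure lebesgue j * i)"
      unfolding pj by (simp add: ac_simps)
    also have "\<dots> \<le> ennreal (k ^ CARD('n)) * (2 * (C * (\<integral>\<^sup>+ x \<in> j. epow (w x) r * indicator {x. t < G x} x \<partial>lebesgue)))"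
      by (intro mult_left_mono *) simp
    finally show "(\<integral>\<^sup>+ x \<in> ?Q. epow (w x) r \<partial>lebesgue)
       \<le> (2 * ennreal (k ^ CARD('n)) * C) * (\<integral>\<^sup>+ x \<in> cube (p j) (l j). epow (w x) r * indicator {x. t < G x} x \<partial>lebesgue)"
      unfolding pj by (simp add: ac_simps)
  qed auto
  then show ?thesis unfolding K_def k_def by simp
qed

text \<open>
  The passage from finitely many cubes to all of them, along an enumeration of the rational cubes.
\<close>

lemma weighted_level_le:
  fixes w h :: "real ^ 'n::finite \<Rightarrow> ennreal"
  assumes [measurable]: "w \<in> borel_measurable lebesgue" "h \<in> borel_measurable lebesgue"
    and fin: "AE x in lebesgue. w x < \<infinity>"
    and A1: "\<And>x. maximal w x \<le> ennreal B * w x" and B: "1 \<le> B"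
    and A1r: "\<And>x. maximal (\<lambda>x. epow (w x) r) x \<le> C * epow (w x) r"
    and r: "1 < r" "r \<le> 2"
  defines "G \<equiv> \<lambda>x. ennreal (2 * B) * maximal (\<lambda>x. h x * epow (w x) (r - 1)) x / epow (w x) (r - 1)"
  shows "(\<integral>\<^sup>+ x \<in> {x. t < maximal h x}. epow (w x) r \<partial>lebesgue)
    \<le> (2 * ennreal (dilation TYPE('n) ^ CARD('n)) * C) * (\<integral>\<^sup>+ x \<in> {x. t < G x}. epow (w x) r \<partial>lebesgue)"
proof -
  obtain e :: "nat \<Rightarrow> (real^'n) set" where e: "range e = rcubes" by (rule rcubes_enumeration)
  define E where "E = (\<lambda>n. \<Union>Q\<in>{Q \<in> e ` {..<n}. t < avg h Q}. Q)"
  have Rc: "e ` {..<n} \<subseteq> cubes" for n using e rcubes_subset by blast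
  have Em: "E n \<in> sets lebesgue" for n
    unfolding E_def using Rc[of n] emeasure_cubes(3) by (intro sets.finite_UN) auto
  have inc: "incseq E" unfolding E_def incseq_def by (auto; force)
  have "{x. t < maximal h x} = (\<Union>n. E n)"
  proof (intro set_eqI iffI)
    fix x assume "x \<in> {x. t < maximal h x}"
    then have "t < (SUP Q \<in> rcubes. avg h Q * indicator Q x)" by (simp add: maximal_eq_rational)
    then obtain Q where Q: "Q \<in> rcubes" "t < avg h Q * indicator Q x" by (auto simp: less_SUP_iff)
    then have "x \<in> Q" "t < avg h Q" by (cases "x \<in> Q"; simp)+
    moreover obtain n where "Q = e n" using Q(1) e by blast
    ultimately have "x \<in> E (Suc n)" by (auto simp: E_def)
    then show "x \<in> (\<Union>n. E n)" by blast
  next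
    fix x assume "x \<in> (\<Union>n. E n)"
    then obtain n Q where "Q \<in> e ` {..<n}" "t < avg h Q" "x \<in> Q" by (auto simp: E_def)
    then show "x \<in> {x. t < maximal h x}" using Rc[of n] avg_le_maximal[of Q x h] by (auto intro: order.strict_trans2)
  qed
  moreover have "(\<integral>\<^sup>+ x \<in> (\<Union>n. E n). epow (w x) r \<partial>lebesgue) = (SUP n. (\<integral>\<^sup>+ x \<in> E n. epow (w x) r \<partial>lebesgue))"
  proof -
    let ?d = "density lebesgue (\<lambda>x. epow (w x) r)"
    have "(\<integral>\<^sup>+ x \<in> (\<Union>n. E n). epow (w x) r \<partial>lebesgue) = emeasure ?d (\<Union>n. E n)"
      using Em by (subst emeasure_density) auto
    also have "\<dots> = (SUP n. emeasure ?d (E n))"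
      using Em inc by (intro SUP_emeasure_incseq[symmetric]) auto
    also have "\<dots> = (SUP n. (\<integral>\<^sup>+ x \<in> E n. epow (w x) r \<partial>lebesgue))"
      using Em by (subst emeasure_density) auto
    finally show ?thesis .
  qed
  moreover have "(\<integral>\<^sup>+ x \<in> E n. epow (w x) r \<partial>lebesgue)
    \<le> (2 * ennreal (dilation TYPE('n) ^ CARD('n)) * C) * (\<integral>\<^sup>+ x \<in> {x. t < G x}. epow (w x) r \<partial>lebesgue)" for n
    unfolding E_def G_def by (intro level_finite_weight_le assms(1,2) fin A1 B A1r r Rc) auto
  ultimately show ?thesis by (simp add: SUP_le_iff)
qed

text \<open>
  Integrating \<open>weighted_level_le\<close> over all levels \<open>t\<close> replaces the maximal function of \<open>h\<close> by that of
  \<open>h w\<^sup>r\<^sup>-\<^sup>1\<close>, divided by \<open>w\<^sup>r\<^sup>-\<^sup>1\<close>. The quotient cancels all but one factor of the weight \<open>w\<^sup>r\<close>.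
\<close>

lemma weighted_maximal_integral_le:
  fixes w h :: "real ^ 'n::finite \<Rightarrow> ennreal"
  assumes [measurable]: "w \<in> borel_measurable lebesgue" "h \<in> borel_measurable lebesgue"
    and fin: "AE x in lebesgue. w x < \<infinity>"
    and A1: "\<And>x. maximal w x \<le> ennreal B * w x" and B: "1 \<le> B"
    and A1r: "\<And>x. maximal (\<lambda>x. epow (w x) r) x \<le> C * epow (w x) r"
    and r: "1 < r" "r \<le> 2"
  shows "(\<integral>\<^sup>+ x. epow (w x) r * maximal h x \<partial>lebesgue)
    \<le> 2 * ennreal (dilation TYPE('n) ^ CARD('n)) * C * ennreal (2 * B)
        * (\<integral>\<^sup>+ x. w x * maximal (\<lambda>x. h x * epow (w x) (r - 1)) x \<partial>lebesgue)"
proof -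
  define D where "D = 2 * ennreal (dilation TYPE('n) ^ CARD('n)) * C"
  define g where "g = maximal (\<lambda>x. h x * epow (w x) (r - 1))"
  have [measurable]: "g \<in> borel_measurable lebesgue" unfolding g_def by measurable
  define G where "G = (\<lambda>x. ennreal (2 * B) * g x / epow (w x) (r - 1))"
  have [measurable]: "G \<in> borel_measurable lebesgue" unfolding G_def by measurable
  have "(\<integral>\<^sup>+ x. epow (w x) r * maximal h x \<partial>lebesgue)
    = (\<integral>\<^sup>+ t. indicator {0<..} t * (\<integral>\<^sup>+ x \<in> {x. ennreal t < maximal h x}. epow (w x) r \<partial>lebesgue) \<partial>lborel)"
    by (rule layer_cake_linear) measurable
  also have "\<dots> \<le> (\<integral>\<^sup>+ t. indicator {0<..} t * (\<integral>\<^sup>+ x \<in> {x. ennreal t < G x}. D * epow (w x) r \<partial>lebesgue) \<partial>lborel)"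
  proof (rule nn_integral_mono, rule mult_left_mono)
    fix t :: real
    have "(\<integral>\<^sup>+ x \<in> {x. ennreal t < maximal h x}. epow (w x) r \<partial>lebesgue) \<le> D * (\<integral>\<^sup>+ x \<in> {x. ennreal t < G x}. epow (w x) r \<partial>lebesgue)"
      unfolding D_def G_def g_def by (rule weighted_level_le[OF assms])
    also have "\<dots> = (\<integral>\<^sup>+ x. D * (epow (w x) r * indicator {x. ennreal t < G x} x) \<partial>lebesgue)"
    proof (rule nn_integral_cmult[symmetric])
      have "(\<lambda>x. epow (w x) r * (if ennreal t < G x then 1 else 0)) \<in> borel_measurable lebesgue" by measurable
      then show "(\<lambda>x. epow (w x) r * indicator {x. ennreal t < G x} x) \<in> borel_measurable lebesgue"
        by (simp add: indicator_def of_bool_def)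
    qed
    also have "\<dots> = (\<integral>\<^sup>+ x \<in> {x. ennreal t < G x}. D * epow (w x) r \<partial>lebesgue)" by (simp add: mult.assoc)
    finally show "(\<integral>\<^sup>+ x \<in> {x. ennreal t < maximal h x}. epow (w x) r \<partial>lebesgue) \<le> (\<integral>\<^sup>+ x \<in> {x. ennreal t < G x}. D * epow (w x) r \<partial>lebesgue)" .
  qed simp
  also have "\<dots> = (\<integral>\<^sup>+ x. D * epow (w x) r * G x \<partial>lebesgue)"
    by (rule layer_cake_linear[symmetric]) measurable
  also have "\<dots> \<le> (\<integral>\<^sup>+ x. D * ennreal (2 * B) * (w x * g x) \<partial>lebesgue)"
  proof (rule nn_integral_mono_AE, rule eventually_mono[OF fin])
    fix x assume wx: "w x < \<infinity>"
    define c where "c = epow (w x) (r - 1)"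
    have "epow (w x) r * G x \<le> ennreal (2 * B) * (w x * g x)"
    proof (cases "w x = 0")
      case False
      then have c: "c \<noteq> 0" "c < top" using wx by (simp_all add: c_def)
      have "epow (w x) r = w x * c" using epow_add[of "w x" 1 "r - 1"] by (simp add: c_def)
      moreover have "c * G x = ennreal (2 * B) * g x"
        unfolding G_def c_def[symmetric] ennreal_times_divide
        by (subst mult.commute) (rule ennreal_mult_divide_eq; use c in simp)
      ultimately have "epow (w x) r * G x = w x * (ennreal (2 * B) * g x)" by (simp add: mult.assoc)
      then show ?thesis by (simp add: ac_simps)
    qed simp
    then have "D * (epow (w x) r * G x) \<le> D * (ennreal (2 * B) * (w x * g x))" by (rule mult_left_mono) simp
    then show "D * epow (w x) r * G x \<le> D * ennreal (2 * B) * (w x * g x)" by (simp add: mult.assoc)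
  qed
  also have "\<dots> = D * ennreal (2 * B) * (\<integral>\<^sup>+ x. w x * g x \<partial>lebesgue)"
    by (rule nn_integral_cmult) measurable
  finally show ?thesis unfolding D_def g_def .
qed

section \<open>Gauges and the maximal operator\<close>

text \<open>
  Gauges are graded by what the arguments need. Powers \<open>X\<^sup>r\<close> are homogeneous but in general not subadditive,
  while Rubio de Francia's construction requires countable subadditivity, which duals always have. Two-sided
  control of the indicators of cubes replaces saturation.
\<close>

locale homogeneous_gauge =
  fixes \<rho> :: "(real ^ 'n::finite \<Rightarrow> ennreal) \<Rightarrow> ennreal"
  assumes mono_AE: "\<lbrakk>f \<in> borel_measurable lebesgue; g \<in> borel_measurable lebesgue; AE x in lebesgue. f x \<le> g x\<rbrakk> \<Longrightarrow> \<rho> f \<le> \<rho> g"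
    and cmult: "\<lbrakk>f \<in> borel_measurable lebesgue; 0 < c\<rbrakk> \<Longrightarrow> \<rho> (\<lambda>x. ennreal c * f x) = ennreal c * \<rho> f"
    and finite_AE: "\<lbrakk>f \<in> borel_measurable lebesgue; \<rho> f < \<infinity>\<rbrakk> \<Longrightarrow> AE x in lebesgue. f x < \<infinity>"

locale cube_gauge = homogeneous_gauge \<rho> for \<rho> :: "(real ^ 'n::finite \<Rightarrow> ennreal) \<Rightarrow> ennreal" +
  assumes cube_pos: "Q \<in> cubes \<Longrightarrow> 0 < \<rho> (indicator Q)"
    and cube_finite: "Q \<in> cubes \<Longrightarrow> \<rho> (indicator Q) < \<infinity>"

locale norm_gauge = cube_gauge \<rho> for \<rho> :: "(real ^ 'n::finite \<Rightarrow> ennreal) \<Rightarrow> ennreal" +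
  assumes countably_subadditive: "(\<And>n. f n \<in> borel_measurable lebesgue) \<Longrightarrow> \<rho> (\<lambda>x. \<Sum>n. f n x) \<le> (\<Sum>n. \<rho> (f n))"

definition bounded_maximal :: "((real ^ 'n::finite \<Rightarrow> ennreal) \<Rightarrow> ennreal) \<Rightarrow> real \<Rightarrow> bool" where
  "bounded_maximal \<rho> A \<longleftrightarrow> 1 \<le> A \<and> (\<forall>f \<in> borel_measurable lebesgue. \<rho> (maximal f) \<le> ennreal A * \<rho> f)"

lemma (in homogeneous_gauge) cong_AE:
  "\<lbrakk>f \<in> borel_measurable lebesgue; g \<in> borel_measurable lebesgue; AE x in lebesgue. f x = g x\<rbrakk> \<Longrightarrow> \<rho> f = \<rho> g"
  by (intro antisym mono_AE) (auto elim: eventually_mono)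

lemma (in homogeneous_gauge) mono:
  "\<lbrakk>f \<in> borel_measurable lebesgue; g \<in> borel_measurable lebesgue; \<And>x. f x \<le> g x\<rbrakk> \<Longrightarrow> \<rho> f \<le> \<rho> g"
  by (rule mono_AE) auto

lemma (in cube_gauge) zero: "\<rho> (\<lambda>x. 0) = 0"
proof -
  have Q: "cube (0 :: real^'n) 1 \<in> cubes" by (rule cubesI) simp
  have "\<rho> (\<lambda>x. 0) \<le> \<rho> (indicator (cube (0 :: real^'n) 1))"
    using emeasure_cubes(3)[OF Q] by (intro mono borel_measurable_indicator) auto
  then have fin: "\<rho> (\<lambda>x. 0) < \<infinity>" using cube_finite[OF Q] by (rule order.strict_trans1)
  have "\<rho> (\<lambda>x. 0) = ennreal 2 * \<rho> (\<lambda>x. 0)" using cmult[of "\<lambda>x. 0" 2] by simp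
  then show ?thesis
    using fin by (cases "\<rho> (\<lambda>x. 0)") (auto simp: ennreal_mult[symmetric] simp del: ennreal_numeral)
qed

lemma (in norm_gauge) add_le:
  assumes [measurable]: "f \<in> borel_measurable lebesgue" "g \<in> borel_measurable lebesgue"
  shows "\<rho> (\<lambda>x. f x + g x) \<le> \<rho> f + \<rho> g"
proof -
  define u where "u = (\<lambda>n::nat. if n = 0 then f else if n = 1 then g else (\<lambda>x. 0))"
  have 1: "(\<Sum>n. u n x) = f x + g x" for x
  proof -
    have "(\<Sum>n. u n x) = (\<Sum>n\<in>{0,1}. u n x)" by (rule suminf_finite) (auto simp: u_def)
    then show ?thesis by (simp add: u_def)
  qed
  have 2: "(\<Sum>n. \<rho> (u n)) = \<rho> f + \<rho> g"
  proof -
    have "(\<Sum>n. \<rho> (u n)) = (\<Sum>n\<in>{0,1}. \<rho> (u n))" by (rule suminf_finite) (auto simp: u_def zero)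
    then show ?thesis by (simp add: u_def)
  qed
  have "\<rho> (\<lambda>x. \<Sum>n. u n x) \<le> (\<Sum>n. \<rho> (u n))" by (rule countably_subadditive) (auto simp: u_def)
  then show ?thesis unfolding 1 2 .
qed

text \<open>
  The geometric weights make the series converge in \<open>\<rho>\<close>, and applying the maximal operator shifts the series by
  one term, at the price of the factor \<open>2 * A\<close>.
\<close>

lemma (in norm_gauge) Rubio_de_Francia:
  assumes A: "bounded_maximal \<rho> A" and f [measurable]: "f \<in> borel_measurable lebesgue"
  obtains w where "w \<in> borel_measurable lebesgue" "\<And>x. f x \<le> w x" "\<rho> w \<le> 2 * \<rho> f"
    "\<And>x. maximal w x \<le> ennreal (2 * A) * w x"
proof -
  have A1: "1 \<le> A" and bd: "\<And>f. f \<in> borel_measurable lebesgue \<Longrightarrow> \<rho> (maximal f) \<le> ennreal A * \<rho> f"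
    using A by (auto simp: bounded_maximal_def)
  define c where "c = 1 / (2 * A)"
  have c: "0 < c" "c * A = 1 / 2" "2 * A * c = 1" using A1 by (auto simp: c_def)
  define u where "u = (\<lambda>k x. ennreal (c ^ k) * (maximal ^^ k) f x)"
  have m [measurable]: "(maximal ^^ k) f \<in> borel_measurable lebesgue" for k by (cases k) auto
  have [measurable]: "u k \<in> borel_measurable lebesgue" for k unfolding u_def by measurable
  define w where "w = (\<lambda>x. \<Sum>k. u k x)"
  have wm: "w \<in> borel_measurable lebesgue" unfolding w_def by measurable
  have iter: "\<rho> ((maximal ^^ k) f) \<le> ennreal (A ^ k) * \<rho> f" for k
  proof (induction k)
    case (Suc k)
    have "\<rho> ((maximal ^^ Suc k) f) \<le> ennreal A * \<rho> ((maximal ^^ k) f)" using bd[OF m] by simp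
    also have "\<dots> \<le> ennreal A * (ennreal (A ^ k) * \<rho> f)" by (intro mult_left_mono Suc.IH) simp
    also have "\<dots> = ennreal (A ^ Suc k) * \<rho> f" using A1 by (simp add: ennreal_mult mult.assoc)
    finally show ?case .
  qed simp
  have rho_u: "\<rho> (u k) \<le> ennreal ((1/2) ^ k) * \<rho> f" for k
  proof -
    have "\<rho> (u k) = ennreal (c ^ k) * \<rho> ((maximal ^^ k) f)" unfolding u_def by (rule cmult) (use c in auto)
    also have "\<dots> \<le> ennreal (c ^ k) * (ennreal (A ^ k) * \<rho> f)" by (intro mult_left_mono iter) simp
    also have "\<dots> = ennreal ((c * A) ^ k) * \<rho> f"
      using c A1 by (simp add: ennreal_mult power_mult_distrib mult.assoc)
    finally show ?thesis unfolding c .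
  qed
  show thesis
  proof (rule that[OF wm])
    fix x
    have "f x = u 0 x" by (simp add: u_def)
    also have "\<dots> \<le> w x" unfolding w_def using sum_le_suminf[of "\<lambda>k. u k x" "{0}"] by simp
    finally show "f x \<le> w x" .
  next
    have "\<rho> w \<le> (\<Sum>k. \<rho> (u k))" unfolding w_def by (rule countably_subadditive) measurable
    also have "\<dots> \<le> (\<Sum>k. ennreal ((1/2) ^ k) * \<rho> f)" by (intro suminf_le rho_u) auto
    also have "\<dots> = (\<Sum>k. ennreal ((1/2) ^ k)) * \<rho> f" by (rule ennreal_suminf_multc)
    also have "(\<Sum>k. ennreal ((1/2) ^ k)) = ennreal 2"
      by (rule suminf_ennreal_eq) (use geometric_sums[of "1/2::real"] in auto)
    finally show "\<rho> w \<le> 2 * \<rho> f" by simp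
  next
    fix x
    have "maximal w x \<le> (\<Sum>k. maximal (u k) x)" unfolding w_def by (rule maximal_suminf_le) measurable
    also have "\<dots> \<le> (\<Sum>k. ennreal (2 * A) * u (Suc k) x)"
    proof (intro suminf_le allI)
      fix k
      have "maximal (u k) x \<le> ennreal (c ^ k) * maximal ((maximal ^^ k) f) x" unfolding u_def by (rule maximal_cmult_le) measurable
      also have "\<dots> = ennreal (2 * A * c ^ Suc k) * (maximal ^^ Suc k) f x"
      proof -
        have "2 * A * c ^ Suc k = (2 * A * c) * c ^ k" by simp
        then have "2 * A * c ^ Suc k = c ^ k" unfolding c(3) by simp
        then show ?thesis by (simp only: funpow.simps o_apply)
      qed
      also have "\<dots> = ennreal (2 * A) * u (Suc k) x"
        unfolding u_def using A1 c by (subst ennreal_mult) (auto simp: mult.assoc)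
      finally show "maximal (u k) x \<le> ennreal (2 * A) * u (Suc k) x" .
    qed auto
    also have "\<dots> = ennreal (2 * A) * (\<Sum>k. u (Suc k) x)" by (rule ennreal_suminf_cmult)
    also have "\<dots> \<le> ennreal (2 * A) * w x"
    proof (intro mult_left_mono)
      have "w x = (\<Sum>k. u (k + 1) x) + (\<Sum>k<1. u k x)" unfolding w_def
        by (rule suminf_offset) simp
      then show "(\<Sum>k. u (Suc k) x) \<le> w x" by simp
    qed simp
    finally show "maximal w x \<le> ennreal (2 * A) * w x" .
  qed
qed

definition gauge_power :: "real \<Rightarrow> ((real ^ 'n::finite \<Rightarrow> ennreal) \<Rightarrow> ennreal) \<Rightarrow> (real ^ 'n \<Rightarrow> ennreal) \<Rightarrow> ennreal" where
  "gauge_power r \<rho> f = epow (\<rho> (\<lambda>x. epow (f x) (1 / r))) r"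

lemma (in cube_gauge) gauge_power_cube_gauge:
  assumes r: "0 < r" shows "cube_gauge (gauge_power r \<rho>)"
proof
  fix f g :: "real^'n \<Rightarrow> ennreal" and c :: real
  assume [measurable]: "f \<in> borel_measurable lebesgue"
  show "gauge_power r \<rho> f \<le> gauge_power r \<rho> g" if [measurable]: "g \<in> borel_measurable lebesgue" and le: "AE x in lebesgue. f x \<le> g x"
    unfolding gauge_power_def using r le by (intro epow_mono mono_AE) (auto elim!: eventually_mono intro: epow_mono)
  show "gauge_power r \<rho> (\<lambda>x. ennreal c * f x) = ennreal c * gauge_power r \<rho> f" if c: "0 < c"
  proof -
    have "\<rho> (\<lambda>x. epow (ennreal c * f x) (1 / r)) = \<rho> (\<lambda>x. ennreal (c powr (1 / r)) * epow (f x) (1 / r))"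
      using c by (simp add: epow_mult epow_ennreal)
    also have "\<dots> = ennreal (c powr (1 / r)) * \<rho> (\<lambda>x. epow (f x) (1 / r))"
      by (rule cmult) (use c in auto)
    finally show ?thesis unfolding gauge_power_def using c r by (simp add: epow_mult epow_ennreal powr_powr)
  qed
  show "AE x in lebesgue. f x < \<infinity>" if "gauge_power r \<rho> f < \<infinity>"
    using finite_AE[of "\<lambda>x. epow (f x) (1 / r)"] that by (simp add: gauge_power_def)
next
  have ind: "(\<lambda>x. epow (indicator Q x) (1 / r)) = indicator Q" for Q :: "(real^'n) set"
    using epow_ennreal[of 1 "1 / r"] by (auto simp: indicator_def fun_eq_iff)
  fix Q :: "(real^'n) set" assume Q: "Q \<in> cubes"
  show "0 < gauge_power r \<rho> (indicator Q)" "gauge_power r \<rho> (indicator Q) < \<infinity>"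
    unfolding gauge_power_def ind using cube_pos[OF Q] cube_finite[OF Q] by simp_all
qed

section \<open>Powers of a gauge\<close>

text \<open>
  The largest exponent for which \<open>A1_power\<close> applies to the majorant of \<open>Rubio_de_Francia\<close>, whose \<open>A\<^sub>1\<close> constant
  is \<open>2 * A\<close>.
\<close>

definition self_improve_exp :: "'n::finite itself \<Rightarrow> real \<Rightarrow> real" where
  "self_improve_exp _ A = min 2 (1 + 1 / (2 * dilation TYPE('n) ^ CARD('n) * (2 * A)\<^sup>2))"

lemma self_improve_exp:
  assumes A: "1 \<le> A"
  shows "1 < self_improve_exp TYPE('n::finite) A"
    and "r \<le> self_improve_exp TYPE('n) A \<Longrightarrow> r \<le> 2"
    and "r \<le> self_improve_exp TYPE('n) A \<Longrightarrow> 2 * dilation TYPE('n) ^ CARD('n) * (r - 1) * (2 * A)\<^sup>2 \<le> 1"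
proof -
  define k where "k = 2 * dilation TYPE('n) ^ CARD('n) * (2 * A)\<^sup>2"
  have "0 < dilation TYPE('n)" using dilation_ge[where 'n='n] by linarith
  then have k: "0 < k" using A by (simp add: k_def)
  show "1 < self_improve_exp TYPE('n) A"
    using k unfolding self_improve_exp_def k_def[symmetric] by simp
  assume "r \<le> self_improve_exp TYPE('n) A"
  then have "r \<le> 2" "r - 1 \<le> 1 / k" unfolding self_improve_exp_def k_def[symmetric] by auto
  then have "k * (r - 1) \<le> 1" using k by (simp add: field_simps)
  then show "r \<le> 2" "2 * dilation TYPE('n) ^ CARD('n) * (r - 1) * (2 * A)\<^sup>2 \<le> 1"
    using \<open>r \<le> 2\<close> by (simp_all add: k_def ac_simps)
qed

lemma (in norm_gauge) A1_majorant:
  assumes A: "bounded_maximal \<rho> A" and r: "1 < r" "r \<le> self_improve_exp TYPE('n) A"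
    and [measurable]: "f \<in> borel_measurable lebesgue" and fin: "\<rho> f < \<infinity>"
  obtains w where "w \<in> borel_measurable lebesgue" "\<And>x. f x \<le> w x" "\<rho> w \<le> 2 * \<rho> f" "AE x in lebesgue. w x < \<infinity>"
    "\<And>x. maximal w x \<le> ennreal (2 * A) * w x"
    "\<And>x. maximal (\<lambda>x. epow (w x) r) x \<le> ennreal (2 * (2 * A)\<^sup>2) * epow (w x) r"
proof -
  have A1: "1 \<le> A" using A by (simp add: bounded_maximal_def)
  obtain w where w: "w \<in> borel_measurable lebesgue" "\<And>x. f x \<le> w x" "\<rho> w \<le> 2 * \<rho> f"
    "\<And>x. maximal w x \<le> ennreal (2 * A) * w x"
    by (rule Rubio_de_Francia[OF A, of f]) (simp, (rule that; assumption))
  have "\<rho> w < \<infinity>" using w(3) fin by (auto intro: order.strict_trans1 simp: ennreal_mult_less_top)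
  then have fw: "AE x in lebesgue. w x < \<infinity>" by (rule finite_AE[OF w(1)])
  have "maximal (\<lambda>x. epow (w x) r) x \<le> ennreal (2 * (2 * A)\<^sup>2) * epow (w x) r" for x
    using A1 r self_improve_exp(2,3)[OF A1 r(2)] by (intro A1_power w(1) fw w(4)) auto
  with w fw show thesis by (intro that)
qed

text \<open>
  If \<open>w\<close> is an \<open>A\<^sub>1\<close> majorant of \<open>f\<^sup>1\<^sup>/\<^sup>r\<close>, then \<open>M f \<le> M (w\<^sup>r) \<le> C w\<^sup>r\<close>. The bound does not depend on \<open>r\<close>.
\<close>

lemma (in norm_gauge) gauge_power_bounded_maximal:
  assumes A: "bounded_maximal \<rho> A" and r: "1 < r" "r \<le> self_improve_exp TYPE('n) A"
  shows "bounded_maximal (gauge_power r \<rho>) ((16 * A\<^sup>2)\<^sup>2)"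
  unfolding bounded_maximal_def
proof (intro conjI ballI)
  have A1: "1 \<le> A" using A by (simp add: bounded_maximal_def)
  have r2: "r \<le> 2" using self_improve_exp(2)[OF A1 r(2)] .
  have A2: "1 \<le> A\<^sup>2" using A1 by simp
  then have A3: "1 \<le> 16 * A\<^sup>2" by simp
  then show "1 \<le> (16 * A\<^sup>2)\<^sup>2" by (rule one_le_power)
  fix f :: "real^'n \<Rightarrow> ennreal" assume [measurable]: "f \<in> borel_measurable lebesgue"
  define k where "k = (\<lambda>x. epow (f x) (1 / r))"
  have [measurable]: "k \<in> borel_measurable lebesgue" unfolding k_def by measurable
  show "gauge_power r \<rho> (maximal f) \<le> ennreal ((16 * A\<^sup>2)\<^sup>2) * gauge_power r \<rho> f"
  proof (cases "\<rho> k < \<infinity>")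
    case False
    then have "gauge_power r \<rho> f = top" by (simp add: gauge_power_def k_def[symmetric] less_top[symmetric])
    then show ?thesis using A1 by (simp add: ennreal_mult_top)
  next
    case True
    obtain w where w: "w \<in> borel_measurable lebesgue" "\<And>x. k x \<le> w x" "\<rho> w \<le> 2 * \<rho> k" "AE x in lebesgue. w x < \<infinity>"
      "\<And>x. maximal w x \<le> ennreal (2 * A) * w x"
      "\<And>x. maximal (\<lambda>x. epow (w x) r) x \<le> ennreal (2 * (2 * A)\<^sup>2) * epow (w x) r"
      by (rule A1_majorant[OF A r _ True]) (simp, (rule that; assumption))
    note [measurable] = w(1)
    have fw: "f x \<le> epow (w x) r" for x
    proof -
      have "f x = epow (k x) r" using r by (simp add: k_def epow_inverse_cancel)
      also have "\<dots> \<le> epow (w x) r" using r by (intro epow_mono w) auto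
      finally show ?thesis .
    qed
    have "epow (maximal f x) (1 / r) \<le> ennreal (8 * A\<^sup>2) * w x" for x
    proof -
      have "maximal f x \<le> maximal (\<lambda>x. epow (w x) r) x" by (rule maximal_mono_AE) (simp add: fw)
      also have "\<dots> \<le> ennreal (8 * A\<^sup>2) * epow (w x) r" using w(6)[of x] by (simp add: power2_eq_square)
      finally have "epow (maximal f x) (1 / r) \<le> epow (ennreal (8 * A\<^sup>2) * epow (w x) r) (1 / r)"
        using r by (intro epow_mono) auto
      also have "\<dots> = epow (ennreal (8 * A\<^sup>2)) (1 / r) * w x"
        using r by (simp add: epow_mult epow_inverse_cancel)
      also have "\<dots> \<le> epow (ennreal (8 * A\<^sup>2)) 1 * w x"
        using A2 r by (intro mult_right_mono epow_const_le) auto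
      finally show ?thesis by simp
    qed
    then have "\<rho> (\<lambda>x. epow (maximal f x) (1 / r)) \<le> \<rho> (\<lambda>x. ennreal (8 * A\<^sup>2) * w x)"
      by (intro mono) auto
    also have "\<dots> = ennreal (8 * A\<^sup>2) * \<rho> w" by (rule cmult) (use A2 in auto)
    also have "\<dots> \<le> ennreal (8 * A\<^sup>2) * (2 * \<rho> k)" by (intro mult_left_mono w(3)) simp
    also have "\<dots> = ennreal (16 * A\<^sup>2) * \<rho> k"
    proof -
      have "ennreal (16 * A\<^sup>2) = ennreal (8 * A\<^sup>2) * 2"
        using ennreal_mult[of "8 * A\<^sup>2" 2] by simp
      then show ?thesis by (simp add: mult.assoc)
    qed
    finally have "gauge_power r \<rho> (maximal f) \<le> epow (ennreal (16 * A\<^sup>2) * \<rho> k) r"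
      unfolding gauge_power_def using r by (intro epow_mono) auto
    also have "\<dots> = epow (ennreal (16 * A\<^sup>2)) r * gauge_power r \<rho> f" by (simp add: gauge_power_def k_def epow_mult)
    also have "\<dots> \<le> epow (ennreal (16 * A\<^sup>2)) 2 * gauge_power r \<rho> f"
      using A3 r2 by (intro mult_right_mono epow_const_le) auto
    also have "epow (ennreal (16 * A\<^sup>2)) 2 = ennreal ((16 * A\<^sup>2)\<^sup>2)"
      using A3 by (simp only: epow_ennreal powr_numeral order_trans[OF zero_le_one])
    finally show ?thesis .
  qed
qed

section \<open>Duals of gauges and of their powers\<close>

definition dual :: "((real ^ 'n::finite \<Rightarrow> ennreal) \<Rightarrow> ennreal) \<Rightarrow> (real ^ 'n \<Rightarrow> ennreal) \<Rightarrow> ennreal" where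
  "dual \<rho> g = (SUP f \<in> {f \<in> borel_measurable lebesgue. \<rho> f \<le> 1}. \<integral>\<^sup>+ x. f x * g x \<partial>lebesgue)"

lemma dual_leI: "(\<And>f. f \<in> borel_measurable lebesgue \<Longrightarrow> \<rho> f \<le> 1 \<Longrightarrow> (\<integral>\<^sup>+ x. f x * g x \<partial>lebesgue) \<le> c) \<Longrightarrow> dual \<rho> g \<le> c"
  unfolding dual_def by (rule SUP_least) auto

lemma integral_le_dual: "f \<in> borel_measurable lebesgue \<Longrightarrow> \<rho> f \<le> 1 \<Longrightarrow> (\<integral>\<^sup>+ x. f x * g x \<partial>lebesgue) \<le> dual \<rho> g"
  unfolding dual_def by (rule SUP_upper) auto

text \<open>
  A positive upper bound \<open>c\<close> of \<open>\<rho> f\<close> instead of \<open>\<rho> f\<close> itself avoids the product \<open>0 * \<infinity>\<close>.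
\<close>

lemma (in homogeneous_gauge) Hoelder:
  assumes [measurable]: "f \<in> borel_measurable lebesgue" "g \<in> borel_measurable lebesgue" and c: "\<rho> f \<le> ennreal c" "0 < c"
  shows "(\<integral>\<^sup>+ x. f x * g x \<partial>lebesgue) \<le> ennreal c * dual \<rho> g"
proof -
  let ?f = "\<lambda>x. ennreal (1 / c) * f x"
  have "\<rho> ?f = ennreal (1 / c) * \<rho> f" by (rule cmult) (use c in auto)
  also have "\<dots> \<le> ennreal (1 / c) * ennreal c" by (intro mult_left_mono c) simp
  also have "\<dots> = 1" using c by (simp add: ennreal_mult[symmetric])
  finally have le: "(\<integral>\<^sup>+ x. ?f x * g x \<partial>lebesgue) \<le> dual \<rho> g" by (intro integral_le_dual) auto
  have "f x * g x = ennreal c * (?f x * g x)" for x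
  proof -
    have "ennreal c * ennreal (1 / c) = 1" using c by (simp add: ennreal_mult[symmetric])
    then show ?thesis by (simp add: mult.assoc[symmetric])
  qed
  then have "(\<integral>\<^sup>+ x. f x * g x \<partial>lebesgue) = (\<integral>\<^sup>+ x. ennreal c * (?f x * g x) \<partial>lebesgue)" by simp
  also have "\<dots> = ennreal c * (\<integral>\<^sup>+ x. ?f x * g x \<partial>lebesgue)" by (rule nn_integral_cmult) measurable
  also have "\<dots> \<le> ennreal c * dual \<rho> g" by (intro mult_left_mono le) simp
  finally show ?thesis .
qed

lemma centred_cubes_exhaust: 
  obtains n :: nat where "x \<in> cube (- vec (real n)) (2 * real n + 1)"
proof -
  obtain n where n: "norm x \<le> real n" using real_arch_simple by blast
  have "x \<in> cube (- vec (real n)) (2 * real n + 1)" unfolding mem_cube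
  proof
    fix i have "\<bar>x $ i\<bar> \<le> real n" using component_le_norm_cart[of x i] n by linarith
    then show "(- vec (real n)) $ i \<le> x $ i \<and> x $ i \<le> (- vec (real n)) $ i + (2 * real n + 1)" by (simp add: abs_le_iff)
  qed
  then show thesis by (rule that)
qed

text \<open>
  The dual could be trivial for a general gauge, since powers of norms need not be convex. Boundedness of the maximal
  operator excludes this: if \<open>\<rho> f \<le> 1\<close>, then \<open>M f\<close> is at least the average of \<open>f\<close> on all of \<open>Q\<close>, so the average is
  at most \<open>A / \<rho> (indicator Q)\<close>, and the indicator of \<open>Q\<close> has finite dual gauge.
\<close>

lemma (in cube_gauge) dual_gauge:
  assumes A: "bounded_maximal \<rho> A"
  shows "norm_gauge (dual \<rho>)"
proof
  fix f g :: "real^'n \<Rightarrow> ennreal" and c :: real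
  assume [measurable]: "f \<in> borel_measurable lebesgue"
  show "dual \<rho> f \<le> dual \<rho> g" if [measurable]: "g \<in> borel_measurable lebesgue" and le: "AE x in lebesgue. f x \<le> g x"
  proof (rule dual_leI)
    fix u :: "real^'n \<Rightarrow> ennreal" assume u: "u \<in> borel_measurable lebesgue" "\<rho> u \<le> 1"
    have "(\<integral>\<^sup>+ x. u x * f x \<partial>lebesgue) \<le> (\<integral>\<^sup>+ x. u x * g x \<partial>lebesgue)"
      using le by (intro nn_integral_mono_AE) (auto elim!: eventually_mono intro: mult_left_mono)
    also have "\<dots> \<le> dual \<rho> g" by (rule integral_le_dual; fact)
    finally show "(\<integral>\<^sup>+ x. u x * f x \<partial>lebesgue) \<le> dual \<rho> g" .
  qed
  show "dual \<rho> (\<lambda>x. ennreal c * f x) = ennreal c * dual \<rho> f"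
  proof -
    have "(\<integral>\<^sup>+ x. u x * (ennreal c * f x) \<partial>lebesgue) = ennreal c * (\<integral>\<^sup>+ x. u x * f x \<partial>lebesgue)"
      if [measurable]: "u \<in> borel_measurable lebesgue" for u
      by (subst nn_integral_cmult[symmetric]) (auto simp: ac_simps)
    then show ?thesis unfolding dual_def by (subst SUP_mult_left_ennreal) (auto intro!: SUP_cong)
  qed
  show "AE x in lebesgue. f x < \<infinity>" if fin: "dual \<rho> f < \<infinity>"
  proof -
    let ?Q = "\<lambda>n::nat. cube (- vec (real n) :: real^'n) (2 * real n + 1)"
    have Q: "?Q n \<in> cubes" for n by (rule cubesI) simp
    have "AE x in lebesgue. indicator (?Q n) x * f x \<noteq> \<infinity>" for n
    proof (rule nn_integral_PInf_AE)
      have [measurable]: "?Q n \<in> sets lebesgue" using emeasure_cubes(3)[OF Q] .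
      show "(\<lambda>x. indicator (?Q n) x * f x) \<in> borel_measurable lebesgue" by measurable
      obtain c where c: "\<rho> (indicator (?Q n)) = ennreal c" "0 < c"
        using cube_finite[OF Q, of n] cube_pos[OF Q, of n] by (cases "\<rho> (indicator (?Q n))") auto
      have "indicator (?Q n) \<in> borel_measurable lebesgue"
        using emeasure_cubes(3)[OF Q] by (rule borel_measurable_indicator)
      then have "(\<integral>\<^sup>+ x. indicator (?Q n) x * f x \<partial>lebesgue) \<le> ennreal c * dual \<rho> f"
        by (rule Hoelder) (use c in auto)
      also have "\<dots> < \<infinity>" using fin by (simp add: ennreal_mult_less_top)
      finally show "(\<integral>\<^sup>+ x. indicator (?Q n) x * f x \<partial>lebesgue) \<noteq> \<infinity>" by simp
    qed
    then have "AE x in lebesgue. \<forall>n. indicator (?Q n) x * f x \<noteq> \<infinity>" unfolding AE_all_countable by blast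
    then show ?thesis
    proof (rule eventually_mono)
      fix x assume H: "\<forall>n. indicator (?Q n) x * f x \<noteq> \<infinity>"
      obtain n where "x \<in> ?Q n" by (rule centred_cubes_exhaust)
      then show "f x < \<infinity>" using H[rule_format, of n] by (simp add: less_top)
    qed
  qed
next
  fix Q :: "(real^'n) set" assume Q: "Q \<in> cubes"
  have [measurable]: "Q \<in> sets lebesgue" using emeasure_cubes(3)[OF Q] .
  obtain c where c: "\<rho> (indicator Q) = ennreal c" "0 < c"
    using cube_finite[OF Q] cube_pos[OF Q] by (cases "\<rho> (indicator Q)") auto
  have "emeasure lebesgue Q = (\<integral>\<^sup>+ x. indicator Q x \<partial>lebesgue)"
    by (rule nn_integral_indicator[symmetric]) measurable
  also have "\<dots> = (\<integral>\<^sup>+ x. indicator Q x * indicator Q x \<partial>lebesgue)"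
    by (intro nn_integral_cong) (auto simp: indicator_def)
  also have "\<dots> \<le> ennreal c * dual \<rho> (indicator Q)" by (rule Hoelder) (use c in auto)
  finally show "0 < dual \<rho> (indicator Q)"
    using emeasure_cubes(1)[OF Q] by (auto simp: zero_less_iff_neq_zero)
  have A1: "1 \<le> A" using A by (simp add: bounded_maximal_def)
  have "dual \<rho> (indicator Q) \<le> ennreal (A / c) * emeasure lebesgue Q"
  proof (rule dual_leI)
    fix f :: "real^'n \<Rightarrow> ennreal" assume [measurable]: "f \<in> borel_measurable lebesgue" and f: "\<rho> f \<le> 1"
    have "avg f Q \<le> ennreal (A / c)"
    proof (rule ccontr)
      assume "\<not> avg f Q \<le> ennreal (A / c)"
      then have "ennreal (A / c) < avg f Q" by (simp only: not_le)
      from dense[OF this] obtain t where t: "ennreal (A / c) < t" "t < avg f Q" by blast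
      from t(2) have "t < top" using top_greatest by (rule order.strict_trans2)
      then obtain a where a: "t = ennreal a" "0 \<le> a" by (cases t) auto
      have ca: "A / c < a" using t(1) a c A1 by (simp add: ennreal_less_iff)
      moreover have "0 < A / c" using c A1 by simp
      ultimately have a0: "0 < a" by linarith
      have "ennreal a * ennreal c = \<rho> (\<lambda>x. ennreal a * indicator Q x)"
        using cmult[of "indicator Q" a] a0 c by simp
      also have "\<dots> \<le> \<rho> (maximal f)"
      proof (rule mono)
        fix x show "ennreal a * indicator Q x \<le> maximal f x"
          using t a avg_le_maximal[OF Q, of x f] by (cases "x \<in> Q") auto
      qed measurable
      also have "\<dots> \<le> ennreal A * \<rho> f" using A by (auto simp: bounded_maximal_def)
      also have "\<dots> \<le> ennreal A * 1" by (intro mult_left_mono f) simp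
      finally have "a * c \<le> A" using a c A1 by (simp add: ennreal_mult[symmetric] ennreal_le_iff)
      then show False using ca c by (simp add: field_simps)
    qed
    then show "(\<integral>\<^sup>+ x. f x * indicator Q x \<partial>lebesgue) \<le> ennreal (A / c) * emeasure lebesgue Q"
      by (simp add: avg_le_iff[OF Q])
  qed
  also have "\<dots> < \<infinity>" using emeasure_cubes(7)[OF Q] by (simp add: ennreal_mult_less_top less_top)
  finally show "dual \<rho> (indicator Q) < \<infinity>" .
next
  fix f :: "nat \<Rightarrow> real^'n \<Rightarrow> ennreal" assume [measurable]: "\<And>n. f n \<in> borel_measurable lebesgue"
  show "dual \<rho> (\<lambda>x. \<Sum>n. f n x) \<le> (\<Sum>n. dual \<rho> (f n))"
  proof (rule dual_leI)
    fix u :: "real^'n \<Rightarrow> ennreal" assume u [measurable]: "u \<in> borel_measurable lebesgue" and u1: "\<rho> u \<le> 1"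
    have "(\<integral>\<^sup>+ x. u x * (\<Sum>n. f n x) \<partial>lebesgue) = (\<integral>\<^sup>+ x. (\<Sum>n. u x * f n x) \<partial>lebesgue)" by simp
    also have "\<dots> = (\<Sum>n. \<integral>\<^sup>+ x. u x * f n x \<partial>lebesgue)" by (rule nn_integral_suminf) measurable
    also have "\<dots> \<le> (\<Sum>n. dual \<rho> (f n))" by (intro suminf_le integral_le_dual u u1) auto
    finally show "(\<integral>\<^sup>+ x. u x * (\<Sum>n. f n x) \<partial>lebesgue) \<le> (\<Sum>n. dual \<rho> (f n))" .
  qed
qed


text \<open>
  A bound uniform in the exponent. The factors come from \<open>weighted_maximal_integral_le\<close> with the constants of
  \<open>A1_majorant\<close>, and from the estimates \<open>\<rho> w \<le> 2\<close> and \<open>\<rho> (u + w) \<le> 3\<close> in the proof below.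
\<close>

definition dual_power_const :: "'n::finite itself \<Rightarrow> real \<Rightarrow> real \<Rightarrow> real" where
  "dual_power_const _ A A' = 2 * dilation TYPE('n) ^ CARD('n) * (8 * A\<^sup>2) * (4 * A) * (18 * A')"

text \<open>
  A test function for the dual of the \<open>r\<close>-th power is dominated by \<open>w\<^sup>r\<close> with an \<open>A\<^sub>1\<close> weight \<open>w\<close>, and
  \<open>weighted_maximal_integral_le\<close> leaves the pairing of \<open>w\<close> with the maximal function of \<open>h w\<^sup>r\<^sup>-\<^sup>1\<close>. The
  dual gauge of \<open>h w\<^sup>r\<^sup>-\<^sup>1\<close> is controlled because \<open>u w\<^sup>r\<^sup>-\<^sup>1 \<le> (u + w)\<^sup>r\<close>.
\<close>

lemma (in norm_gauge) dual_gauge_power_bounded_maximal: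
  assumes A: "bounded_maximal \<rho> A" and A': "bounded_maximal (dual \<rho>) A'"
    and r: "1 < r" "r \<le> self_improve_exp TYPE('n) A"
  shows "bounded_maximal (dual (gauge_power r \<rho>)) (dual_power_const TYPE('n) A A')"
  unfolding bounded_maximal_def
proof (intro conjI ballI)
  have A1: "1 \<le> A" "1 \<le> A'" using A A' by (simp_all add: bounded_maximal_def)
  have r2: "r \<le> 2" using self_improve_exp(2)[OF A1(1) r(2)] .
  have A2: "1 \<le> A\<^sup>2" using A1 by simp
  define k where "k = dilation TYPE('n) ^ CARD('n)"
  have k: "1 \<le> k" unfolding k_def using dilation_ge[where 'n='n] by (intro one_le_power) linarith
  have "1 * 1 * 1 * 1 \<le> (2 * k) * (8 * A\<^sup>2) * (4 * A) * (18 * A')"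
  proof (intro mult_mono)
    show "1 \<le> 8 * A\<^sup>2" using A2 by linarith
  qed (use A1 k in auto)
  then show "1 \<le> dual_power_const TYPE('n) A A'" unfolding dual_power_const_def k_def[symmetric] by simp
  interpret S: cube_gauge "gauge_power r \<rho>" using r by (intro gauge_power_cube_gauge) simp
  fix h :: "real^'n \<Rightarrow> ennreal" assume h [measurable]: "h \<in> borel_measurable lebesgue"
  show "dual (gauge_power r \<rho>) (maximal h) \<le> ennreal (dual_power_const TYPE('n) A A') * dual (gauge_power r \<rho>) h"
  proof (rule dual_leI)
    fix f :: "real^'n \<Rightarrow> ennreal" assume [measurable]: "f \<in> borel_measurable lebesgue" and f1: "gauge_power r \<rho> f \<le> 1"
    define g where "g = (\<lambda>x. epow (f x) (1 / r))"
    have [measurable]: "g \<in> borel_measurable lebesgue" unfolding g_def by measurable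
    have "epow (\<rho> g) r \<le> epow 1 r" using f1 by (simp add: gauge_power_def g_def epow_ennreal[of 1, simplified])
    then have g1: "\<rho> g \<le> 1" using r by (simp add: epow_le_iff)
    then have gfin: "\<rho> g < \<infinity>" by (rule order.strict_trans1) simp
    obtain w where w: "w \<in> borel_measurable lebesgue" "\<And>x. g x \<le> w x" "\<rho> w \<le> 2 * \<rho> g" "AE x in lebesgue. w x < \<infinity>"
      "\<And>x. maximal w x \<le> ennreal (2 * A) * w x"
      "\<And>x. maximal (\<lambda>x. epow (w x) r) x \<le> ennreal (2 * (2 * A)\<^sup>2) * epow (w x) r"
      by (rule A1_majorant[OF A r _ gfin]) (simp, (rule that; assumption))
    note [measurable] = w(1)
    have "2 * \<rho> g \<le> 2 * 1" by (intro mult_left_mono g1) simp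
    with w(3) have w2: "\<rho> w \<le> ennreal 2" by (auto intro: order.trans)
    define v where "v = (\<lambda>x. h x * epow (w x) (r - 1))"
    have [measurable]: "v \<in> borel_measurable lebesgue" unfolding v_def by measurable
    have v: "dual \<rho> v \<le> ennreal 9 * dual (gauge_power r \<rho>) h"
    proof (rule dual_leI)
      fix u :: "real^'n \<Rightarrow> ennreal" assume [measurable]: "u \<in> borel_measurable lebesgue" and u: "\<rho> u \<le> 1"
      define z where "z = (\<lambda>x. u x * epow (w x) (r - 1))"
      have [measurable]: "z \<in> borel_measurable lebesgue" unfolding z_def by measurable
      \<comment> \<open>\<open>u\<close> and \<open>w\<close> are both at most \<open>u + w\<close>, with total exponent \<open>1 + (r - 1) = r\<close>\<close>
      have "epow (z x) (1 / r) \<le> u x + w x" for x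
      proof -
        have "z x \<le> (u x + w x) * epow (u x + w x) (r - 1)"
          unfolding z_def using r by (intro mult_mono epow_mono) auto
        also have "\<dots> = epow (u x + w x) r" using epow_add[of "u x + w x" 1 "r - 1"] by simp
        finally have "epow (z x) (1 / r) \<le> epow (epow (u x + w x) r) (1 / r)" using r by (intro epow_mono) auto
        then show ?thesis using r by (simp add: epow_inverse_cancel)
      qed
      then have "\<rho> (\<lambda>x. epow (z x) (1 / r)) \<le> \<rho> (\<lambda>x. u x + w x)" by (intro mono) auto
      also have "\<dots> \<le> \<rho> u + \<rho> w" by (rule add_le) auto
      also have "\<dots> \<le> 1 + ennreal 2" by (intro add_mono u w2)
      also have "\<dots> = ennreal 3" by simp
      finally have "gauge_power r \<rho> z \<le> epow (ennreal 3) r" unfolding gauge_power_def using r by (intro epow_mono) auto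
      also have "\<dots> \<le> epow (ennreal 3) 2" using r2 by (intro epow_const_le) auto
      also have "\<dots> = ennreal 9" by (simp only: epow_ennreal zero_le_numeral) simp
      finally have "(\<integral>\<^sup>+ x. z x * h x \<partial>lebesgue) \<le> ennreal 9 * dual (gauge_power r \<rho>) h"
        by (intro S.Hoelder) auto
      then show "(\<integral>\<^sup>+ x. u x * v x \<partial>lebesgue) \<le> ennreal 9 * dual (gauge_power r \<rho>) h"
        by (simp add: z_def v_def ac_simps)
    qed
    let ?K = "2 * ennreal k * ennreal (2 * (2 * A)\<^sup>2) * ennreal (2 * (2 * A))"
    have "(\<integral>\<^sup>+ x. f x * maximal h x \<partial>lebesgue) \<le> (\<integral>\<^sup>+ x. epow (w x) r * maximal h x \<partial>lebesgue)"
    proof (intro nn_integral_mono mult_right_mono)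
      fix x
      have "f x = epow (g x) r" using r by (simp add: g_def epow_inverse_cancel)
      also have "\<dots> \<le> epow (w x) r" using r by (intro epow_mono w) auto
      finally show "f x \<le> epow (w x) r" .
    qed simp
    also have "\<dots> \<le> ?K * (\<integral>\<^sup>+ x. w x * maximal v x \<partial>lebesgue)"
      unfolding v_def k_def using A1 r r2 w by (intro weighted_maximal_integral_le) auto
    also have "\<dots> \<le> ?K * (ennreal 2 * dual \<rho> (maximal v))"
      by (intro mult_left_mono Hoelder w2) auto
    also have "\<dots> \<le> ?K * (ennreal 2 * (ennreal A' * (ennreal 9 * dual (gauge_power r \<rho>) h)))"
    proof (intro mult_left_mono)
      have "dual \<rho> (maximal v) \<le> ennreal A' * dual \<rho> v" using A' by (auto simp: bounded_maximal_def)
      also have "\<dots> \<le> ennreal A' * (ennreal 9 * dual (gauge_power r \<rho>) h)" by (intro mult_left_mono v) simp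
      finally show "dual \<rho> (maximal v) \<le> ennreal A' * (ennreal 9 * dual (gauge_power r \<rho>) h)" .
    qed auto
    also have "\<dots> = (ennreal 2 * ennreal k * ennreal (2 * (2 * A)\<^sup>2) * ennreal (2 * (2 * A)) * ennreal 2 * ennreal A' * ennreal 9) * dual (gauge_power r \<rho>) h"
      by (simp add: mult.assoc)
    also have "ennreal 2 * ennreal k * ennreal (2 * (2 * A)\<^sup>2) * ennreal (2 * (2 * A)) * ennreal 2 * ennreal A' * ennreal 9
      = ennreal (2 * k * (2 * (2 * A)\<^sup>2) * (2 * (2 * A)) * 2 * A' * 9)"
    proof -
      have "0 \<le> k" "0 \<le> A'" "0 \<le> 2 * (2 * A)" "0 \<le> 2 * (2 * A)\<^sup>2" using A1 k by auto
      then show ?thesis by (simp only: ennreal_mult[symmetric] mult_nonneg_nonneg zero_le_numeral)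
    qed
    also have "2 * k * (2 * (2 * A)\<^sup>2) * (2 * (2 * A)) * 2 * A' * 9 = dual_power_const TYPE('n) A A'"
      by (simp add: dual_power_const_def k_def power2_eq_square)
    finally show "(\<integral>\<^sup>+ x. f x * maximal h x \<partial>lebesgue) \<le> ennreal (dual_power_const TYPE('n) A A') * dual (gauge_power r \<rho>) h" .
  qed
qed

lemma sum_disjoint_indicator_le:
  fixes a :: "nat \<Rightarrow> ennreal"
  assumes disj: "\<And>i j. i < j \<Longrightarrow> j < n \<Longrightarrow> x \<in> E i \<Longrightarrow> x \<in> E j \<Longrightarrow> False"
    and le: "\<And>i. i < n \<Longrightarrow> x \<in> E i \<Longrightarrow> a i \<le> c"
  shows "(\<Sum>i<n. a i * indicator (E i) x) \<le> c"
proof (cases "\<exists>i<n. x \<in> E i")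
  case True
  then obtain i where i: "i < n" "x \<in> E i" by blast
  have "x \<notin> E j" if "j < n" "j \<noteq> i" for j
    using disj[of i j] disj[of j i] i that by (meson nat_neq_iff)
  then have "(\<Sum>i<n. a i * indicator (E i) x) = (\<Sum>i\<in>{i}. a i * indicator (E i) x)"
    using i by (intro sum.mono_neutral_right) auto
  also have "\<dots> \<le> c" using le i by simp
  finally show ?thesis .
qed simp

text \<open>
  The maximum over finitely many cubes is the linear operator \<open>T\<close> that uses at \<open>x\<close> the cube on which the average of \<open>h\<close>
  is largest. For every \<open>k\<close> one has \<open>T k \<le> M k\<close>, so the adjoint \<open>T'\<close> satisfies the dual bound, and the pairing of \<open>g\<close>
  with \<open>T h\<close> equals that of \<open>T' g\<close> with \<open>h\<close>.
\<close>

lemma (in cube_gauge) bidual_bounded_maximal: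
  assumes A: "bounded_maximal \<rho> A"
  shows "bounded_maximal (dual (dual \<rho>)) A"
  unfolding bounded_maximal_def
proof (intro conjI ballI)
  interpret D: norm_gauge "dual \<rho>" by (rule dual_gauge[OF A])
  show A1: "1 \<le> A" using A by (simp add: bounded_maximal_def)
  have bd: "\<And>f. f \<in> borel_measurable lebesgue \<Longrightarrow> \<rho> (maximal f) \<le> ennreal A * \<rho> f"
    using A by (auto simp: bounded_maximal_def)
  obtain e :: "nat \<Rightarrow> (real^'n) set" where e: "range e = rcubes" by (rule rcubes_enumeration)
  have ec: "e j \<in> cubes" for j using e rcubes_subset by blast
  have em [measurable]: "e j \<in> sets lebesgue" for j using emeasure_cubes(3)[OF ec] .
  fix h :: "real^'n \<Rightarrow> ennreal" assume h [measurable]: "h \<in> borel_measurable lebesgue"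
  define v where "v = (\<lambda>j x. avg h (e j) * indicator (e j) x)"
  have [measurable]: "v j \<in> borel_measurable lebesgue" for j unfolding v_def by measurable
  show "dual (dual \<rho>) (maximal h) \<le> ennreal A * dual (dual \<rho>) h"
  proof (rule dual_leI)
    fix g :: "real^'n \<Rightarrow> ennreal" assume [measurable]: "g \<in> borel_measurable lebesgue" and g: "dual \<rho> g \<le> 1"
    define V where "V = (\<lambda>n x. SUP j\<in>{..<n}. v j x)"
    have [measurable]: "V n \<in> borel_measurable lebesgue" for n unfolding V_def by measurable
    have maximal_V: "maximal h x = (SUP n. V n x)" for x
    proof -
      have "maximal h x = (SUP j. v j x)" unfolding maximal_eq_rational v_def e[symmetric] by (simp add: image_comp)
      also have "\<dots> = (SUP n. V n x)"
      proof (rule antisym)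
        show "(SUP j. v j x) \<le> (SUP n. V n x)"
        proof (rule SUP_least)
          fix j
          have "v j x \<le> V (Suc j) x" unfolding V_def by (rule SUP_upper) simp
          also have "\<dots> \<le> (SUP n. V n x)" by (rule SUP_upper) simp
          finally show "v j x \<le> (SUP n. V n x)" .
        qed
        show "(SUP n. V n x) \<le> (SUP j. v j x)" unfolding V_def by (intro SUP_least SUP_upper) simp
      qed
      finally show ?thesis .
    qed
    have fin: "(\<integral>\<^sup>+ x. g x * V n x \<partial>lebesgue) \<le> ennreal A * dual (dual \<rho>) h" for n
    proof -
      \<comment> \<open>the set where \<open>j\<close> is the first index of a largest average, which makes the sets disjoint\<close>
      define E where "E = (\<lambda>j. {x. (\<forall>i\<in>{..<j}. v i x < v j x) \<and> (\<forall>i\<in>{j<..<n}. v i x \<le> v j x)})"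
      have Em [measurable]: "E j \<in> sets lebesgue" for j
      proof -
        have "{x \<in> space lebesgue. (\<forall>i\<in>{..<j}. v i x < v j x) \<and> (\<forall>i\<in>{j<..<n}. v i x \<le> v j x)} \<in> sets lebesgue"
          by measurable
        then show ?thesis by (simp add: E_def)
      qed
      have disj: False if "i < j" "j < n" "x \<in> E i" "x \<in> E j" for i j x
      proof -
        have "v i x < v j x" using that(1,4) by (simp add: E_def)
        moreover have "v j x \<le> v i x" using that(1,2,3) by (simp add: E_def)
        ultimately show False by simp
      qed
      define T where "T = (\<lambda>k x. \<Sum>j<n. (avg k (e j) * indicator (e j) x) * indicator (E j) x)"
      have T_le: "T k x \<le> maximal k x" for k x
        unfolding T_def
      proof (rule sum_disjoint_indicator_le)
        show "avg k (e i) * indicator (e i) x \<le> maximal k x" for i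
          using avg_le_maximal[OF ec, of x i k] by (cases "x \<in> e i") auto
      qed (rule disj)
      have V_le: "V n x \<le> T h x" for x
      proof (cases "n = 0")
        case False
        define m where "m = Max ((\<lambda>j. v j x) ` {..<n})"
        have m_ge: "v j x \<le> m" if "j < n" for j unfolding m_def using that by (intro Max_ge) auto
        have "m \<in> (\<lambda>j. v j x) ` {..<n}" unfolding m_def using False by (intro Max_in) auto
        then have ex: "\<exists>j. j < n \<and> v j x = m" by auto
        define j where "j = (LEAST j. j < n \<and> v j x = m)"
        have j: "j < n" "v j x = m" using LeastI_ex[OF ex] by (simp_all add: j_def)
        have "v i x < m" if "i < j" for i
        proof -
          have "i < n" using that j by simp
          moreover have "v i x \<noteq> m" using not_less_Least[of i "\<lambda>j. j < n \<and> v j x = m"] that \<open>i < n\<close> unfolding j_def by blast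
          ultimately show ?thesis using m_ge by (simp add: order_less_le)
        qed
        then have "x \<in> E j" using j m_ge by (auto simp: E_def)
        have "V n x \<le> m" unfolding V_def by (rule SUP_least) (simp add: m_ge)
        also have "m = v j x * indicator (E j) x" using j \<open>x \<in> E j\<close> by simp
        also have "\<dots> \<le> T h x"
          using member_le_sum[of j "{..<n}" "\<lambda>j. v j x * indicator (E j) x"] j(1)
          by (simp add: T_def v_def)
        finally show ?thesis .
      qed (simp add: V_def bot_ennreal)
      define c where "c = (\<lambda>j. (\<integral>\<^sup>+ y. indicator (e j) y * indicator (E j) y * g y \<partial>lebesgue) / emeasure lebesgue (e j))"
      define T' where "T' = (\<lambda>x. \<Sum>j<n. c j * indicator (e j) x)"
      have T'm [measurable]: "T' \<in> borel_measurable lebesgue" unfolding T'_def by measurable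
      have adj: "(\<integral>\<^sup>+ x. g x * T k x \<partial>lebesgue) = (\<integral>\<^sup>+ x. T' x * k x \<partial>lebesgue)"
        if [measurable]: "k \<in> borel_measurable lebesgue" for k
      proof -
        have "(\<integral>\<^sup>+ x. g x * T k x \<partial>lebesgue) = (\<integral>\<^sup>+ x. (\<Sum>j<n. avg k (e j) * (indicator (e j) x * indicator (E j) x * g x)) \<partial>lebesgue)"
          unfolding T_def by (intro nn_integral_cong) (simp only: sum_distrib_left mult_ac)
        also have "\<dots> = (\<Sum>j<n. \<integral>\<^sup>+ x. avg k (e j) * (indicator (e j) x * indicator (E j) x * g x) \<partial>lebesgue)"
          by (rule nn_integral_sum) measurable
        also have "\<dots> = (\<Sum>j<n. avg k (e j) * (\<integral>\<^sup>+ x. indicator (e j) x * indicator (E j) x * g x \<partial>lebesgue))"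
          by (intro sum.cong nn_integral_cmult refl) measurable
        also have "\<dots> = (\<Sum>j<n. c j * (\<integral>\<^sup>+ x. k x * indicator (e j) x \<partial>lebesgue))"
          by (intro sum.cong refl) (simp add: c_def avg_def ennreal_times_divide mult.commute)
        also have "\<dots> = (\<Sum>j<n. (\<integral>\<^sup>+ x. c j * (k x * indicator (e j) x) \<partial>lebesgue))"
          by (intro sum.cong nn_integral_cmult[symmetric] refl) measurable
        also have "\<dots> = (\<integral>\<^sup>+ x. (\<Sum>j<n. c j * (k x * indicator (e j) x)) \<partial>lebesgue)"
          by (rule nn_integral_sum[symmetric]) measurable
        also have "\<dots> = (\<integral>\<^sup>+ x. T' x * k x \<partial>lebesgue)"
          unfolding T'_def by (intro nn_integral_cong) (simp only: sum_distrib_left sum_distrib_right mult_ac)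
        finally show ?thesis .
      qed
      have T': "dual \<rho> T' \<le> ennreal A"
      proof (rule dual_leI)
        fix k :: "real^'n \<Rightarrow> ennreal" assume k [measurable]: "k \<in> borel_measurable lebesgue" and k1: "\<rho> k \<le> 1"
        have "(\<integral>\<^sup>+ x. k x * T' x \<partial>lebesgue) = (\<integral>\<^sup>+ x. g x * T k x \<partial>lebesgue)"
          by (simp add: adj[OF k] mult.commute)
        also have "\<dots> \<le> (\<integral>\<^sup>+ x. maximal k x * g x \<partial>lebesgue)"
        proof (rule nn_integral_mono)
          fix x show "g x * T k x \<le> maximal k x * g x" using T_le[of k x] by (simp add: mult.commute mult_left_mono)
        qed
        also have "\<dots> \<le> ennreal A * dual \<rho> g"
        proof (rule Hoelder)
          have "\<rho> (maximal k) \<le> ennreal A * \<rho> k" by (rule bd[OF k])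
          also have "\<dots> \<le> ennreal A * 1" by (intro mult_left_mono k1) simp
          finally show "\<rho> (maximal k) \<le> ennreal A" by simp
        qed (use A1 in auto)
        also have "\<dots> \<le> ennreal A * 1" by (intro mult_left_mono g) simp
        finally show "(\<integral>\<^sup>+ x. k x * T' x \<partial>lebesgue) \<le> ennreal A" by simp
      qed
      have "(\<integral>\<^sup>+ x. g x * V n x \<partial>lebesgue) \<le> (\<integral>\<^sup>+ x. g x * T h x \<partial>lebesgue)"
        by (intro nn_integral_mono mult_left_mono V_le) simp
      also have "\<dots> = (\<integral>\<^sup>+ x. T' x * h x \<partial>lebesgue)" by (rule adj) fact
      also have "\<dots> \<le> ennreal A * dual (dual \<rho>) h" by (rule D.Hoelder) (use T' A1 in auto)
      finally show ?thesis .
    qed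
    have "(\<integral>\<^sup>+ x. g x * maximal h x \<partial>lebesgue) = (\<integral>\<^sup>+ x. (SUP n. g x * V n x) \<partial>lebesgue)"
      unfolding maximal_V by (simp add: SUP_mult_left_ennreal)
    also have "\<dots> = (SUP n. \<integral>\<^sup>+ x. g x * V n x \<partial>lebesgue)"
    proof (rule nn_integral_monotone_convergence_SUP)
      show "incseq (\<lambda>n x. g x * V n x)"
        unfolding incseq_def le_fun_def V_def by (intro allI impI mult_left_mono SUP_subset_mono) auto
    qed measurable
    also have "\<dots> \<le> ennreal A * dual (dual \<rho>) h" by (intro SUP_least fin)
    finally show "(\<integral>\<^sup>+ x. g x * maximal h x \<partial>lebesgue) \<le> ennreal A * dual (dual \<rho>) h" .
  qed
qed

section \<open>Function spaces and their gauges\<close>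

definition represents :: "(real ^ 'n::finite) fun_space \<Rightarrow> ((real ^ 'n \<Rightarrow> ennreal) \<Rightarrow> ennreal) \<Rightarrow> bool" where
  "represents S \<rho> \<longleftrightarrow>
    fcarrier S = {f \<in> borel_measurable lebesgue. \<rho> (\<lambda>x. ennreal \<bar>f x\<bar>) < \<infinity>} \<and>
    (\<forall>f \<in> fcarrier S. ennreal (fnorm S f) = \<rho> (\<lambda>x. ennreal \<bar>f x\<bar>) \<and> 0 \<le> fnorm S f)"

text \<open>
  The two suprema run over real-valued and over extended test functions. They agree because functions of finite gauge
  are finite almost everywhere.
\<close>

lemma (in homogeneous_gauge) represents_associate:
  assumes S: "represents S \<rho>"
  shows "represents (associate S) (dual \<rho>)"
proof -
  have eq: "assoc_norm S g = dual \<rho> (\<lambda>x. ennreal \<bar>g x\<bar>)" for g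
  proof (rule antisym)
    show "assoc_norm S g \<le> dual \<rho> (\<lambda>x. ennreal \<bar>g x\<bar>)"
      unfolding assoc_norm_def
    proof (rule SUP_least)
      fix f assume f: "f \<in> {f \<in> fcarrier S. fnorm S f \<le> 1}"
      then have "\<rho> (\<lambda>x. ennreal \<bar>f x\<bar>) = ennreal (fnorm S f)" "f \<in> borel_measurable lebesgue"
        using S by (auto simp: represents_def)
      moreover have "ennreal (fnorm S f) \<le> 1" using f by (simp add: ennreal_le_1)
      ultimately have "(\<integral>\<^sup>+ x. ennreal \<bar>f x\<bar> * ennreal \<bar>g x\<bar> \<partial>lebesgue) \<le> dual \<rho> (\<lambda>x. ennreal \<bar>g x\<bar>)"
        by (intro integral_le_dual) auto
      then show "(\<integral>\<^sup>+ x. ennreal \<bar>f x * g x\<bar> \<partial>lebesgue) \<le> dual \<rho> (\<lambda>x. ennreal \<bar>g x\<bar>)"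
        by (simp add: abs_mult ennreal_mult)
    qed
    show "dual \<rho> (\<lambda>x. ennreal \<bar>g x\<bar>) \<le> assoc_norm S g"
    proof (rule dual_leI)
      fix f :: "real^'n \<Rightarrow> ennreal" assume f [measurable]: "f \<in> borel_measurable lebesgue" and f1: "\<rho> f \<le> 1"
      define u where "u = (\<lambda>x. enn2real (f x))"
      have um [measurable]: "u \<in> borel_measurable lebesgue" unfolding u_def by measurable
      have "\<rho> f < \<infinity>" using f1 by (rule order.strict_trans1) simp
      then have fin: "AE x in lebesgue. f x < \<infinity>" by (rule finite_AE[OF f])
      have ae: "AE x in lebesgue. ennreal \<bar>u x\<bar> = f x"
        using fin by (rule eventually_mono) (auto simp: u_def)
      have "\<rho> (\<lambda>x. ennreal \<bar>u x\<bar>) = \<rho> f" using ae by (intro cong_AE) auto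
      then have us: "u \<in> fcarrier S" using S \<open>\<rho> f < \<infinity>\<close> um by (simp add: represents_def)
      then have "ennreal (fnorm S u) = \<rho> (\<lambda>x. ennreal \<bar>u x\<bar>)" using S unfolding represents_def by blast
      then have "ennreal (fnorm S u) \<le> 1" using f1 \<open>\<rho> (\<lambda>x. ennreal \<bar>u x\<bar>) = \<rho> f\<close> by simp
      with us have u: "u \<in> {f \<in> fcarrier S. fnorm S f \<le> 1}" using S by (auto simp: represents_def ennreal_le_1)
      have "(\<integral>\<^sup>+ x. f x * ennreal \<bar>g x\<bar> \<partial>lebesgue) = (\<integral>\<^sup>+ x. ennreal \<bar>u x * g x\<bar> \<partial>lebesgue)"
        using ae by (intro nn_integral_cong_AE) (auto elim!: eventually_mono simp: abs_mult ennreal_mult)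
      also have "\<dots> \<le> assoc_norm S g" unfolding assoc_norm_def by (rule SUP_upper[OF u])
      finally show "(\<integral>\<^sup>+ x. f x * ennreal \<bar>g x\<bar> \<partial>lebesgue) \<le> assoc_norm S g" .
    qed
  qed
  show ?thesis unfolding represents_def by (auto simp: associate_def eq)
qed

lemma represents_power:
  assumes S: "represents S \<rho>" and r: "0 < r"
  shows "represents (space_power S r) (gauge_power r \<rho>)"
proof -
  have eq: "gauge_power r \<rho> (\<lambda>x. ennreal \<bar>f x\<bar>) = epow (\<rho> (\<lambda>x. ennreal \<bar>\<bar>f x\<bar> powr (1 / r)\<bar>)) r" for f :: "real^'a \<Rightarrow> real"
    by (simp add: gauge_power_def epow_ennreal)
  show ?thesis unfolding represents_def
  proof (intro conjI ballI)
    have "(\<lambda>x. \<bar>f x\<bar> powr (1 / r)) \<in> fcarrier S \<longleftrightarrow> gauge_power r \<rho> (\<lambda>x. ennreal \<bar>f x\<bar>) < \<infinity>"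
      if [measurable]: "f \<in> borel_measurable lebesgue" for f
    proof -
      have "(\<lambda>x. \<bar>f x\<bar> powr (1 / r)) \<in> borel_measurable lebesgue" by measurable
      then show ?thesis using S unfolding eq represents_def by simp
    qed
    then show "fcarrier (space_power S r) = {f \<in> borel_measurable lebesgue. gauge_power r \<rho> (\<lambda>x. ennreal \<bar>f x\<bar>) < \<infinity>}"
      by (auto simp: space_power_def)
  next
    fix f assume "f \<in> fcarrier (space_power S r)"
    then have "(\<lambda>x. \<bar>f x\<bar> powr (1 / r)) \<in> fcarrier S" by (simp add: space_power_def)
    then have *: "\<rho> (\<lambda>x. ennreal \<bar>\<bar>f x\<bar> powr (1 / r)\<bar>) = ennreal (fnorm S (\<lambda>x. \<bar>f x\<bar> powr (1 / r)))" "0 \<le> fnorm S (\<lambda>x. \<bar>f x\<bar> powr (1 / r))"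
      using S by (auto simp: represents_def)
    show "ennreal (fnorm (space_power S r) f) = gauge_power r \<rho> (\<lambda>x. ennreal \<bar>f x\<bar>)"
      unfolding eq * using *(2) by (simp add: epow_ennreal space_power_def)
    show "0 \<le> fnorm (space_power S r) f" by (simp add: space_power_def)
  qed
qed

lemma (in homogeneous_gauge) maximal_bounded_onI:
  assumes S: "represents S \<rho>" and A: "bounded_maximal \<rho> A"
  shows "maximal_bounded_on S"
  unfolding maximal_bounded_on_def
proof (intro exI[of _ A] ballI conjI)
  fix f :: "real^'n \<Rightarrow> real" assume f: "f \<in> fcarrier S"
  have A1: "1 \<le> A" using A by (simp add: bounded_maximal_def)
  let ?f = "\<lambda>x. ennreal \<bar>f x\<bar>"
  let ?m = "\<lambda>x. enn2real (maximal_function f x)"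
  have fm [measurable]: "f \<in> borel_measurable lebesgue" using f S by (auto simp: represents_def)
  have norm: "\<rho> ?f = ennreal (fnorm S f)" "0 \<le> fnorm S f" using f S by (auto simp: represents_def)
  have le: "\<rho> (maximal ?f) \<le> ennreal A * \<rho> ?f" using A by (simp add: bounded_maximal_def)
  also have "\<dots> < \<infinity>" unfolding norm by (simp add: ennreal_mult_less_top)
  finally have fin: "\<rho> (maximal ?f) < \<infinity>" .
  then have ae: "AE x in lebesgue. maximal ?f x < \<infinity>" by (intro finite_AE) measurable
  then show "AE x in lebesgue. maximal_function f x < \<infinity>" by (simp add: maximal_function_eq)
  have "AE x in lebesgue. ennreal \<bar>?m x\<bar> = maximal ?f x"
    using ae by (rule eventually_mono) (simp add: maximal_function_eq)
  then have eq: "\<rho> (\<lambda>x. ennreal \<bar>?m x\<bar>) = \<rho> (maximal ?f)"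
    by (intro cong_AE) (auto simp: maximal_function_eq)
  have mm: "?m \<in> borel_measurable lebesgue" unfolding maximal_function_eq by measurable
  with eq fin show mc: "?m \<in> fcarrier S" using S by (simp add: represents_def)
  have "ennreal (fnorm S ?m) = \<rho> (maximal ?f)" using mc S unfolding eq[symmetric] by (simp add: represents_def)
  also have "\<dots> \<le> ennreal A * ennreal (fnorm S f)" using le norm by simp
  also have "\<dots> = ennreal (A * fnorm S f)" using A1 norm by (simp add: ennreal_mult)
  finally show "fnorm S ?m \<le> A * fnorm S f"
    using A1 norm by (subst (asm) ennreal_le_iff) auto
qed

lemma (in homogeneous_gauge) maximal_bounded_onE:
  assumes S: "represents S \<rho>" and M: "maximal_bounded_on S"
  obtains A where "bounded_maximal \<rho> A"
proof -
  obtain C where C: "\<And>f. f \<in> fcarrier S \<Longrightarrow> (AE x in lebesgue. maximal_function f x < \<infinity>) \<and>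
    (\<lambda>x. enn2real (maximal_function f x)) \<in> fcarrier S \<and>
    fnorm S (\<lambda>x. enn2real (maximal_function f x)) \<le> C * fnorm S f"
    using M unfolding maximal_bounded_on_def by blast
  have "\<rho> (maximal f) \<le> ennreal (max 1 C) * \<rho> f" if f [measurable]: "f \<in> borel_measurable lebesgue" for f
  proof (cases "\<rho> f < \<infinity>")
    case False
    then have "\<rho> f = top" by (simp add: less_top[symmetric])
    then show ?thesis by (simp add: ennreal_mult_top)
  next
    case True
    define u where "u = (\<lambda>x. enn2real (f x))"
    have um [measurable]: "u \<in> borel_measurable lebesgue" unfolding u_def by measurable
    let ?m = "\<lambda>x. enn2real (maximal_function u x)"
    have ae: "AE x in lebesgue. ennreal \<bar>u x\<bar> = f x"
      using finite_AE[OF f True] by (rule eventually_mono) (auto simp: u_def)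
    have eq: "\<rho> (\<lambda>x. ennreal \<bar>u x\<bar>) = \<rho> f" using ae by (intro cong_AE) auto
    then have u: "u \<in> fcarrier S" using S True um by (simp add: represents_def)
    then have norm: "\<rho> f = ennreal (fnorm S u)" "0 \<le> fnorm S u" using S eq by (simp_all add: represents_def)
    have "maximal f x = maximal_function u x" for x
      unfolding maximal_function_eq using ae by (intro antisym maximal_mono_AE) (auto elim: eventually_mono)
    then have "AE x in lebesgue. maximal f x = ennreal \<bar>?m x\<bar>"
      using conjunct1[OF C[OF u]] by (auto elim!: eventually_mono)
    then have "\<rho> (maximal f) = \<rho> (\<lambda>x. ennreal \<bar>?m x\<bar>)"
      by (intro cong_AE) (auto simp: maximal_function_eq)
    also have "\<dots> = ennreal (fnorm S ?m)" using C[OF u] S by (simp add: represents_def)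
    also have "\<dots> \<le> ennreal (max 1 C * fnorm S u)"
    proof (rule ennreal_leI)
      have "fnorm S ?m \<le> C * fnorm S u" using C[OF u] by blast
      also have "\<dots> \<le> max 1 C * fnorm S u" by (intro mult_right_mono norm) simp
      finally show "fnorm S ?m \<le> max 1 C * fnorm S u" .
    qed
    also have "\<dots> = ennreal (max 1 C) * \<rho> f" using norm by (simp add: ennreal_mult)
    finally show ?thesis .
  qed
  then show thesis by (intro that[of "max 1 C"]) (auto simp: bounded_maximal_def)
qed

text \<open>
  The value \<open>\<infinity>\<close> marks functions outside the space, in particular those that are infinite on a set of
  positive measure, where \<^const>\<open>enn2real\<close> would discard the value.
\<close>

definition space_gauge :: "(real ^ 'n::finite) fun_space \<Rightarrow> (real ^ 'n \<Rightarrow> ennreal) \<Rightarrow> ennreal" where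
  "space_gauge X f = (if (AE x in lebesgue. f x < \<infinity>) \<and> (\<lambda>x. enn2real (f x)) \<in> fcarrier X
    then ennreal (fnorm X (\<lambda>x. enn2real (f x))) else \<infinity>)"

context banach_function_space
begin

lemma space_gauge_finite:
  "space_gauge X f < \<infinity> \<longleftrightarrow> (AE x in lebesgue. f x < \<infinity>) \<and> (\<lambda>x. enn2real (f x)) \<in> fcarrier X"
  "space_gauge X f < top \<longleftrightarrow> (AE x in lebesgue. f x < top) \<and> (\<lambda>x. enn2real (f x)) \<in> fcarrier X"
  by (simp_all add: space_gauge_def)

lemma space_gauge_homogeneous: "homogeneous_gauge (space_gauge X)"
proof
  fix f g :: "real^'n \<Rightarrow> ennreal" and c :: real
  assume f [measurable]: "f \<in> borel_measurable lebesgue"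
  show "AE x in lebesgue. f x < \<infinity>" if "space_gauge X f < \<infinity>"
    using that by (simp add: space_gauge_finite)
  show "space_gauge X f \<le> space_gauge X g" if g [measurable]: "g \<in> borel_measurable lebesgue" and le: "AE x in lebesgue. f x \<le> g x"
  proof (cases "space_gauge X g < \<infinity>")
    case True
    then have g: "AE x in lebesgue. g x < \<infinity>" "(\<lambda>x. enn2real (g x)) \<in> fcarrier X" by (simp_all add: space_gauge_finite)
    have fin: "AE x in lebesgue. f x < \<infinity>" using le g(1) by eventually_elim (rule order.strict_trans1)
    have "AE x in lebesgue. \<bar>enn2real (f x)\<bar> \<le> \<bar>enn2real (g x)\<bar>"
      using le g(1) by eventually_elim (simp add: enn2real_mono)
    then have "(\<lambda>x. enn2real (f x)) \<in> fcarrier X \<and> fnorm X (\<lambda>x. enn2real (f x)) \<le> fnorm X (\<lambda>x. enn2real (g x))"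
      by (intro ideal[OF g(2)]) measurable
    then show ?thesis using fin g by (simp add: space_gauge_def ennreal_leI)
  qed (simp add: less_top[symmetric])
  show "space_gauge X (\<lambda>x. ennreal c * f x) = ennreal c * space_gauge X f" if c: "0 < c"
  proof -
    have 1: "enn2real (ennreal c * f x) = c * enn2real (f x)" for x using c by (simp add: enn2real_mult)
    have 2: "ennreal c * f x < \<infinity> \<longleftrightarrow> f x < \<infinity>" for x using c by (auto simp: ennreal_mult_less_top)
    have 3: "(\<lambda>x. c * enn2real (f x)) \<in> fcarrier X \<longleftrightarrow> (\<lambda>x. enn2real (f x)) \<in> fcarrier X"
    proof
      assume "(\<lambda>x. c * enn2real (f x)) \<in> fcarrier X"
      from scale_mem[OF this, of "1 / c"] show "(\<lambda>x. enn2real (f x)) \<in> fcarrier X" using c by simp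
    qed (rule scale_mem)
    have 4: "(\<lambda>x. enn2real (f x)) \<in> fcarrier X \<Longrightarrow> fnorm X (\<lambda>x. c * enn2real (f x)) = c * fnorm X (\<lambda>x. enn2real (f x))"
      using norm_scale[of _ c] c by simp
    show ?thesis unfolding space_gauge_def 1 2 3 using c by (auto simp: 4 ennreal_mult norm_nonneg ennreal_mult_top)
  qed
qed

lemma space_gauge_represents: "represents X (space_gauge X)"
proof -
  have abs: "(\<lambda>x. \<bar>f x\<bar>) \<in> fcarrier X \<longleftrightarrow> f \<in> fcarrier X" if [measurable]: "f \<in> borel_measurable lebesgue" for f
    using ideal[of f "\<lambda>x. \<bar>f x\<bar>"] ideal[of "\<lambda>x. \<bar>f x\<bar>" f] by auto
  have abs_norm: "fnorm X (\<lambda>x. \<bar>f x\<bar>) = fnorm X f" if f: "f \<in> fcarrier X" for f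
  proof -
    have [measurable]: "f \<in> borel_measurable lebesgue" using f carrier_measurable by blast
    show ?thesis using ideal[of f "\<lambda>x. \<bar>f x\<bar>"] ideal[of "\<lambda>x. \<bar>f x\<bar>" f] f abs[of f] by (auto intro!: antisym)
  qed
  show ?thesis
    unfolding represents_def space_gauge_def using abs carrier_measurable
    by (auto simp: abs_norm norm_nonneg)
qed

interpretation G: homogeneous_gauge "space_gauge X" by (rule space_gauge_homogeneous)

lemma space_gauge_indicator_pos:
  assumes A: "A \<in> sets lebesgue" "0 < emeasure lebesgue A"
  shows "0 < space_gauge X (indicator A)"
proof -
  have eq: "(\<lambda>x. enn2real (indicator A x)) = (indicator A :: real^'n \<Rightarrow> real)" by (auto simp: indicator_def)
  show ?thesis
  proof (cases "space_gauge X (indicator A) < \<infinity>")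
    case True
    then have m: "(indicator A :: real^'n \<Rightarrow> real) \<in> fcarrier X" unfolding space_gauge_finite eq by blast
    have "fnorm X (indicator A) \<noteq> 0"
    proof
      assume "fnorm X (indicator A) = 0"
      then have "AE x in lebesgue. indicator A x = (0::real)" using norm_eq_zero_iff[OF m] by simp
      then have "AE x in lebesgue. x \<notin> A" by (rule eventually_mono) (auto simp: indicator_def split: if_splits)
      then have "emeasure lebesgue A = 0" using A(1) by (simp add: AE_iff_measurable[OF _ refl])
      with A(2) show False by simp
    qed
    then have "0 < fnorm X (indicator A)" using norm_nonneg[OF m] by simp
    then show ?thesis using m by (simp add: space_gauge_def eq)
  qed (simp add: less_top[symmetric])
qed

lemma space_gauge_saturation:
  assumes "E \<in> sets lebesgue" "0 < emeasure lebesgue E"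
  obtains A where "A \<in> sets lebesgue" "A \<subseteq> E" "0 < emeasure lebesgue A" "space_gauge X (indicator A) < \<infinity>"
proof -
  obtain A where A: "A \<in> sets lebesgue" "A \<subseteq> E" "emeasure lebesgue A > 0" "indicator A \<in> fcarrier X"
    using saturation[OF assms] by blast
  have "(\<lambda>x. enn2real (indicator A x)) = (indicator A :: real^'n \<Rightarrow> real)" by (auto simp: indicator_def)
  then have "space_gauge X (indicator A) < \<infinity>" unfolding space_gauge_finite using A(4) by (simp add: indicator_def)
  with A show thesis by (intro that)
qed

lemma space_gauge_Fatou_finite:
  assumes m [measurable]: "\<And>n. F n \<in> borel_measurable lebesgue" and inc: "\<And>x. incseq (\<lambda>n. F n x)"
    and le: "\<And>n. space_gauge X (F n) \<le> ennreal C" and fin: "AE x in lebesgue. (SUP n. F n x) < \<infinity>"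
  shows "space_gauge X (\<lambda>x. SUP n. F n x) \<le> ennreal C"
proof -
  let ?F = "\<lambda>n x. enn2real (F n x)" and ?f = "\<lambda>x. enn2real (SUP n. F n x)"
  have Fm: "?F n \<in> fcarrier X" for n
    using le[of n] space_gauge_finite(2)[of "F n"] by (auto intro: order.strict_trans1)
  have nC: "fnorm X (?F n) \<le> max 0 C" for n
  proof -
    have "ennreal (fnorm X (?F n)) \<le> ennreal C"
      using le[of n] by (auto simp: space_gauge_def top_unique split: if_splits)
    also have "\<dots> \<le> ennreal (max 0 C)" by (rule ennreal_leI) simp
    finally show ?thesis by (subst (asm) ennreal_le_iff) auto
  qed
  have "?f \<in> fcarrier X \<and> fnorm X ?f = (SUP n. fnorm X (?F n))"
  proof (rule fatou[OF Fm])
    show "AE x in lebesgue. (\<forall>n. 0 \<le> ?F n x) \<and> incseq (\<lambda>n. ?F n x) \<and> (\<lambda>n. ?F n x) \<longlonglongrightarrow> ?f x"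
      using fin
    proof (rule eventually_mono)
      fix x assume x: "(SUP n. F n x) < \<infinity>"
      have b: "F n x < top" for n
        by (rule order.strict_trans1[OF SUP_upper[of n UNIV "\<lambda>n. F n x"]]) (use x in auto)
      have "incseq (\<lambda>n. ?F n x)"
        using inc[of x] b by (auto simp: incseq_def intro: enn2real_mono)
      moreover have "(\<lambda>n. F n x) \<longlonglongrightarrow> (SUP n. F n x)" by (rule LIMSEQ_SUP[OF inc])
      then have "(\<lambda>n. ?F n x) \<longlonglongrightarrow> ?f x"
        using x by (intro tendsto_enn2real) auto
      ultimately show "(\<forall>n. 0 \<le> ?F n x) \<and> incseq (\<lambda>n. ?F n x) \<and> (\<lambda>n. ?F n x) \<longlonglongrightarrow> ?f x" by simp
    qed
    show "bdd_above (range (\<lambda>n. fnorm X (?F n)))" using nC by (intro bdd_aboveI[of _ "max 0 C"]) auto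
  qed measurable
  moreover have "(SUP n. fnorm X (?F n)) \<le> max 0 C" using nC by (intro cSUP_least) auto
  ultimately have "space_gauge X (\<lambda>x. SUP n. F n x) \<le> ennreal (max 0 C)"
    using fin by (simp add: space_gauge_def ennreal_leI)
  also have "ennreal (max 0 C) = ennreal C" by (simp add: max_def ennreal_neg)
  finally show ?thesis .
qed

text \<open>
  If the limit were infinite on a set of positive measure, then by saturation some \<open>A\<close> inside that set would have a positive
  finite gauge. All multiples of its indicator are limits of truncations of the \<open>F n\<close>, hence have gauge at most \<open>C\<close>,
  which is absurd.
\<close>

lemma space_gauge_Fatou:
  assumes m [measurable]: "\<And>n. F n \<in> borel_measurable lebesgue" and inc: "\<And>x. incseq (\<lambda>n. F n x)"
    and le: "\<And>n. space_gauge X (F n) \<le> ennreal C"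
  shows "space_gauge X (\<lambda>x. SUP n. F n x) \<le> ennreal C"
proof (rule space_gauge_Fatou_finite[OF m inc le])
  define E where "E = {x \<in> space lebesgue. (SUP n. F n x) = \<infinity>}"
  have [measurable]: "E \<in> sets lebesgue" unfolding E_def by measurable
  have "emeasure lebesgue E = 0"
  proof (rule ccontr)
    assume "emeasure lebesgue E \<noteq> 0"
    then have pos: "0 < emeasure lebesgue E" by (simp add: zero_less_iff_neq_zero)
    obtain A where A: "A \<in> sets lebesgue" "A \<subseteq> E" "0 < emeasure lebesgue A" "space_gauge X (indicator A) < \<infinity>"
      by (rule space_gauge_saturation[OF \<open>E \<in> sets lebesgue\<close> pos])
    note [measurable] = A(1)
    have "ennreal t * space_gauge X (indicator A) \<le> ennreal C" if t: "0 < t" for t :: real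
    proof -
      let ?H = "\<lambda>n x. min (F n x) (ennreal t * indicator A x)"
      have "(SUP n. ?H n x) = ennreal t * indicator A x" for x
      proof (cases "x \<in> A")
        case True
        then have "(SUP n. F n x) = top" using A(2) by (auto simp: E_def)
        have "ennreal t < (SUP n. F n x)" unfolding \<open>(SUP n. F n x) = top\<close> by simp
        then obtain n where "ennreal t < F n x" unfolding less_SUP_iff by blast
        then have "?H n x = ennreal t" using True by (simp add: min_absorb2 less_imp_le)
        then have "ennreal t \<le> (SUP n. ?H n x)" by (metis SUP_upper UNIV_I)
        moreover have "(SUP n. ?H n x) \<le> ennreal t" using True by (intro SUP_least) simp
        ultimately show ?thesis using True by (simp add: antisym)
      qed simp
      then have "space_gauge X (\<lambda>x. ennreal t * indicator A x) = space_gauge X (\<lambda>x. SUP n. ?H n x)" by simp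
      also have "\<dots> \<le> ennreal C"
      proof (rule space_gauge_Fatou_finite)
        show "incseq (\<lambda>n. ?H n x)" for x
          using inc[of x] unfolding incseq_def by (intro allI impI min.mono) auto
        show "space_gauge X (?H n) \<le> ennreal C" for n
          by (rule order.trans[OF G.mono le[of n]]) auto
        have "(SUP n. ?H n x) < \<infinity>" for x
        proof -
          have "(SUP n. ?H n x) \<le> ennreal t * indicator A x" by (intro SUP_least) simp
          also have "\<dots> < \<infinity>" by (auto simp: indicator_def)
          finally show ?thesis .
        qed
        then show "AE x in lebesgue. (SUP n. ?H n x) < \<infinity>" by simp
      qed measurable
      finally show ?thesis using G.cmult[of "indicator A" t] t by simp
    qed
    moreover obtain a where a: "space_gauge X (indicator A) = ennreal a" "0 < a"
      using A(4) space_gauge_indicator_pos[OF A(1,3)] by (cases "space_gauge X (indicator A)") auto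
    ultimately have "ennreal ((max 0 C + 1) / a) * ennreal a \<le> ennreal C" by (metis divide_pos_pos less_add_one max.cobounded1 order.strict_trans1)
    also have "ennreal C \<le> ennreal (max 0 C)" by (intro ennreal_leI) simp
    finally have "ennreal (max 0 C + 1) \<le> ennreal (max 0 C)"
      using a by (simp add: ennreal_mult[symmetric] del: ennreal_plus)
    then show False by (subst (asm) ennreal_le_iff) auto
  qed
  then have "AE x in lebesgue. x \<notin> E" by (intro AE_not_in null_setsI) auto
  then show "AE x in lebesgue. (SUP n. F n x) < \<infinity>"
  proof (rule eventually_mono)
    fix x assume "x \<notin> E"
    then have "(SUP n. F n x) \<noteq> \<infinity>" unfolding E_def by simp
    then show "(SUP n. F n x) < \<infinity>" unfolding infinity_ennreal_def top.not_eq_extremum .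
  qed
qed

lemma space_gauge_add_le:
  assumes [measurable]: "f \<in> borel_measurable lebesgue" "g \<in> borel_measurable lebesgue"
  shows "space_gauge X (\<lambda>x. f x + g x) \<le> space_gauge X f + space_gauge X g"
proof (cases "space_gauge X f < \<infinity> \<and> space_gauge X g < \<infinity>")
  case True
  let ?f = "\<lambda>x. enn2real (f x)" and ?g = "\<lambda>x. enn2real (g x)"
  have f: "AE x in lebesgue. f x < \<infinity>" "?f \<in> fcarrier X" and g: "AE x in lebesgue. g x < \<infinity>" "?g \<in> fcarrier X"
    using True by (simp_all add: space_gauge_finite)
  have "AE x in lebesgue. f x + g x = ennreal (?f x + ?g x)"
    using f(1) g(1) by eventually_elim (simp add: ennreal_plus)
  then have "space_gauge X (\<lambda>x. f x + g x) = space_gauge X (\<lambda>x. ennreal (?f x + ?g x))"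
    by (intro G.cong_AE) auto
  also have "\<dots> = ennreal (fnorm X (\<lambda>x. ?f x + ?g x))"
    using add_mem[OF f(2) g(2)] by (simp add: space_gauge_def del: ennreal_plus)
  also have "\<dots> \<le> ennreal (fnorm X ?f + fnorm X ?g)" by (intro ennreal_leI norm_triangle f g)
  also have "\<dots> = space_gauge X f + space_gauge X g"
    using f g by (simp add: space_gauge_def norm_nonneg)
  finally show ?thesis .
qed (auto simp: less_top[symmetric])

lemma space_gauge_suminf_le:
  assumes [measurable]: "\<And>n. f n \<in> borel_measurable lebesgue"
  shows "space_gauge X (\<lambda>x. \<Sum>n. f n x) \<le> (\<Sum>n. space_gauge X (f n))"
proof (cases "(\<Sum>n. space_gauge X (f n))")
  case (real C)
  have zero: "space_gauge X (\<lambda>x. 0) = 0"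
    using zero_mem norm_eq_zero_iff[OF zero_mem] by (simp add: space_gauge_def)
  have sum_le: "space_gauge X (\<lambda>x. \<Sum>n<N. f n x) \<le> (\<Sum>n<N. space_gauge X (f n))" for N
  proof (induction N)
    case (Suc N)
    have "space_gauge X (\<lambda>x. \<Sum>n<Suc N. f n x) = space_gauge X (\<lambda>x. (\<Sum>n<N. f n x) + f N x)" by simp
    also have "\<dots> \<le> space_gauge X (\<lambda>x. \<Sum>n<N. f n x) + space_gauge X (f N)"
      by (rule space_gauge_add_le) measurable
    also have "\<dots> \<le> (\<Sum>n<Suc N. space_gauge X (f n))" using Suc.IH by (simp add: add_right_mono)
    finally show ?case .
  qed (simp add: zero)
  have "space_gauge X (\<lambda>x. SUP N. \<Sum>n<N. f n x) \<le> ennreal C"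
  proof (rule space_gauge_Fatou)
    show "incseq (\<lambda>N. \<Sum>n<N. f n x)" for x
      by (auto simp: incseq_def intro!: sum_mono2)
    fix N
    have "(\<Sum>n<N. space_gauge X (f n)) \<le> (\<Sum>n. space_gauge X (f n))" by (rule sum_le_suminf) auto
    with sum_le[of N] show "space_gauge X (\<lambda>x. \<Sum>n<N. f n x) \<le> ennreal C"
      unfolding real by (rule order.trans)
  qed measurable
  then show ?thesis using real by (simp add: suminf_eq_SUP)
qed simp

text \<open>
  Saturation provides one set \<open>E\<close> of positive measure in the space. Its indicator has positive average over a cube \<open>R\<close>
  that contains \<open>Q\<close>, so a multiple of the indicator of \<open>Q\<close> is dominated by the maximal function of the indicator of \<open>E\<close>.
\<close>

lemma space_gauge_norm:
  assumes A: "bounded_maximal (space_gauge X) A"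
  shows "norm_gauge (space_gauge X)"
proof
  fix Q :: "(real^'n) set" assume Q: "Q \<in> cubes"
  have Qm [measurable]: "Q \<in> sets lebesgue" using emeasure_cubes(3)[OF Q] .
  show "0 < space_gauge X (indicator Q)" by (rule space_gauge_indicator_pos[OF emeasure_cubes(3,1)[OF Q]])
  have "0 < emeasure lebesgue (UNIV :: (real^'n) set)" by simp
  then obtain E where E: "E \<in> sets lebesgue" "0 < emeasure lebesgue E" "space_gauge X (indicator E) < \<infinity>"
    by (rule space_gauge_saturation[rotated]) auto
  note [measurable] = E(1)
  let ?P = "\<lambda>n::nat. cube (- vec (real n) :: real^'n) (2 * real n + 1)"
  have P: "?P n \<in> cubes" for n by (rule cubesI) simp
  have Pm: "?P n \<in> sets lebesgue" for n using emeasure_cubes(3)[OF P] .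
  have mono_P: "?P m \<subseteq> ?P n" if "m \<le> n" for m n
  proof
    fix x assume x: "x \<in> ?P m"
    show "x \<in> ?P n" unfolding mem_cube
    proof
      fix i show "(- vec (real n)) $ i \<le> x $ i \<and> x $ i \<le> (- vec (real n)) $ i + (2 * real n + 1)"
        using x[unfolded mem_cube, rule_format, of i] that by simp
    qed
  qed
  have "\<exists>n. 0 < emeasure lebesgue (E \<inter> ?P n)"
  proof (rule ccontr)
    assume "\<not> (\<exists>n. 0 < emeasure lebesgue (E \<inter> ?P n))"
    then have "E \<inter> ?P n \<in> null_sets lebesgue" for n using E(1) Pm by (intro null_setsI) auto
    then have "(\<Union>n. E \<inter> ?P n) \<in> null_sets lebesgue" by (rule null_sets_UN)
    moreover have "E \<subseteq> (\<Union>n. E \<inter> ?P n)"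
    proof
      fix x assume "x \<in> E"
      moreover obtain n where "x \<in> ?P n" by (rule centred_cubes_exhaust)
      ultimately show "x \<in> (\<Union>n. E \<inter> ?P n)" by blast
    qed
    ultimately have "E \<in> null_sets lebesgue" using null_sets_subset[OF _ E(1)] by blast
    then show False using E(2) by auto
  qed
  then obtain n0 where n0: "0 < emeasure lebesgue (E \<inter> ?P n0)" by blast
  obtain p l where pl: "Q = cube p l" "0 < l" using Q by (rule cubesE)
  obtain n1 where n1: "norm p + l \<le> real n1" using real_arch_simple by blast
  have Qsub: "Q \<subseteq> ?P n1"
  proof
    fix x assume x: "x \<in> Q"
    show "x \<in> ?P n1" unfolding mem_cube
    proof
      fix i
      have "\<bar>p $ i\<bar> \<le> norm p" by (rule component_le_norm_cart)
      then show "(- vec (real n1)) $ i \<le> x $ i \<and> x $ i \<le> (- vec (real n1)) $ i + (2 * real n1 + 1)"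
        using x[unfolded pl mem_cube, rule_format, of i] n1 pl(2) by (auto simp: abs_le_iff)
    qed
  qed
  define R where "R = ?P (max n0 n1)"
  have R: "R \<in> cubes" "Q \<subseteq> R" "0 < emeasure lebesgue (E \<inter> R)"
  proof -
    show "R \<in> cubes" unfolding R_def by (rule P)
    show "Q \<subseteq> R" unfolding R_def using Qsub mono_P[of n1 "max n0 n1"] by simp
    have "emeasure lebesgue (E \<inter> ?P n0) \<le> emeasure lebesgue (E \<inter> R)"
      unfolding R_def using mono_P[of n0 "max n0 n1"] E(1) Pm by (intro emeasure_mono) auto
    with n0 show "0 < emeasure lebesgue (E \<inter> R)" by (rule order.strict_trans2)
  qed
  have Rm [measurable]: "R \<in> sets lebesgue" using emeasure_cubes(3)[OF R(1)] .
  define a where "a = avg (indicator E) R"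
  have "0 < a"
  proof -
    have "(\<integral>\<^sup>+ x \<in> R. indicator E x \<partial>lebesgue) = (\<integral>\<^sup>+ x. indicator (E \<inter> R) x \<partial>lebesgue)"
      by (intro nn_integral_cong) (auto simp: indicator_def)
    also have "\<dots> = emeasure lebesgue (E \<inter> R)" by (rule nn_integral_indicator) measurable
    finally show ?thesis using R(3) emeasure_cubes(2)[OF R(1)] by (simp add: a_def avg_def ennreal_zero_less_divide)
  qed
  moreover have "a \<le> 1"
  proof -
    have "(\<integral>\<^sup>+ x \<in> R. indicator E x \<partial>lebesgue) \<le> (\<integral>\<^sup>+ x. indicator R x \<partial>lebesgue)"
      by (intro nn_integral_mono) (auto simp: indicator_def)
    then show ?thesis unfolding a_def by (simp add: avg_le_iff[OF R(1)])
  qed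
  ultimately obtain b where b: "a = ennreal b" "0 < b" by (cases a) (auto simp: top_unique)
  have "ennreal b * space_gauge X (indicator Q) = space_gauge X (\<lambda>x. ennreal b * indicator Q x)"
    by (rule G.cmult[symmetric]) (use b in auto)
  also have "\<dots> \<le> space_gauge X (maximal (indicator E))"
  proof (rule G.mono)
    fix x show "ennreal b * indicator Q x \<le> maximal (indicator E) x"
      using avg_le_maximal[OF R(1), of x "indicator E"] R(2) b a_def by (cases "x \<in> Q") auto
  qed measurable
  also have "\<dots> \<le> ennreal A * space_gauge X (indicator E)" using A by (simp add: bounded_maximal_def)
  also have "\<dots> < \<infinity>" using E(3) by (simp add: ennreal_mult_less_top)
  finally show "space_gauge X (indicator Q) < \<infinity>" using b by (auto simp: ennreal_mult_less_top)
qed (rule space_gauge_suminf_le)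

end

section \<open>The spaces \<open>X\<^bsub>r,s\<^esub>\<close>\<close>

theorem corollary3p3:
  fixes X :: "(real ^ 'n::finite) fun_space"
    and r_star s_star :: real
  assumes "banach_function_space X"
    and "1 < r_star" and "r_star < s_star"
    and "p_convex r_star X" and "q_concave s_star X"
    and "maximal_bounded_on X" and "maximal_bounded_on (associate X)"
  shows "\<exists>r0 \<in> {1<..r_star}. \<exists>s0 \<in> {s_star..}. \<forall>r \<in> {1<..r0}. \<forall>s \<in> {s0..}.
    maximal_bounded_on (rs_space X r s) \<and> maximal_bounded_on (associate (rs_space X r s))"
proof -
  interpret X: banach_function_space X by fact
  define \<rho> where "\<rho> = space_gauge X"
  interpret G: homogeneous_gauge \<rho> unfolding \<rho>_def by (rule X.space_gauge_homogeneous)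
  have rep: "represents X \<rho>" unfolding \<rho>_def by (rule X.space_gauge_represents)
  obtain A where A: "bounded_maximal \<rho> A" using G.maximal_bounded_onE[OF rep assms(6)] .
  interpret N: norm_gauge \<rho> unfolding \<rho>_def by (rule X.space_gauge_norm[OF A[unfolded \<rho>_def]])
  have rep': "represents (associate X) (dual \<rho>)" by (rule G.represents_associate[OF rep])
  interpret D: norm_gauge "dual \<rho>" by (rule N.dual_gauge[OF A])
  obtain A' where A': "bounded_maximal (dual \<rho>) A'" using D.maximal_bounded_onE[OF rep' assms(7)] .
  have A1: "1 \<le> A" using A by (simp add: bounded_maximal_def)
  define B where "B = dual_power_const TYPE('n) A A'"
  define r0 where "r0 = min r_star (self_improve_exp TYPE('n) A)"
  define q0 where "q0 = self_improve_exp TYPE('n) B"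
  \<comment> \<open>the last entry makes \<open>s / (s - r) \<le> q0\<close> for \<open>r \<le> r0\<close>, the middle one keeps \<open>s > r\<close>\<close>
  define s0 where "s0 = max s_star (max (r0 + 1) (q0 * r0 / (q0 - 1)))"
  have r0: "1 < r0" "r0 \<le> r_star" "r0 \<le> self_improve_exp TYPE('n) A"
    using assms(2) self_improve_exp(1)[OF A1, where 'n='n] by (auto simp: r0_def)
  have main: "maximal_bounded_on (rs_space X r s) \<and> maximal_bounded_on (associate (rs_space X r s))"
    if r: "1 < r" "r \<le> r0" and s: "s0 \<le> s" for r s
  proof -
    have r': "r \<le> self_improve_exp TYPE('n) A" using r r0 by simp
    define \<sigma> where "\<sigma> = gauge_power r \<rho>"
    interpret P: cube_gauge \<sigma> unfolding \<sigma>_def using r by (intro N.gauge_power_cube_gauge) simp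
    have bd_\<sigma>: "bounded_maximal \<sigma> ((16 * A\<^sup>2)\<^sup>2)"
      unfolding \<sigma>_def by (rule N.gauge_power_bounded_maximal[OF A r(1) r'])
    have bd_d\<sigma>: "bounded_maximal (dual \<sigma>) B"
      unfolding \<sigma>_def B_def by (rule N.dual_gauge_power_bounded_maximal[OF A A' r(1) r'])
    have bd_dd\<sigma>: "bounded_maximal (dual (dual \<sigma>)) ((16 * A\<^sup>2)\<^sup>2)"
      by (rule P.bidual_bounded_maximal[OF bd_\<sigma>])
    interpret DP: norm_gauge "dual \<sigma>" by (rule P.dual_gauge[OF bd_\<sigma>])
    have B1: "1 \<le> B" using bd_d\<sigma> by (simp add: bounded_maximal_def)
    have q0: "1 < q0" unfolding q0_def by (rule self_improve_exp(1)[OF B1])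
    define q where "q = hoelder_conj (s / r)"
    have sr: "r < s" "q0 * r0 / (q0 - 1) \<le> s" using s r by (auto simp: s0_def)
    have q_eq: "q = s / (s - r)" using sr r by (simp add: q_def hoelder_conj_def field_simps)
    have q1: "1 < q" unfolding q_eq using sr r by (simp add: field_simps)
    have "q0 * r0 \<le> s * (q0 - 1)" using sr(2) q0 by (simp add: field_simps)
    moreover have "q0 * r \<le> q0 * r0" using q0 r by (intro mult_left_mono) auto
    ultimately have "s \<le> q0 * (s - r)" by (simp add: algebra_simps)
    then have q2: "q \<le> self_improve_exp TYPE('n) B"
      unfolding q_eq q0_def[symmetric] using sr by (simp add: divide_le_eq)
    define \<tau> where "\<tau> = gauge_power q (dual \<sigma>)"
    interpret T: cube_gauge \<tau> unfolding \<tau>_def using q1 by (intro DP.gauge_power_cube_gauge) simp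
    have bd_\<tau>: "bounded_maximal \<tau> ((16 * B\<^sup>2)\<^sup>2)"
      unfolding \<tau>_def by (rule DP.gauge_power_bounded_maximal[OF bd_d\<sigma> q1 q2])
    interpret DT: norm_gauge "dual \<tau>" by (rule T.dual_gauge[OF bd_\<tau>])
    have bd_d\<tau>: "bounded_maximal (dual \<tau>) (dual_power_const TYPE('n) B ((16 * A\<^sup>2)\<^sup>2))"
      unfolding \<tau>_def by (rule DP.dual_gauge_power_bounded_maximal[OF bd_d\<sigma> bd_dd\<sigma> q1 q2])
    interpret DDT: norm_gauge "dual (dual \<tau>)" by (rule DT.dual_gauge[OF bd_d\<tau>])
    have bd_dd\<tau>: "bounded_maximal (dual (dual \<tau>)) ((16 * B\<^sup>2)\<^sup>2)"
      by (rule T.bidual_bounded_maximal[OF bd_\<tau>])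
    have "represents (space_power X r) \<sigma>"
      unfolding \<sigma>_def using r by (intro represents_power rep) simp
    then have "represents (associate (space_power X r)) (dual \<sigma>)" by (rule P.represents_associate)
    then have "represents (space_power (associate (space_power X r)) q) \<tau>"
      unfolding \<tau>_def using q1 by (intro represents_power) simp_all
    then have rs: "represents (rs_space X r s) (dual \<tau>)"
      unfolding rs_space_def q_def[symmetric] by (rule T.represents_associate)
    then have "represents (associate (rs_space X r s)) (dual (dual \<tau>))" by (rule DT.represents_associate)
    then show ?thesis
      using DT.maximal_bounded_onI[OF rs bd_d\<tau>] DDT.maximal_bounded_onI[OF _ bd_dd\<tau>] by blast
  qed
  have "r0 \<in> {1<..r_star}" "s0 \<in> {s_star..}" using r0 by (auto simp: s0_def)
  with main show ?thesis by (intro bexI[of _ r0] bexI[of _ s0]) auto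
qed

end
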